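(* Assume $\beta>\max(H,H_0)$ and consider the stationary sequence $\{Q_i\}_{i\ge1}$ with $Q_i=\sup_{t\ge0}\left(X_i(t)+\sigma_0X(t)-ct^\beta\right)$. If $\beta\ge 2H-H_0$, then $\{Q_i\}_{i\ge1}$ does not admit a phantom distribution function. If $\beta<2H-H_0$, then $\{Q_i\}_{i\ge1}$ admits a continuous phantom distribution function.
   Context: A stationary sequence $\{\xi_i\}_{i\ge1}$ is said to admit a phantom distribution function $G$ (a distribution function on $\mathbb{R}$) if $\mathbb{P}\{\max_{i\le n}\xi_i\le u_n\}-G^n(u_n)\to0$ as $n\to\infty$ for every sequence $\{u_n\}_{n\ge1}\subset\mathbb{R}$. Let $H,H_0\in(0,1)$, $\sigma_0>0$, $c>0$. Let $\{X_i(t),t\ge0\}$, $i\ge1$, be independent copies of a centered Gaussian process $\{X_H(t),t\ge 0\}$ with a.s. continuous sample paths, self-similar with index $H$ (i.e. $\{X_H(at)\}_{t\ge0}\overset{d}{=}\{a^HX_H(t)\}_{t\ge0}$ for all $a>0$) and variance function $t^{2H}$. Let $\{X(t),t\ge0\}$ be a centered self-similar Gaussian process with a.s. continuous sample paths, index $H_0$ and variance function $t^{2H_0}$, independent of $\{X_i\}_{i\ge1}$. Put $t_0=\left(\frac{H}{c(\beta-H)}\right)^{1/\beta}$. Local stationarity assumption: with $\overline X_H(t)=X_H(t)/t^H$, $t>0$, $$\lim_{s,t\to t_0}\frac{\mathbb{E}\{(\overline X_H(s)-\overline X_H(t))^2\}}{K^2(|s-t|)}=1$$ for some positive function $K(\cdot)$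 regularly varying at $0$ with index $\alpha/2\in(0,1)$. *)

theory Defs
  imports "HOL-Probability.Probability"
begin

text \<open>
  A process \<open>{X t, t \<ge> 0}\<close> is a function \<open>real \<Rightarrow> 'w \<Rightarrow> real\<close> of which only the times \<open>t \<ge> 0\<close> are
  relevant. Laws of processes and independence of processes refer to the cylinder
  \<open>\<sigma>\<close>-algebra on functions on \<open>[0,\<infinity>)\<close>.
\<close>

abbreviation path_space :: "(real \<Rightarrow> real) measure" where
  "path_space \<equiv> PiM {0..} (\<lambda>_. borel)"

definition sample_path :: "(real \<Rightarrow> 'w \<Rightarrow> real) \<Rightarrow> 'w \<Rightarrow> real \<Rightarrow> real" where
  "sample_path X \<omega> = (\<lambda>t\<in>{0..}. X t \<omega>)"

definition process_law :: "'w measure \<Rightarrow> (real \<Rightarrow> 'w \<Rightarrow> real) \<Rightarrow> (real \<Rightarrow> real) measure" where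
  "process_law M X = distr M path_space (sample_path X)"

definition stochastic_process :: "'w measure \<Rightarrow> (real \<Rightarrow> 'w \<Rightarrow> real) \<Rightarrow> bool" where
  "stochastic_process M X \<longleftrightarrow> prob_space M \<and> (\<forall>t\<ge>0. X t \<in> borel_measurable M)"

definition as_continuous_paths :: "'w measure \<Rightarrow> (real \<Rightarrow> 'w \<Rightarrow> real) \<Rightarrow> bool" where
  "as_continuous_paths M X \<longleftrightarrow> (AE \<omega> in M. continuous_on {0..} (\<lambda>t. X t \<omega>))"

text \<open>The second disjunct is the degenerate normal law with variance 0.\<close>

definition centered_normal :: "'w measure \<Rightarrow> ('w \<Rightarrow> real) \<Rightarrow> bool" where
  "centered_normal M Y \<longleftrightarrow>
     (\<exists>\<sigma>>0. distributed M lborel Y (normal_density 0 \<sigma>)) \<or> (AE \<omega> in M. Y \<omega> = 0)"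

definition centered_gaussian_process :: "'w measure \<Rightarrow> (real \<Rightarrow> 'w \<Rightarrow> real) \<Rightarrow> bool" where
  "centered_gaussian_process M X \<longleftrightarrow>
     stochastic_process M X \<and>
     (\<forall>F a. finite F \<and> F \<subseteq> {0..} \<longrightarrow> centered_normal M (\<lambda>\<omega>. \<Sum>t\<in>F. a t * X t \<omega>))"

definition self_similar :: "'w measure \<Rightarrow> real \<Rightarrow> (real \<Rightarrow> 'w \<Rightarrow> real) \<Rightarrow> bool" where
  "self_similar M H X \<longleftrightarrow>
     (\<forall>a>0. process_law M (\<lambda>t. X (a * t)) = process_law M (\<lambda>t \<omega>. a powr H * X t \<omega>))"

definition self_similar_gaussian :: "'w measure \<Rightarrow> real \<Rightarrow> (real \<Rightarrow> 'w \<Rightarrow> real) \<Rightarrow> bool" where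
  "self_similar_gaussian M H X \<longleftrightarrow>
     centered_gaussian_process M X \<and> as_continuous_paths M X \<and> self_similar M H X \<and>
     (\<forall>t\<ge>0. prob_space.variance M (X t) = t powr (2 * H))"

text \<open>
  Almost sure continuity is not determined by the law on the cylinder \<open>\<sigma>\<close>-algebra, so it is
  required of each copy separately.
\<close>

definition independent_copies ::
  "'w measure \<Rightarrow> (nat \<Rightarrow> real \<Rightarrow> 'w \<Rightarrow> real) \<Rightarrow> 'v measure \<Rightarrow> (real \<Rightarrow> 'v \<Rightarrow> real) \<Rightarrow> bool" where
  "independent_copies M Xs N Y \<longleftrightarrow>
     (\<forall>i\<ge>1. stochastic_process M (Xs i) \<and> as_continuous_paths M (Xs i) \<and>
             process_law M (Xs i) = process_law N Y) \<and>
     prob_space.indep_vars M (\<lambda>_. path_space) (\<lambda>i. sample_path (Xs i)) {1..}"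

text \<open>
  Independence of the generated \<open>\<sigma>\<close>-algebras; \<open>indep_var\<close> would need both random elements to
  have values in the same type.
\<close>

definition independent_of_sequence ::
  "'w measure \<Rightarrow> (real \<Rightarrow> 'w \<Rightarrow> real) \<Rightarrow> (nat \<Rightarrow> real \<Rightarrow> 'w \<Rightarrow> real) \<Rightarrow> bool" where
  "independent_of_sequence M X Xs \<longleftrightarrow>
     prob_space.indep_set M
       (sets (vimage_algebra (space M) (sample_path X) path_space))
       (sets (vimage_algebra (space M) (\<lambda>\<omega>. \<lambda>i\<in>{1..}. sample_path (Xs i) \<omega>)
                (PiM {1..} (\<lambda>_. path_space))))"

definition regularly_varying_at_0 :: "real \<Rightarrow> (real \<Rightarrow> real) \<Rightarrow> bool" where
  "regularly_varying_at_0 \<rho> K \<longleftrightarrow>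
     K \<in> borel_measurable (restrict_space borel {0<..}) \<and> (\<forall>x>0. K x > 0) \<and>
     (\<forall>l>0. ((\<lambda>x. K (l * x) / K x) \<longlongrightarrow> l powr \<rho>) (at_right 0))"

definition t_zero :: "real \<Rightarrow> real \<Rightarrow> real \<Rightarrow> real" where
  "t_zero H c \<beta> = (H / (c * (\<beta> - H))) powr (1 / \<beta>)"

text \<open>The ratio is meaningful off the diagonal only, so the double limit is taken over \<open>s \<noteq> t\<close>.\<close>

definition locally_stationary_at ::
  "'w measure \<Rightarrow> real \<Rightarrow> (real \<Rightarrow> 'w \<Rightarrow> real) \<Rightarrow> (real \<Rightarrow> real) \<Rightarrow> real \<Rightarrow> bool" where
  "locally_stationary_at N H Y K t0 \<longleftrightarrow>
     ((\<lambda>(s, t). (\<integral>\<omega>. (Y s \<omega> / s powr H - Y t \<omega> / t powr H)\<^sup>2 \<partial>N) / (K \<bar>s - t\<bar>)\<^sup>2) \<longlongrightarrow> 1)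
       (at (t0, t0) within {(s, t). s \<noteq> t})"

text \<open>
  Under the hypotheses of the theorem the supremum is almost surely finite; on the exceptional
  null set the real-valued supremum of an unbounded set is an arbitrary value.
  As path continuity is only almost sure, the supremum over uncountably many times is measurable
  with respect to the completion of the underlying measure, but not necessarily with respect to
  the measure itself.
\<close>

definition sup_with_drift ::
  "(nat \<Rightarrow> real \<Rightarrow> 'w \<Rightarrow> real) \<Rightarrow> (real \<Rightarrow> 'w \<Rightarrow> real) \<Rightarrow> real \<Rightarrow> real \<Rightarrow> real \<Rightarrow> nat \<Rightarrow> 'w \<Rightarrow> real" where
  "sup_with_drift Xs X \<sigma>0 c \<beta> i \<omega> = (SUP t\<in>{0..}. Xs i t \<omega> + \<sigma>0 * X t \<omega> - c * t powr \<beta>)"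

text \<open>Sequences are indexed by \<open>i \<ge> 1\<close>; the empty maximum at \<open>n = 0\<close> does not affect the limit.\<close>

definition phantom_df :: "'w measure \<Rightarrow> (nat \<Rightarrow> 'w \<Rightarrow> real) \<Rightarrow> (real \<Rightarrow> real) \<Rightarrow> bool" where
  "phantom_df M \<xi> G \<longleftrightarrow>
     (\<exists>\<mu>. real_distribution \<mu> \<and> G = cdf \<mu>) \<and>
     (\<forall>u :: nat \<Rightarrow> real.
        (\<lambda>n. measure M {\<omega> \<in> space M. (MAX i\<in>{1..n}. \<xi> i \<omega>) \<le> u n} - G (u n) ^ n) \<longlonglongrightarrow> 0)"

end

theory Submission
  imports Defs
begin

text \<open>
  Given the common input \<open>X\<close>, the variables \<open>Q\<^sub>i\<close> are independent and identically distributed, so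
  \<open>P(max Q\<^sub>i \<le> u) = E ((1 - T(u, X)) ^ n)\<close>, where \<open>T(u, X)\<close> is the conditional tail of one of them
  (\<open>measure_max_event_eq\<close>). A phantom distribution function exists if this tail is asymptotically
  deterministic, and only if it does not fluctuate by a factor. The time change
  \<open>t = u powr (1 / \<beta>) * s\<close> and self-similarity turn \<open>T(u, X)\<close> into the probability that \<open>XH\<close> crosses
  \<open>x * (1 + c * s powr \<beta>) - y * X s\<close> for some \<open>s\<close>, where \<open>x = u powr (1 - H / \<beta>)\<close>,
  \<open>y = \<sigma>0 * u powr ((H0 - H) / \<beta>)\<close>. The most likely crossing time is the constant
  \<open>s0 = t_zero H c \<beta>\<close>, and there \<open>XH\<close> has order \<open>x\<close>. Hence perturbing the barrier by
  \<open>y * X s\<close> changes the probability by a factor \<open>exp\<close> of order \<open>x * y * X s0\<close>, and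
  \<open>x * y = \<sigma>0 * u powr (1 + (H0 - 2 * H) / \<beta>)\<close> tends to zero exactly if \<open>\<beta> < 2 * H - H0\<close>.

  Exact tail asymptotics are avoided by means of the Cameron--Martin formula (\<open>cameron_martin\<close>):
  translating a Gaussian process by a multiple \<open>\<theta>\<close> of its covariance function at \<open>s0\<close> gives its law the density
  \<open>exp (\<theta> * XH s0 - \<theta>\<^sup>2 * Var (XH s0) / 2)\<close>, and near \<open>s0\<close> the translation compares with a change of
  the barrier. To use it, crossings far from \<open>s0\<close> or with an untypical value of \<open>XH s0\<close> must be
  negligible compared with the crossing at \<open>s0\<close> itself (\<open>atypical_negligible\<close>). This is large
  deviations at the level of exponents: Fernique's inequality (\<open>fernique\<close>) shows that
  the oscillation over a short interval, or over a neighbourhood of infinity, has a tail as light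
  as desired, and compactness leaves finitely many intervals.

  If \<open>\<beta> < 2 * H - H0\<close>, the tail of \<open>sup (XH / barrier)\<close> does not feel shifts of the level \<open>x\<close> by
  \<open>o(1 / x)\<close> (\<open>hit_prob_long_tailed\<close>), so that the conditional tail is close to the tail without \<open>X\<close>,
  and any continuous distribution function with an equivalent tail is a phantom distribution
  function. If \<open>\<beta> \<ge> 2 * H - H0\<close>, translating \<open>X\<close> by a fixed multiple of its own covariance
  function at \<open>s0\<close> at least doubles the conditional tail for large \<open>u\<close> (\<open>hit_prob_doubling\<close>). A phantom distribution function
  would force the variance of \<open>(1 - T(u, X)) ^ n\<close> to vanish uniformly in \<open>u\<close> as \<open>n\<close> grows;
  by absolute continuity the same limit would have to be approached after the translation, a contradiction.
\<close>

section \<open>The Cramer--Wold device\<close>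

text \<open>
  Levy uniqueness is available for probability measures; the case of total mass 0 is separate and
  the others follow by normalisation.
\<close>

lemma finite_measure_eq_of_char_eq:
  fixes M1 M2 :: "real measure"
  assumes fin: "finite_measure M1" "finite_measure M2"
    and sets: "sets M1 = sets borel" "sets M2 = sets borel"
    and char: "\<And>t. char M1 t = char M2 t"
  shows "M1 = M2"
proof -
  interpret M1: finite_measure M1 by fact
  interpret M2: finite_measure M2 by fact
  have sp: "space M1 = UNIV" "space M2 = UNIV" using sets[THEN sets_eq_imp_space_eq] by simp_all
  define T where "T = measure M1 UNIV"
  have c1: "char M1 0 = complex_of_real (measure M1 UNIV)" "char M2 0 = complex_of_real (measure M2 UNIV)"
    by (simp_all add: char_def sp scaleR_conv_of_real)
  with char have T2: "T = measure M2 UNIV" unfolding T_def by (metis of_real_eq_iff)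
  have T0: "T \<ge> 0" by (simp add: T_def)
  show ?thesis
  proof (cases "T = 0")
    case True
    have "emeasure M1 A = 0" "emeasure M2 A = 0" for A
    proof -
      have "measure M1 A \<le> measure M1 (space M1)" "measure M2 A \<le> measure M2 (space M2)"
        by (rule M1.bounded_measure, rule M2.bounded_measure)
      then show "emeasure M1 A = 0" "emeasure M2 A = 0"
        using True T2 T_def sp
        by (simp_all add: M1.emeasure_eq_measure M2.emeasure_eq_measure measure_le_0_iff)
    qed
    then show ?thesis by (intro measure_eqI) (auto simp: sets)
  next
    case False
    with T0 have Tp: "T > 0" by simp
    define N where "N = (\<lambda>M::real measure. density M (\<lambda>_. ennreal (1/T)))"
    have rd: "real_distribution (N M)" if f: "finite_measure M" and s: "sets M = sets borel" and m: "measure M UNIV = T" for M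
    proof -
      interpret finite_measure M by fact
      have sp: "space M = UNIV" using s[THEN sets_eq_imp_space_eq] by simp
      have "emeasure (N M) (space M) = ennreal (1/T) * ennreal T"
        by (simp add: N_def emeasure_density_const sp s emeasure_eq_measure m)
      also have "\<dots> = 1" using Tp by (simp flip: ennreal_mult')
      finally have "prob_space (N M)" by (intro prob_spaceI) (simp add: N_def)
      then show ?thesis unfolding real_distribution_def real_distribution_axioms_def
        using s sp by (simp add: N_def)
    qed
    have ch: "char (N M) t = complex_of_real (1/T) * char M t" if s: "sets M = sets borel" for M t
    proof -
      have [measurable_cong]: "sets M = sets borel" by fact
      have "char (N M) t = (\<integral>x. (1/T) *\<^sub>R iexp (t * x) \<partial>M)"
        unfolding char_def N_def using Tp by (subst integral_density) auto
      then show ?thesis by (simp add: char_def scaleR_conv_of_real)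
    qed
    have "N M1 = N M2"
      using T2 by (intro Levy_uniqueness rd fin sets ext) (auto simp: ch sets char T_def)
    then have *: "emeasure (N M1) A = emeasure (N M2) A" for A by simp
    have "emeasure M1 A = emeasure M2 A" if "A \<in> sets M1" for A
    proof -
      have A: "A \<in> sets M1" "A \<in> sets M2" using that sets by auto
      have "ennreal (1/T) * emeasure M1 A = ennreal (1/T) * emeasure M2 A"
        using * [of A] A by (simp add: N_def emeasure_density nn_integral_cmult_indicator)
      then show ?thesis using Tp by (simp add: ennreal_mult_cancel_left)
    qed
    then show ?thesis by (intro measure_eqI) (auto simp: sets)
  qed
qed

text \<open>
  One coordinate \<open>Y\<close> is localised to a set \<open>B\<close> while the other stays in the exponent. The weight
  \<open>1 + cos (S + \<phi>)\<close> is nonnegative and a combination of exponentials, so the law of \<open>Y\<close> under the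
  weighted measure is determined by the joint characteristic function; varying \<open>\<phi>\<close> recovers \<open>iexp S\<close>.
\<close>

lemma integral_indicator_iexp_eq:
  fixes P :: "'a measure" and Q :: "'b measure"
  assumes fin: "finite_measure P" "finite_measure Q"
    and meas: "Y \<in> borel_measurable P" "S \<in> borel_measurable P"
       "Z \<in> borel_measurable Q" "T \<in> borel_measurable Q"
    and eq: "\<And>s t. (\<integral>\<omega>. iexp (t * Y \<omega> + s * S \<omega>) \<partial>P) = (\<integral>\<omega>. iexp (t * Z \<omega> + s * T \<omega>) \<partial>Q)"
    and B: "B \<in> sets borel"
  shows "(\<integral>\<omega>. indicator B (Y \<omega>) *\<^sub>R iexp (S \<omega>) \<partial>P) = (\<integral>\<omega>. indicator B (Z \<omega>) *\<^sub>R iexp (T \<omega>) \<partial>Q)"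
proof -
  have wt: "complex_of_real (1 + cos (s + \<phi>)) =
      1 + (1/2) * iexp \<phi> * iexp s + (1/2) * iexp (-\<phi>) * iexp (- s)" for s \<phi>
    unfolding cis_conv_exp [symmetric] by (simp add: complex_eq_iff cos_add add_divide_distrib diff_divide_distrib)
  have aux: "char (distr (density P (\<lambda>\<omega>. ennreal (1 + cos (S \<omega> + \<phi>)))) borel Y) t =
      (\<integral>\<omega>. iexp (t * Y \<omega> + 0 * S \<omega>) \<partial>P) + (1/2) * iexp \<phi> * (\<integral>\<omega>. iexp (t * Y \<omega> + 1 * S \<omega>) \<partial>P)
       + (1/2) * iexp (-\<phi>) * (\<integral>\<omega>. iexp (t * Y \<omega> + (-1) * S \<omega>) \<partial>P)"
    and auxf: "finite_measure (distr (density P (\<lambda>\<omega>. ennreal (1 + cos (S \<omega> + \<phi>)))) borel Y)"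
    and auxm: "measure (distr (density P (\<lambda>\<omega>. ennreal (1 + cos (S \<omega> + \<phi>)))) borel Y) B
      = (\<integral>\<omega>. indicator B (Y \<omega>) \<partial>P) + (\<integral>\<omega>. indicator B (Y \<omega>) * cos (S \<omega> + \<phi>) \<partial>P)"
    if "finite_measure P" and [measurable]: "Y \<in> borel_measurable P" "S \<in> borel_measurable P"
    for P :: "'c measure" and Y S \<phi> t
  proof -
    interpret finite_measure P by fact
    have nn: "0 \<le> 1 + cos x" for x :: real using cos_ge_minus_one[of x] by linarith
    have b: "integrable P (\<lambda>\<omega>. iexp (t * Y \<omega> + s * S \<omega>))" for s
      by (intro integrable_const_bound[where B=1]) auto
    have ex: "iexp (t * y + 0 * s) = iexp (t * y)" "iexp (t * y + 1 * s) = iexp (t * y) * iexp s"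
      "iexp (t * y + (-1) * s) = iexp (t * y) * iexp (- s)" for y s
      by (simp_all flip: exp_add add: distrib_left right_diff_distrib)
    have "char (distr (density P (\<lambda>\<omega>. ennreal (1 + cos (S \<omega> + \<phi>)))) borel Y) t =
        (\<integral>\<omega>. (1 + cos (S \<omega> + \<phi>)) *\<^sub>R iexp (t * Y \<omega>) \<partial>P)"
      unfolding char_def by (subst integral_distr, measurable) (subst integral_density, auto simp: nn)
    also have "\<dots> = (\<integral>\<omega>. iexp (t * Y \<omega> + 0 * S \<omega>) + (1/2) * iexp \<phi> * iexp (t * Y \<omega> + 1 * S \<omega>)
         + (1/2) * iexp (-\<phi>) * iexp (t * Y \<omega> + (-1) * S \<omega>) \<partial>P)"
      unfolding scaleR_conv_of_real wt ex
      by (intro Bochner_Integration.integral_cong refl) (simp only: distrib_right distrib_left mult_1_left mult_ac)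
    also have "\<dots> = (\<integral>\<omega>. iexp (t * Y \<omega> + 0 * S \<omega>) \<partial>P) + (1/2) * iexp \<phi> * (\<integral>\<omega>. iexp (t * Y \<omega> + 1 * S \<omega>) \<partial>P)
       + (1/2) * iexp (-\<phi>) * (\<integral>\<omega>. iexp (t * Y \<omega> + (-1) * S \<omega>) \<partial>P)"
      using b[of 0] b[of 1] b[of "-1"]
      by (simp add: Bochner_Integration.integral_add integrable_mult_right
            del: of_real_add of_real_mult)
    finally show "char (distr (density P (\<lambda>\<omega>. ennreal (1 + cos (S \<omega> + \<phi>)))) borel Y) t = \<dots>" .
    have i1: "integrable P (\<lambda>\<omega>. 1 + cos (S \<omega> + \<phi>))"
      by (intro Bochner_Integration.integrable_add integrable_const_bound[where B=1]) auto
    have "finite_measure (density P (\<lambda>\<omega>. ennreal (1 + cos (S \<omega> + \<phi>))))"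
      using i1 nn by (intro finite_measureI)
         (auto simp: emeasure_density nn_integral_eq_integral)
    then show "finite_measure (distr (density P (\<lambda>\<omega>. ennreal (1 + cos (S \<omega> + \<phi>)))) borel Y)"
      by (intro finite_measure.finite_measure_distr) auto
    have Y: "Y -` B \<inter> space P \<in> sets P" using B by measurable
    have i2: "integrable P (\<lambda>\<omega>. indicator B (Y \<omega>) :: real)" "integrable P (\<lambda>\<omega>. indicator B (Y \<omega>) * cos (S \<omega> + \<phi>) :: real)"
      using B by (intro integrable_const_bound[where B=1]; auto simp: indicator_def abs_mult)+
    have "emeasure (distr (density P (\<lambda>\<omega>. ennreal (1 + cos (S \<omega> + \<phi>)))) borel Y) B
       = (\<integral>\<^sup>+\<omega>. ennreal (indicator B (Y \<omega>) * (1 + cos (S \<omega> + \<phi>))) \<partial>P)"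
      using B Y by (subst emeasure_distr) (auto simp: emeasure_density intro!: nn_integral_cong split: split_indicator)
    also have "\<dots> = ennreal (\<integral>\<omega>. indicator B (Y \<omega>) * (1 + cos (S \<omega> + \<phi>)) \<partial>P)"
    proof (rule nn_integral_eq_integral)
      show "integrable P (\<lambda>\<omega>. indicator B (Y \<omega>) * (1 + cos (S \<omega> + \<phi>)))" using i2 by (simp add: distrib_left)
    qed (simp add: nn)
    finally have "measure (distr (density P (\<lambda>\<omega>. ennreal (1 + cos (S \<omega> + \<phi>)))) borel Y) B
       = (\<integral>\<omega>. indicator B (Y \<omega>) * (1 + cos (S \<omega> + \<phi>)) \<partial>P)"
      by (simp add: measure_def integral_nonneg_AE nn)
    then show "measure (distr (density P (\<lambda>\<omega>. ennreal (1 + cos (S \<omega> + \<phi>)))) borel Y) B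
      = (\<integral>\<omega>. indicator B (Y \<omega>) \<partial>P) + (\<integral>\<omega>. indicator B (Y \<omega>) * cos (S \<omega> + \<phi>) \<partial>P)"
      using i2 by (simp add: distrib_left)
  qed
  have D: "distr (density P (\<lambda>\<omega>. ennreal (1 + cos (S \<omega> + \<phi>)))) borel Y =
        distr (density Q (\<lambda>\<omega>. ennreal (1 + cos (T \<omega> + \<phi>)))) borel Z" for \<phi>
    by (intro finite_measure_eq_of_char_eq auxf fin meas) (auto simp only: aux fin meas eq sets_distr)
  define p q where "p = (\<lambda>\<phi>. \<integral>\<omega>. indicator B (Y \<omega>) * cos (S \<omega> + \<phi>) \<partial>P)"
    and "q = (\<lambda>\<phi>. \<integral>\<omega>. indicator B (Z \<omega>) * cos (T \<omega> + \<phi>) \<partial>Q)"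
  define p0 q0 where "p0 = (\<integral>\<omega>. indicator B (Y \<omega>) \<partial>P :: real)" and "q0 = (\<integral>\<omega>. indicator B (Z \<omega>) \<partial>Q :: real)"
  have pq: "p0 + p \<phi> = q0 + q \<phi>" for \<phi>
    using arg_cong[OF D[of \<phi>], of "\<lambda>M. measure M B"]
    unfolding auxm[OF fin(1) meas(1,2)] auxm[OF fin(2) meas(3,4)] p_def q_def p0_def q0_def .
  have neg: "p pi = - p 0" "q pi = - q 0" by (simp_all add: p_def q_def)
  have e0: "p 0 = q 0" using pq[of 0] pq[of pi] neg by linarith
  then have e1: "p (-pi/2) = q (-pi/2)" using pq[of 0] pq[of "-pi/2"] by linarith
  have sn: "cos (x + - pi/2) = sin x" for x :: real using sin_cos_eq[of x] cos_minus[of "pi/2 - x"] by simp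
  have split: "(\<integral>\<omega>. indicator B (Y \<omega>) *\<^sub>R iexp (S \<omega>) \<partial>P) =
      complex_of_real (\<integral>\<omega>. indicator B (Y \<omega>) * cos (S \<omega> + 0) \<partial>P)
       + \<i> * complex_of_real (\<integral>\<omega>. indicator B (Y \<omega>) * cos (S \<omega> + (-pi/2)) \<partial>P)"
    if "finite_measure P" and [measurable]: "Y \<in> borel_measurable P" "S \<in> borel_measurable P"
    for P :: "'c measure" and Y S
  proof -
    interpret finite_measure P by fact
    have i: "integrable P (\<lambda>\<omega>. complex_of_real (indicator B (Y \<omega>) * cos (S \<omega>)))"
       "integrable P (\<lambda>\<omega>. complex_of_real (indicator B (Y \<omega>) * sin (S \<omega>)))"
      using B by (intro integrable_of_real integrable_const_bound[where B=1]; auto simp: indicator_def abs_mult)+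
    have "(\<integral>\<omega>. indicator B (Y \<omega>) *\<^sub>R iexp (S \<omega>) \<partial>P) =
      (\<integral>\<omega>. complex_of_real (indicator B (Y \<omega>) * cos (S \<omega>)) + \<i> * complex_of_real (indicator B (Y \<omega>) * sin (S \<omega>)) \<partial>P)"
      unfolding cis_conv_exp [symmetric]
      by (intro Bochner_Integration.integral_cong refl) (simp add: complex_eq_iff)
    also have "\<dots> = (\<integral>\<omega>. complex_of_real (indicator B (Y \<omega>) * cos (S \<omega>)) \<partial>P)
        + (\<integral>\<omega>. \<i> * complex_of_real (indicator B (Y \<omega>) * sin (S \<omega>)) \<partial>P)"
      using i by (intro Bochner_Integration.integral_add integrable_mult_right)
    finally show ?thesis
      unfolding sn Bochner_Integration.integral_mult_right_zero integral_complex_of_real by simp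
  qed
  show ?thesis
    unfolding split[OF fin(1) meas(1,2)] split[OF fin(2) meas(3,4)]
    using e0 e1 unfolding p_def q_def by simp
qed

text \<open>
  The Cramer--Wold device, by induction on the number of coordinates: restricting both measures to
  \<open>{Y j \<in> B j}\<close> and \<open>{Z j \<in> B j}\<close> preserves the equality of the characteristic functions of the
  other coordinates.
\<close>

lemma cramer_wold_rectangles:
  fixes P :: "'a measure" and Q :: "'b measure" and Y :: "'i \<Rightarrow> 'a \<Rightarrow> real" and Z :: "'i \<Rightarrow> 'b \<Rightarrow> real"
  assumes "finite F" "finite_measure P" "finite_measure Q"
    and "\<And>i. i \<in> F \<Longrightarrow> Y i \<in> borel_measurable P" "\<And>i. i \<in> F \<Longrightarrow> Z i \<in> borel_measurable Q"
    and "\<And>a. (\<integral>\<omega>. iexp (\<Sum>i\<in>F. a i * Y i \<omega>) \<partial>P) = (\<integral>\<omega>. iexp (\<Sum>i\<in>F. a i * Z i \<omega>) \<partial>Q)"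
    and "\<And>i. i \<in> F \<Longrightarrow> B i \<in> sets borel"
  shows "emeasure P {\<omega>\<in>space P. \<forall>i\<in>F. Y i \<omega> \<in> B i} = emeasure Q {\<omega>\<in>space Q. \<forall>i\<in>F. Z i \<omega> \<in> B i}"
  using assms
proof (induction F arbitrary: P Q)
  case empty
  interpret P: finite_measure P by fact
  interpret Q: finite_measure Q by fact
  have "complex_of_real (measure P (space P)) = complex_of_real (measure Q (space Q))"
    using empty(5) by simp
  then show ?case by (simp add: P.emeasure_eq_measure Q.emeasure_eq_measure)
next
  case (insert j F)
  interpret P: finite_measure P by fact
  interpret Q: finite_measure Q by fact
  have [measurable]: "Y j \<in> borel_measurable P" "Z j \<in> borel_measurable Q" "B j \<in> sets borel"
    using insert.prems by auto
  have YF [measurable]: "i \<in> F \<Longrightarrow> Y i \<in> borel_measurable P" "i \<in> F \<Longrightarrow> Z i \<in> borel_measurable Q" for i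
    using insert.prems by auto
  define P' where "P' = density P (\<lambda>\<omega>. ennreal (indicator (B j) (Y j \<omega>)))"
  define Q' where "Q' = density Q (\<lambda>\<omega>. ennreal (indicator (B j) (Z j \<omega>)))"
  have fin: "finite_measure P'" "finite_measure Q'"
  proof -
    have "(\<integral>\<^sup>+\<omega>. ennreal (indicator (B j) (Y j \<omega>)) \<partial>P) \<le> (\<integral>\<^sup>+\<omega>. 1 \<partial>P)"
      "(\<integral>\<^sup>+\<omega>. ennreal (indicator (B j) (Z j \<omega>)) \<partial>Q) \<le> (\<integral>\<^sup>+\<omega>. 1 \<partial>Q)"
      by (intro nn_integral_mono; simp add: indicator_def)+
    then show "finite_measure P'" "finite_measure Q'"
      using P.emeasure_finite Q.emeasure_finite
      by (auto intro!: finite_measureI simp: P'_def Q'_def emeasure_density top_unique)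
  qed
  have *: "(\<integral>\<omega>. iexp (\<Sum>i\<in>F. a i * Y i \<omega>) \<partial>P') = (\<integral>\<omega>. iexp (\<Sum>i\<in>F. a i * Z i \<omega>) \<partial>Q')" for a
  proof -
    have "(\<integral>\<omega>. indicator (B j) (Y j \<omega>) *\<^sub>R iexp (\<Sum>i\<in>F. a i * Y i \<omega>) \<partial>P) =
       (\<integral>\<omega>. indicator (B j) (Z j \<omega>) *\<^sub>R iexp (\<Sum>i\<in>F. a i * Z i \<omega>) \<partial>Q)"
    proof (rule integral_indicator_iexp_eq)
      fix s t
      define b where "b = (\<lambda>i. if i = j then t else s * a i)"
      have "(\<Sum>i\<in>insert j F. b i * V i) = t * V j + s * (\<Sum>i\<in>F. a i * V i)" for V :: "'i \<Rightarrow> real"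
        using insert.hyps by (simp add: b_def sum_distrib_left mult.assoc) (intro sum.cong, auto)
      then show "(\<integral>\<omega>. iexp (t * Y j \<omega> + s * (\<Sum>i\<in>F. a i * Y i \<omega>)) \<partial>P) =
         (\<integral>\<omega>. iexp (t * Z j \<omega> + s * (\<Sum>i\<in>F. a i * Z i \<omega>)) \<partial>Q)"
        using insert.prems(5)[of b] by simp
    qed (use insert.prems YF in \<open>auto\<close>)
    then show ?thesis
      unfolding P'_def Q'_def by (subst (1 2) integral_density) auto
  qed
  have "emeasure P' {\<omega>\<in>space P'. \<forall>i\<in>F. Y i \<omega> \<in> B i} = emeasure Q' {\<omega>\<in>space Q'. \<forall>i\<in>F. Z i \<omega> \<in> B i}"
    using insert.prems fin * by (intro insert.IH) (auto simp: P'_def Q'_def)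
  moreover have "emeasure P' {\<omega>\<in>space P'. \<forall>i\<in>F. Y i \<omega> \<in> B i} = emeasure P {\<omega>\<in>space P. \<forall>i\<in>insert j F. Y i \<omega> \<in> B i}"
  proof -
    have [measurable]: "{\<omega>\<in>space P. \<forall>i\<in>F. Y i \<omega> \<in> B i} \<in> sets P" "{\<omega>\<in>space P. \<forall>i\<in>insert j F. Y i \<omega> \<in> B i} \<in> sets P"
      using insert.hyps insert.prems by (auto intro!: sets.sets_Collect_finite_All)
    have "emeasure P' {\<omega>\<in>space P'. \<forall>i\<in>F. Y i \<omega> \<in> B i} =
        (\<integral>\<^sup>+\<omega>. ennreal (indicator (B j) (Y j \<omega>)) * indicator {\<omega>\<in>space P. \<forall>i\<in>F. Y i \<omega> \<in> B i} \<omega> \<partial>P)"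
      by (simp add: P'_def emeasure_density)
    also have "\<dots> = (\<integral>\<^sup>+\<omega>. indicator {\<omega>\<in>space P. \<forall>i\<in>insert j F. Y i \<omega> \<in> B i} \<omega> \<partial>P)"
      by (intro nn_integral_cong) (auto split: split_indicator)
    also have "\<dots> = emeasure P {\<omega>\<in>space P. \<forall>i\<in>insert j F. Y i \<omega> \<in> B i}"
      by (rule nn_integral_indicator) measurable
    finally show ?thesis .
  qed
  moreover have "emeasure Q' {\<omega>\<in>space Q'. \<forall>i\<in>F. Z i \<omega> \<in> B i} = emeasure Q {\<omega>\<in>space Q. \<forall>i\<in>insert j F. Z i \<omega> \<in> B i}"
  proof -
    have [measurable]: "{\<omega>\<in>space Q. \<forall>i\<in>F. Z i \<omega> \<in> B i} \<in> sets Q" "{\<omega>\<in>space Q. \<forall>i\<in>insert j F. Z i \<omega> \<in> B i} \<in> sets Q"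
      using insert.hyps insert.prems by (auto intro!: sets.sets_Collect_finite_All)
    have "emeasure Q' {\<omega>\<in>space Q'. \<forall>i\<in>F. Z i \<omega> \<in> B i} =
        (\<integral>\<^sup>+\<omega>. ennreal (indicator (B j) (Z j \<omega>)) * indicator {\<omega>\<in>space Q. \<forall>i\<in>F. Z i \<omega> \<in> B i} \<omega> \<partial>Q)"
      by (simp add: Q'_def emeasure_density)
    also have "\<dots> = (\<integral>\<^sup>+\<omega>. indicator {\<omega>\<in>space Q. \<forall>i\<in>insert j F. Z i \<omega> \<in> B i} \<omega> \<partial>Q)"
      by (intro nn_integral_cong) (auto split: split_indicator)
    also have "\<dots> = emeasure Q {\<omega>\<in>space Q. \<forall>i\<in>insert j F. Z i \<omega> \<in> B i}"
      by (rule nn_integral_indicator) measurable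
    finally show ?thesis .
  qed
  ultimately show ?case by simp
qed

theorem cramer_wold:
  fixes P :: "'a measure" and Q :: "'b measure" and Y :: "'i \<Rightarrow> 'a \<Rightarrow> real" and Z :: "'i \<Rightarrow> 'b \<Rightarrow> real"
  assumes fin: "finite_measure P" "finite_measure Q"
    and Y: "\<And>i. i \<in> I \<Longrightarrow> Y i \<in> borel_measurable P" and Z: "\<And>i. i \<in> I \<Longrightarrow> Z i \<in> borel_measurable Q"
    and eq: "\<And>F a. finite F \<Longrightarrow> F \<subseteq> I \<Longrightarrow>
       (\<integral>\<omega>. iexp (\<Sum>i\<in>F. a i * Y i \<omega>) \<partial>P) = (\<integral>\<omega>. iexp (\<Sum>i\<in>F. a i * Z i \<omega>) \<partial>Q)"
  shows "distr P (PiM I (\<lambda>_. borel)) (\<lambda>\<omega>. \<lambda>i\<in>I. Y i \<omega>) = distr Q (PiM I (\<lambda>_. borel)) (\<lambda>\<omega>. \<lambda>i\<in>I. Z i \<omega>)"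
proof (rule measure_eqI_PiM_infinite[where I=I and M="\<lambda>_. borel"])
  have m: "(\<lambda>\<omega>. \<lambda>i\<in>I. Y i \<omega>) \<in> measurable P (PiM I (\<lambda>_. borel))"
    "(\<lambda>\<omega>. \<lambda>i\<in>I. Z i \<omega>) \<in> measurable Q (PiM I (\<lambda>_. borel))"
    using Y Z by (auto intro!: measurable_restrict)
  show "finite_measure (distr P (PiM I (\<lambda>_. borel)) (\<lambda>\<omega>. \<lambda>i\<in>I. Y i \<omega>))"
    using fin m by (intro finite_measure.finite_measure_distr)
  fix A :: "'i \<Rightarrow> real set" and J assume J: "finite J" "J \<subseteq> I" "\<And>i. i \<in> J \<Longrightarrow> A i \<in> sets borel"
  let ?E = "prod_emb I (\<lambda>_. borel) J (Pi\<^sub>E J A)"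
  have E: "?E \<in> sets (PiM I (\<lambda>_. borel))" using J by (intro sets_PiM_I) auto
  have "(\<lambda>\<omega>. \<lambda>i\<in>I. Y i \<omega>) -` ?E \<inter> space P = {\<omega>\<in>space P. \<forall>i\<in>J. Y i \<omega> \<in> A i}"
    "(\<lambda>\<omega>. \<lambda>i\<in>I. Z i \<omega>) -` ?E \<inter> space Q = {\<omega>\<in>space Q. \<forall>i\<in>J. Z i \<omega> \<in> A i}"
    using J by (auto simp: prod_emb_def PiE_def Pi_def extensional_def)
  moreover have "emeasure P {\<omega>\<in>space P. \<forall>i\<in>J. Y i \<omega> \<in> A i} = emeasure Q {\<omega>\<in>space Q. \<forall>i\<in>J. Z i \<omega> \<in> A i}"
    by (rule cramer_wold_rectangles[OF J(1) fin]) (use J Y Z eq in \<open>auto simp: subset_iff\<close>)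
  ultimately show "emeasure (distr P (PiM I (\<lambda>_. borel)) (\<lambda>\<omega>. \<lambda>i\<in>I. Y i \<omega>)) ?E =
     emeasure (distr Q (PiM I (\<lambda>_. borel)) (\<lambda>\<omega>. \<lambda>i\<in>I. Z i \<omega>)) ?E"
    using m E by (simp add: emeasure_distr)
qed auto

section \<open>Spaces of centered normal variables\<close>

locale gaussian_space = prob_space P for P :: "'w measure" +
  fixes V :: "('w \<Rightarrow> real) set"
  assumes V_zero: "(\<lambda>_. 0) \<in> V"
    and V_add: "\<And>S T. S \<in> V \<Longrightarrow> T \<in> V \<Longrightarrow> (\<lambda>\<omega>. S \<omega> + T \<omega>) \<in> V"
    and V_scale: "\<And>S a. S \<in> V \<Longrightarrow> (\<lambda>\<omega>. a * S \<omega>) \<in> V"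
    and V_meas: "\<And>S. S \<in> V \<Longrightarrow> S \<in> borel_measurable P"
    and V_normal: "\<And>S. S \<in> V \<Longrightarrow> centered_normal P S"
begin

lemma V_sum:
  assumes "finite F" "\<And>i. i \<in> F \<Longrightarrow> X i \<in> V"
  shows "(\<lambda>\<omega>. \<Sum>i\<in>F. a i * X i \<omega>) \<in> V"
  using assms
proof (induction F)
  case empty then show ?case by (simp add: V_zero)
next
  case (insert j F)
  then have "(\<lambda>\<omega>. a j * X j \<omega> + (\<Sum>i\<in>F. a i * X i \<omega>)) \<in> V"
    by (intro V_add V_scale) auto
  then show ?case using insert.hyps by simp
qed

lemma V_diff: "S \<in> V \<Longrightarrow> T \<in> V \<Longrightarrow> (\<lambda>\<omega>. S \<omega> - T \<omega>) \<in> V"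
  using V_add[OF _ V_scale[of T "-1"], of S] by simp

lemma V_square_integrable_and_law:
  assumes "S \<in> V"
  shows V_integrable: "integrable P S"
    and V_integrable_square: "integrable P (\<lambda>\<omega>. (S \<omega>)\<^sup>2)"
    and V_expectation: "expectation S = 0"
    and V_distributed: "expectation (\<lambda>\<omega>. (S \<omega>)\<^sup>2) > 0 \<Longrightarrow>
       distributed P lborel S (normal_density 0 (sqrt (expectation (\<lambda>\<omega>. (S \<omega>)\<^sup>2))))"
    and V_char: "(\<integral>\<omega>. iexp (S \<omega>) \<partial>P) = complex_of_real (exp (- expectation (\<lambda>\<omega>. (S \<omega>)\<^sup>2) / 2))"
proof -
  have [measurable]: "S \<in> borel_measurable P" using assms by (rule V_meas)
  have "integrable P S \<and> integrable P (\<lambda>\<omega>. (S \<omega>)\<^sup>2) \<and> expectation S = 0 \<and>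
     (expectation (\<lambda>\<omega>. (S \<omega>)\<^sup>2) > 0 \<longrightarrow>
       distributed P lborel S (normal_density 0 (sqrt (expectation (\<lambda>\<omega>. (S \<omega>)\<^sup>2))))) \<and>
     (\<integral>\<omega>. iexp (S \<omega>) \<partial>P) = complex_of_real (exp (- expectation (\<lambda>\<omega>. (S \<omega>)\<^sup>2) / 2))"
    using V_normal[OF assms] unfolding centered_normal_def
  proof (elim disjE exE conjE)
    fix \<sigma> :: real assume \<sigma>: "\<sigma> > 0" and D: "distributed P lborel S (normal_density 0 \<sigma>)"
    have i2: "integrable P (\<lambda>\<omega>. (S \<omega>)\<^sup>2)"
      using distributed_integrable[OF D, of "\<lambda>x. x^2"] integrable_normal_moment[where \<mu>=0 and k=2, OF \<sigma>] \<sigma> by simp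
    have i1: "integrable P S"
      using distributed_integrable[OF D, of "\<lambda>x. x"] integrable_normal_moment_nz_1[where \<mu>=0, OF \<sigma>] \<sigma> by simp
    have e0: "expectation S = 0" by (rule normal_distributed_expectation[OF \<sigma> D])
    have v: "expectation (\<lambda>\<omega>. (S \<omega>)\<^sup>2) = \<sigma>\<^sup>2"
      using normal_distributed_variance[OF \<sigma> D] e0 by simp
    have D1: "distributed P lborel (\<lambda>x. S x / \<sigma>) std_normal_density"
      using D normal_standard_normal_convert[OF \<sigma>, of S 0] by simp
    have "distr P borel (\<lambda>x. S x / \<sigma>) = std_normal_distribution"
      using distributed_distr_eq_density[OF D1] by (simp cong: distr_cong)
    then have "char (distr P borel (\<lambda>x. S x / \<sigma>)) \<sigma> = complex_of_real (exp (- (\<sigma>^2) / 2))"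
      by (simp add: char_std_normal_distribution)
    moreover have "char (distr P borel (\<lambda>x. S x / \<sigma>)) \<sigma> = (\<integral>\<omega>. iexp (S \<omega>) \<partial>P)"
      unfolding char_def using \<sigma> by (subst integral_distr) auto
    ultimately show ?thesis using i1 i2 e0 v D \<sigma> by simp
  next
    assume ae: "AE \<omega> in P. S \<omega> = 0"
    have "integrable P S \<longleftrightarrow> integrable P (\<lambda>_. 0::real)" "integrable P (\<lambda>\<omega>. (S \<omega>)\<^sup>2) \<longleftrightarrow> integrable P (\<lambda>_. 0::real)"
      using ae by (intro integrable_cong_AE; auto)+
    moreover have "expectation S = expectation (\<lambda>_. 0)" "expectation (\<lambda>\<omega>. (S \<omega>)\<^sup>2) = expectation (\<lambda>_. 0)"
      using ae by (intro integral_cong_AE; auto)+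
    moreover have "(\<integral>\<omega>. iexp (S \<omega>) \<partial>P) = (\<integral>\<omega>. 1 \<partial>P)"
      using ae by (intro integral_cong_AE) auto
    ultimately show ?thesis by (simp add: prob_space)
  qed
  then show "integrable P S" "integrable P (\<lambda>\<omega>. (S \<omega>)\<^sup>2)" "expectation S = 0"
    "expectation (\<lambda>\<omega>. (S \<omega>)\<^sup>2) > 0 \<Longrightarrow>
       distributed P lborel S (normal_density 0 (sqrt (expectation (\<lambda>\<omega>. (S \<omega>)\<^sup>2))))"
    "(\<integral>\<omega>. iexp (S \<omega>) \<partial>P) = complex_of_real (exp (- expectation (\<lambda>\<omega>. (S \<omega>)\<^sup>2) / 2))"
    by blast+
qed

lemma V_integrable_mult:
  assumes "S \<in> V" "T \<in> V"
  shows "integrable P (\<lambda>\<omega>. S \<omega> * T \<omega>)"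
proof -
  have [measurable]: "S \<in> borel_measurable P" "T \<in> borel_measurable P" using assms V_meas by auto
  show ?thesis
  proof (rule Bochner_Integration.integrable_bound)
    show "integrable P (\<lambda>\<omega>. (S \<omega>)\<^sup>2 + (T \<omega>)\<^sup>2)"
      using assms by (intro Bochner_Integration.integrable_add V_integrable_square)
    have "\<bar>a * b\<bar> \<le> a\<^sup>2 + b\<^sup>2" for a b :: real
    proof -
      have "0 \<le> (\<bar>a\<bar> - \<bar>b\<bar>)\<^sup>2" by simp
      then have "2 * \<bar>a * b\<bar> \<le> a\<^sup>2 + b\<^sup>2" by (simp add: power2_diff abs_mult)
      then show ?thesis by linarith
    qed
    then show "AE \<omega> in P. norm (S \<omega> * T \<omega>) \<le> norm ((S \<omega>)\<^sup>2 + (T \<omega>)\<^sup>2)"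
      by (auto simp del: abs_mult)
  qed simp
qed

lemma V_square_lincomb:
  assumes "S \<in> V" "T \<in> V"
  shows "expectation (\<lambda>\<omega>. (a * S \<omega> + b * T \<omega>)\<^sup>2) =
    a\<^sup>2 * expectation (\<lambda>\<omega>. (S \<omega>)\<^sup>2) + 2 * a * b * expectation (\<lambda>\<omega>. S \<omega> * T \<omega>) + b\<^sup>2 * expectation (\<lambda>\<omega>. (T \<omega>)\<^sup>2)"
proof -
  have "expectation (\<lambda>\<omega>. (a * S \<omega> + b * T \<omega>)\<^sup>2) =
    expectation (\<lambda>\<omega>. a\<^sup>2 * (S \<omega>)\<^sup>2 + (2 * a * b * (S \<omega> * T \<omega>) + b\<^sup>2 * (T \<omega>)\<^sup>2))"
    by (intro Bochner_Integration.integral_cong refl) (simp add: power2_eq_square algebra_simps)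
  also have "\<dots> = a\<^sup>2 * expectation (\<lambda>\<omega>. (S \<omega>)\<^sup>2) + (2 * a * b * expectation (\<lambda>\<omega>. S \<omega> * T \<omega>) + b\<^sup>2 * expectation (\<lambda>\<omega>. (T \<omega>)\<^sup>2))"
    using V_integrable_square[OF assms(1)] V_integrable_square[OF assms(2)] V_integrable_mult[OF assms]
    by (simp add: Bochner_Integration.integral_add)
  finally show ?thesis by simp
qed

text \<open>Translating the normal density by \<open>\<theta> * v\<close> multiplies it by \<open>exp (\<theta> * x - \<theta>\<^sup>2 * v / 2)\<close>.\<close>

lemma nn_integral_shift:
  assumes S: "S \<in> V" and v: "v = expectation (\<lambda>\<omega>. (S \<omega>)\<^sup>2)" "v > 0"
    and h [measurable]: "h \<in> borel_measurable borel"
  shows "(\<integral>\<^sup>+\<omega>. h (S \<omega> + \<theta> * v) \<partial>P) = (\<integral>\<^sup>+\<omega>. ennreal (exp (\<theta> * S \<omega> - \<theta>\<^sup>2 * v / 2)) * h (S \<omega>) \<partial>P)"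
proof -
  have D: "distributed P lborel S (normal_density 0 (sqrt v))"
    using V_distributed[OF S] v by simp
  have nd: "normal_density 0 (sqrt v) (x - \<theta> * v) = normal_density 0 (sqrt v) x * exp (\<theta> * x - \<theta>\<^sup>2 * v / 2)" for x
  proof -
    have "- (x - \<theta> * v)\<^sup>2 / (2 * v) = - x\<^sup>2 / (2 * v) + (\<theta> * x - \<theta>\<^sup>2 * v / 2)"
      using v(2) by (simp add: power2_eq_square field_simps)
    then show ?thesis using v(2) by (simp add: normal_density_def mult_exp_exp)
  qed
  have "(\<integral>\<^sup>+\<omega>. h (S \<omega> + \<theta> * v) \<partial>P) = (\<integral>\<^sup>+x. ennreal (normal_density 0 (sqrt v) x) * h (x + \<theta> * v) \<partial>lborel)"
    by (rule distributed_nn_integral[OF D, symmetric]) measurable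
  also have "\<dots> = (\<integral>\<^sup>+x. ennreal (normal_density 0 (sqrt v) (x - \<theta> * v)) * h x \<partial>lborel)"
    by (subst nn_integral_real_affine[where c=1 and t="- \<theta> * v"]) (auto simp: algebra_simps)
  also have "\<dots> = (\<integral>\<^sup>+x. ennreal (normal_density 0 (sqrt v) x) * (ennreal (exp (\<theta> * x - \<theta>\<^sup>2 * v / 2)) * h x) \<partial>lborel)"
    by (simp add: nd ennreal_mult' mult.assoc)
  also have "\<dots> = (\<integral>\<^sup>+\<omega>. ennreal (exp (\<theta> * S \<omega> - \<theta>\<^sup>2 * v / 2)) * h (S \<omega>) \<partial>P)"
    by (rule distributed_nn_integral[OF D]) measurable
  finally show ?thesis .
qed

text \<open>
  Chernoff's bound; the total mass of the translated law in \<open>nn_integral_shift\<close> is the exponential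
  moment. Only an upper bound \<open>w\<close> of the variance enters, so a vanishing variance is allowed.
\<close>

lemma normal_tail_upper:
  assumes S: "S \<in> V" and w: "expectation (\<lambda>\<omega>. (S \<omega>)\<^sup>2) \<le> w" "w > 0" and x: "x \<ge> 0"
  shows "prob {\<omega>\<in>space P. S \<omega> > x} \<le> exp (- x\<^sup>2 / (2 * w))"
proof -
  have [measurable]: "S \<in> borel_measurable P" using S by (rule V_meas)
  define v where "v = expectation (\<lambda>\<omega>. (S \<omega>)\<^sup>2)"
  have v0: "v \<ge> 0" by (simp add: v_def)
  show ?thesis
  proof (cases "v = 0")
    case True
    have "AE \<omega> in P. (S \<omega>)\<^sup>2 = 0"
      using True integral_nonneg_eq_0_iff_AE[OF V_integrable_square[OF S]] by (simp add: v_def)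
    then have "AE \<omega> in P. \<not> S \<omega> > x" using x by (auto elim!: AE_mp)
    then have "prob {\<omega>\<in>space P. S \<omega> > x} = 0" by (subst prob_eq_0) auto
    then show ?thesis by simp
  next
    case False
    with v0 have v: "v > 0" by simp
    define \<theta> where "\<theta> = x / v"
    have t0: "\<theta> \<ge> 0" using x v by (simp add: \<theta>_def)
    have "emeasure P {\<omega>\<in>space P. S \<omega> > x} = (\<integral>\<^sup>+\<omega>. indicator {\<omega>\<in>space P. S \<omega> > x} \<omega> \<partial>P)" by simp
    also have "\<dots> \<le> (\<integral>\<^sup>+\<omega>. ennreal (exp (\<theta>\<^sup>2 * v / 2 - \<theta> * x)) * (ennreal (exp (\<theta> * S \<omega> - \<theta>\<^sup>2 * v / 2)) * 1) \<partial>P)"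
    proof (intro nn_integral_mono)
      fix \<omega>
      have "S \<omega> > x \<Longrightarrow> 1 \<le> exp (\<theta>\<^sup>2 * v / 2 - \<theta> * x) * exp (\<theta> * S \<omega> - \<theta>\<^sup>2 * v / 2)"
        using t0 by (simp add: mult_exp_exp mult_left_mono)
      then show "indicator {\<omega>\<in>space P. S \<omega> > x} \<omega> \<le> ennreal (exp (\<theta>\<^sup>2 * v / 2 - \<theta> * x)) * (ennreal (exp (\<theta> * S \<omega> - \<theta>\<^sup>2 * v / 2)) * 1)"
        by (auto simp: indicator_def simp flip: ennreal_mult' intro!: ennreal_leI[of 1, simplified])
    qed
    also have "\<dots> = ennreal (exp (\<theta>\<^sup>2 * v / 2 - \<theta> * x)) * (\<integral>\<^sup>+\<omega>. ennreal (exp (\<theta> * S \<omega> - \<theta>\<^sup>2 * v / 2)) * 1 \<partial>P)"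
      by (rule nn_integral_cmult) simp
    also have "(\<integral>\<^sup>+\<omega>. ennreal (exp (\<theta> * S \<omega> - \<theta>\<^sup>2 * v / 2)) * 1 \<partial>P) = 1"
      using nn_integral_shift[OF S v_def v, of "\<lambda>_. 1" \<theta>] by (simp add: emeasure_space_1)
    finally have "prob {\<omega>\<in>space P. S \<omega> > x} \<le> exp (\<theta>\<^sup>2 * v / 2 - \<theta> * x)"
      by (simp add: emeasure_eq_measure)
    also have "\<theta>\<^sup>2 * v / 2 - \<theta> * x = - x\<^sup>2 / (2 * v)"
      using v by (simp add: \<theta>_def power2_eq_square field_simps)
    also have "exp (- x\<^sup>2 / (2 * v)) \<le> exp (- x\<^sup>2 / (2 * w))"
      using v w by (simp add: v_def[symmetric] frac_le)
    finally show ?thesis .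
  qed
qed

text \<open>The density integrated over \<open>{x<..x + 1}\<close> in units of the standard deviation.\<close>

lemma normal_tail_lower:
  assumes S: "S \<in> V" and v: "v = expectation (\<lambda>\<omega>. (S \<omega>)\<^sup>2)" "v > 0" and x: "x \<ge> 0"
  shows "prob {\<omega>\<in>space P. S \<omega> > sqrt v * x} \<ge> exp (- (x + 1)\<^sup>2 / 2) / sqrt (2 * pi)"
proof -
  have [measurable]: "S \<in> borel_measurable P" using S by (rule V_meas)
  have D: "distributed P lborel S (normal_density 0 (sqrt v))"
    using V_distributed[OF S] v by simp
  have s0: "sqrt v > 0" using v by simp
  let ?c = "exp (- (x + 1)\<^sup>2 / 2) / sqrt (2 * pi)"
  let ?I = "{sqrt v * x<..sqrt v * (x + 1)}"
  have "ennreal ?c = ennreal (?c / sqrt v) * ennreal (sqrt v)"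
    using s0 by (subst ennreal_mult[symmetric]) auto
  also have "ennreal (sqrt v) = emeasure lborel ?I"
    using s0 by (simp add: algebra_simps)
  also have "ennreal (?c / sqrt v) * emeasure lborel ?I = (\<integral>\<^sup>+z. ennreal (?c / sqrt v) * indicator ?I z \<partial>lborel)"
    by (simp add: nn_integral_cmult_indicator)
  also have "\<dots> \<le> (\<integral>\<^sup>+z. ennreal (normal_density 0 (sqrt v) z) * indicator {sqrt v * x<..} z \<partial>lborel)"
  proof (intro nn_integral_mono)
    fix z
    have "?c / sqrt v \<le> normal_density 0 (sqrt v) z" if "z \<in> ?I"
    proof -
      have "0 \<le> sqrt v * x" using x s0 by simp
      then have "0 \<le> z" using that by (simp only: greaterThanAtMost_iff) linarith
      then have "z\<^sup>2 \<le> (sqrt v * (x + 1))\<^sup>2" using that by (intro power_mono) auto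
      then have "z\<^sup>2 / (2 * v) \<le> (x + 1)\<^sup>2 / 2"
        using v(2) by (simp only: power_mult_distrib) (simp add: field_simps)
      then show ?thesis using v(2)
        by (simp add: normal_density_def real_sqrt_mult divide_right_mono field_simps)
    qed
    then show "ennreal (?c / sqrt v) * indicator ?I z \<le> ennreal (normal_density 0 (sqrt v) z) * indicator {sqrt v * x<..} z"
      by (auto simp: indicator_def intro: ennreal_leI)
  qed
  also have "\<dots> = emeasure P (S -` {sqrt v * x<..} \<inter> space P)"
    by (rule distributed_emeasure[OF D, symmetric]) simp
  also have "S -` {sqrt v * x<..} \<inter> space P = {\<omega>\<in>space P. S \<omega> > sqrt v * x}" by auto
  finally show ?thesis by (simp add: emeasure_eq_measure)
qed

end

definition linear_functionals :: "(real \<Rightarrow> 'w \<Rightarrow> real) \<Rightarrow> ('w \<Rightarrow> real) set" where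
  "linear_functionals X = {S. \<exists>F a. finite F \<and> F \<subseteq> {0..} \<and> S = (\<lambda>\<omega>. \<Sum>t\<in>F. a t * X t \<omega>)}"

lemma gaussian_space_linear_functionals:
  assumes "centered_gaussian_process P X"
  shows "gaussian_space P (linear_functionals X)"
proof -
  have sp: "stochastic_process P X" and n: "\<And>F a. finite F \<Longrightarrow> F \<subseteq> {0..} \<Longrightarrow> centered_normal P (\<lambda>\<omega>. \<Sum>t\<in>F. a t * X t \<omega>)"
    using assms by (auto simp: centered_gaussian_process_def)
  interpret prob_space P using sp by (simp add: stochastic_process_def)
  show ?thesis
  proof (intro gaussian_space.intro gaussian_space_axioms.intro prob_space_axioms)
    show "(\<lambda>_. 0) \<in> linear_functionals X"
      unfolding linear_functionals_def by (intro CollectI exI[of _ "{}"]) auto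
    fix S assume S: "S \<in> linear_functionals X"
    then obtain F a where F: "finite F" "F \<subseteq> {0..}" "S = (\<lambda>\<omega>. \<Sum>t\<in>F. a t * X t \<omega>)"
      by (auto simp: linear_functionals_def)
    show "S \<in> borel_measurable P"
      using F sp unfolding stochastic_process_def by (auto intro!: borel_measurable_sum borel_measurable_times simp: subset_iff)
    show "centered_normal P S" using F n by auto
    show "(\<lambda>\<omega>. b * S \<omega>) \<in> linear_functionals X" for b
      unfolding linear_functionals_def using F
      by (intro CollectI exI[of _ F] exI[of _ "\<lambda>t. b * a t"]) (auto simp: sum_distrib_left mult.assoc)
    fix T assume "T \<in> linear_functionals X"
    then obtain G b where G: "finite G" "G \<subseteq> {0..}" "T = (\<lambda>\<omega>. \<Sum>t\<in>G. b t * X t \<omega>)"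
      by (auto simp: linear_functionals_def)
    define d where "d = (\<lambda>t. (if t \<in> F then a t else 0) + (if t \<in> G then b t else 0))"
    have "(\<Sum>t\<in>F \<union> G. d t * X t \<omega>) = S \<omega> + T \<omega>" for \<omega>
    proof -
      have "(\<Sum>t\<in>F \<union> G. d t * X t \<omega>) = (\<Sum>t\<in>F \<union> G. (if t \<in> F then a t * X t \<omega> else 0)) + (\<Sum>t\<in>F \<union> G. (if t \<in> G then b t * X t \<omega> else 0))"
        by (simp add: d_def distrib_right flip: sum.distrib) (intro sum.cong, auto)
      also have "\<dots> = S \<omega> + T \<omega>"
        using F G by (simp add: sum.If_cases Int_absorb1)
      finally show ?thesis .
    qed
    then show "(\<lambda>\<omega>. S \<omega> + T \<omega>) \<in> linear_functionals X"
      unfolding linear_functionals_def using F(1,2) G(1,2)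
      by (intro CollectI exI[of _ "F \<union> G"] exI[of _ d]) auto
  qed
qed

lemma linear_functionals_I: "0 \<le> t \<Longrightarrow> X t \<in> linear_functionals X"
  unfolding linear_functionals_def by (intro CollectI exI[of _ "{t}"] exI[of _ "\<lambda>_. 1"]) auto

section \<open>The Cameron--Martin formula and Fernique's inequality\<close>

lemma integral_iexp_add_prod:
  assumes P: "prob_space P" and Q: "prob_space Q"
    and [measurable]: "S \<in> borel_measurable P" "T \<in> borel_measurable Q"
  shows "(\<integral>\<omega>. iexp (S (fst \<omega>) + T (snd \<omega>)) \<partial>(P \<Otimes>\<^sub>M Q)) = (\<integral>\<omega>. iexp (S \<omega>) \<partial>P) * (\<integral>\<omega>. iexp (T \<omega>) \<partial>Q)"
proof -
  interpret pair_prob_space P Q using P Q by (simp add: pair_prob_space_def pair_sigma_finite_def prob_space_imp_sigma_finite)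
  have "(\<integral>\<omega>. iexp (S (fst \<omega>) + T (snd \<omega>)) \<partial>(P \<Otimes>\<^sub>M Q)) = (\<integral>x. (\<integral>y. iexp (S x + T y) \<partial>Q) \<partial>P)"
  proof -
    have "integrable (P \<Otimes>\<^sub>M Q) (\<lambda>\<omega>. iexp (S (fst \<omega>) + T (snd \<omega>)))"
      by (intro integrable_const_bound[where B=1]) auto
    from integral_fst'[OF this] show ?thesis by simp
  qed
  also have "\<dots> = (\<integral>x. iexp (S x) * (\<integral>y. iexp (T y) \<partial>Q) \<partial>P)"
    by (simp add: distrib_left exp_add)
  finally show ?thesis by simp
qed

context gaussian_space
begin

lemma V_char_pair:
  assumes "S \<in> V" "T \<in> V"
  shows "(\<integral>\<omega>. iexp (S (fst \<omega>) + T (snd \<omega>)) \<partial>(P \<Otimes>\<^sub>M P)) =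
    complex_of_real (exp (- (expectation (\<lambda>\<omega>. (S \<omega>)\<^sup>2) + expectation (\<lambda>\<omega>. (T \<omega>)\<^sup>2)) / 2))"
proof -
  have "exp (- (a + b) / 2) = exp (- a / 2) * exp (- b / 2)" for a b :: real
    by (simp add: mult_exp_exp diff_divide_distrib)
  then show ?thesis
    using assms by (simp only: integral_iexp_add_prod[OF prob_space_axioms prob_space_axioms V_meas V_meas] V_char of_real_mult)
qed

text \<open>
  Replacing the component of a Gaussian family along \<open>X t0\<close> by an independent copy of it does not
  change the law.
\<close>

lemma gaussian_resample:
  assumes X: "\<And>t. t \<in> I \<Longrightarrow> X t \<in> V" and t0: "t0 \<in> I"
    and v: "v = expectation (\<lambda>\<omega>. (X t0 \<omega>)\<^sup>2)" "v > 0"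
    and k: "\<And>t. k t = expectation (\<lambda>\<omega>. X t \<omega> * X t0 \<omega>) / v"
  shows "distr P (PiM I (\<lambda>_. borel)) (\<lambda>\<omega>. \<lambda>t\<in>I. X t \<omega>) =
    distr (P \<Otimes>\<^sub>M P) (PiM I (\<lambda>_. borel)) (\<lambda>\<omega>. \<lambda>t\<in>I. (X t (snd \<omega>) - k t * X t0 (snd \<omega>)) + k t * X t0 (fst \<omega>))"
proof (rule cramer_wold)
  interpret PP: pair_prob_space P P by standard
  show "finite_measure P" "finite_measure (P \<Otimes>\<^sub>M P)" by unfold_locales
  have m0 [measurable]: "X t0 \<in> borel_measurable P" using X t0 V_meas by auto
  show "X t \<in> borel_measurable P" if "t \<in> I" for t using that X V_meas by auto
  then show "(\<lambda>\<omega>. X t (snd \<omega>) - k t * X t0 (snd \<omega>) + k t * X t0 (fst \<omega>)) \<in> borel_measurable (P \<Otimes>\<^sub>M P)"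
    if "t \<in> I" for t using that by measurable
  fix F a assume F: "finite F" "F \<subseteq> I"
  define S where "S = (\<lambda>\<omega>. \<Sum>t\<in>F. a t * X t \<omega>)"
  define \<kappa> where "\<kappa> = (\<Sum>t\<in>F. a t * k t)"
  have S: "S \<in> V" using F X unfolding S_def by (intro V_sum) auto
  have T: "X t0 \<in> V" using X t0 by simp
  have cov: "expectation (\<lambda>\<omega>. S \<omega> * X t0 \<omega>) = \<kappa> * v"
  proof -
    have "expectation (\<lambda>\<omega>. S \<omega> * X t0 \<omega>) = expectation (\<lambda>\<omega>. \<Sum>t\<in>F. a t * (X t \<omega> * X t0 \<omega>))"
      by (simp add: S_def sum_distrib_right mult.assoc)
    also have "\<dots> = (\<Sum>t\<in>F. a t * expectation (\<lambda>\<omega>. X t \<omega> * X t0 \<omega>))"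
      using F X T by (subst Bochner_Integration.integral_sum) (auto intro!: V_integrable_mult)
    also have "\<dots> = \<kappa> * v" using v by (simp add: \<kappa>_def k sum_distrib_right)
    finally show ?thesis .
  qed
  have sum: "(\<Sum>t\<in>F. a t * (X t (snd \<omega>) - k t * X t0 (snd \<omega>) + k t * X t0 (fst \<omega>))) =
      \<kappa> * X t0 (fst \<omega>) + (1 * S (snd \<omega>) + (- \<kappa>) * X t0 (snd \<omega>))" for \<omega>
    by (simp add: S_def \<kappa>_def algebra_simps sum.distrib sum_subtractf sum_distrib_left)
  have V1: "(\<lambda>\<omega>. \<kappa> * X t0 \<omega>) \<in> V" "(\<lambda>\<omega>. 1 * S \<omega> + (- \<kappa>) * X t0 \<omega>) \<in> V"
    by (rule V_scale[OF T], rule V_add[OF V_scale[OF S] V_scale[OF T]])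
  have "expectation (\<lambda>\<omega>. (\<kappa> * X t0 \<omega>)\<^sup>2) + expectation (\<lambda>\<omega>. (1 * S \<omega> + (- \<kappa>) * X t0 \<omega>)\<^sup>2) = expectation (\<lambda>\<omega>. (S \<omega>)\<^sup>2)"
    unfolding V_square_lincomb[OF S T] cov v(1)[symmetric]
    by (simp add: power_mult_distrib v(1)[symmetric]) (simp add: power2_eq_square)
  then show "(\<integral>\<omega>. iexp (\<Sum>t\<in>F. a t * X t \<omega>) \<partial>P) =
     (\<integral>\<omega>. iexp (\<Sum>t\<in>F. a t * (X t (snd \<omega>) - k t * X t0 (snd \<omega>) + k t * X t0 (fst \<omega>))) \<partial>(P \<Otimes>\<^sub>M P))"
    unfolding sum V_char_pair[OF V1] using V_char[OF S] by (simp add: S_def)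
qed

text \<open>
  After \<open>gaussian_resample\<close> the family is a deterministic multiple of an independent variable
  \<open>X t0\<close> plus a remainder, and the translation acts on that variable only, so that Fubini's theorem
  reduces the claim to \<open>nn_integral_shift\<close>.
\<close>

theorem cameron_martin:
  fixes X :: "'i \<Rightarrow> 'w \<Rightarrow> real"
  assumes X: "\<And>t. t \<in> I \<Longrightarrow> X t \<in> V" and t0: "t0 \<in> I"
    and v: "v = expectation (\<lambda>\<omega>. (X t0 \<omega>)\<^sup>2)" "v > 0"
    and r: "\<And>t. r t = expectation (\<lambda>\<omega>. X t \<omega> * X t0 \<omega>)"
    and B [measurable]: "B \<in> sets (PiM I (\<lambda>_. borel))"
  shows "emeasure P {\<omega>\<in>space P. (\<lambda>t\<in>I. X t \<omega> + \<theta> * r t) \<in> B} =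
    (\<integral>\<^sup>+\<omega>. ennreal (exp (\<theta> * X t0 \<omega> - \<theta>\<^sup>2 * v / 2)) * indicator B (\<lambda>t\<in>I. X t \<omega>) \<partial>P)"
proof -
  interpret PP: pair_prob_space P P by standard
  let ?M = "PiM I (\<lambda>_. borel :: real measure)"
  have m0 [measurable]: "X t0 \<in> borel_measurable P" using X t0 V_meas by auto
  have mX: "X t \<in> borel_measurable P" if "t \<in> I" for t using that X V_meas by auto
  have m1 [measurable]: "(\<lambda>\<omega>. \<lambda>t\<in>I. X t \<omega>) \<in> measurable P ?M"
    using mX by (intro measurable_restrict) auto
  define k where "k = (\<lambda>t. r t / v)"
  define Z where "Z = (\<lambda>\<omega>2 z. \<lambda>t\<in>I. (X t \<omega>2 - k t * X t0 \<omega>2) + k t * z)"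
  have mZ [measurable]: "(\<lambda>(z, \<omega>). Z \<omega> z) \<in> measurable (borel \<Otimes>\<^sub>M P) ?M"
    unfolding Z_def split_beta using mX by (intro measurable_restrict) (auto intro!: borel_measurable_add borel_measurable_diff borel_measurable_times)
  have mZ2 [measurable]: "(\<lambda>\<omega>. Z (snd \<omega>) (X t0 (fst \<omega>))) \<in> measurable (P \<Otimes>\<^sub>M P) ?M"
    using measurable_compose[OF _ mZ, of "\<lambda>\<omega>. (X t0 (fst \<omega>), snd \<omega>)" "P \<Otimes>\<^sub>M P"] by simp
  have mZ1: "Z \<omega> \<in> measurable borel ?M" if "\<omega> \<in> space P" for \<omega>
    unfolding Z_def by (intro measurable_restrict) auto
  have law: "distr P ?M (\<lambda>\<omega>. \<lambda>t\<in>I. X t \<omega>) = distr (P \<Otimes>\<^sub>M P) ?M (\<lambda>\<omega>. Z (snd \<omega>) (X t0 (fst \<omega>)))"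
    unfolding Z_def by (rule gaussian_resample[where X=X and ?t0.0=t0 and v=v]) (use X t0 v in \<open>auto simp: k_def r\<close>)
  have fub: "(\<integral>\<^sup>+\<omega>. h (\<lambda>t\<in>I. X t \<omega>) \<partial>P) = (\<integral>\<^sup>+\<omega>2. (\<integral>\<^sup>+\<omega>1. h (Z \<omega>2 (X t0 \<omega>1)) \<partial>P) \<partial>P)"
    if [measurable]: "h \<in> borel_measurable ?M" for h :: "_ \<Rightarrow> ennreal"
  proof -
    have "(\<integral>\<^sup>+\<omega>. h (\<lambda>t\<in>I. X t \<omega>) \<partial>P) = (\<integral>\<^sup>+y. h y \<partial>distr P ?M (\<lambda>\<omega>. \<lambda>t\<in>I. X t \<omega>))"
      by (subst nn_integral_distr) auto
    also have "\<dots> = (\<integral>\<^sup>+\<omega>. h (Z (snd \<omega>) (X t0 (fst \<omega>))) \<partial>(P \<Otimes>\<^sub>M P))"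
      unfolding law by (subst nn_integral_distr) auto
    also have "\<dots> = (\<integral>\<^sup>+\<omega>2. (\<integral>\<^sup>+\<omega>1. h (Z \<omega>2 (X t0 \<omega>1)) \<partial>P) \<partial>P)"
      by (subst PP.nn_integral_snd[symmetric]) (auto simp: split_beta)
    finally show ?thesis .
  qed
  define sh where "sh = (\<lambda>y::'i \<Rightarrow> real. \<lambda>t\<in>I. y t + \<theta> * r t)"
  have msh [measurable]: "sh \<in> measurable ?M ?M"
    unfolding sh_def by (intro measurable_restrict borel_measurable_add measurable_component_singleton) auto
  have "emeasure P {\<omega>\<in>space P. (\<lambda>t\<in>I. X t \<omega> + \<theta> * r t) \<in> B} = (\<integral>\<^sup>+\<omega>. indicator B (sh (\<lambda>t\<in>I. X t \<omega>)) \<partial>P)"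
  proof -
    have "{\<omega>\<in>space P. (\<lambda>t\<in>I. X t \<omega> + \<theta> * r t) \<in> B} = {\<omega>\<in>space P. sh (\<lambda>t\<in>I. X t \<omega>) \<in> B}"
      unfolding sh_def by (simp cong: restrict_cong)
    moreover have "{\<omega>\<in>space P. sh (\<lambda>t\<in>I. X t \<omega>) \<in> B} \<in> sets P" by measurable
    ultimately show ?thesis
      by (auto simp flip: nn_integral_indicator intro!: nn_integral_cong split: split_indicator)
  qed
  also have "\<dots> = (\<integral>\<^sup>+\<omega>2. (\<integral>\<^sup>+\<omega>1. indicator B (sh (Z \<omega>2 (X t0 \<omega>1))) \<partial>P) \<partial>P)"
    by (rule fub) measurable
  also have "\<dots> = (\<integral>\<^sup>+\<omega>2. (\<integral>\<^sup>+\<omega>1. indicator B (Z \<omega>2 (X t0 \<omega>1 + \<theta> * v)) \<partial>P) \<partial>P)"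
  proof -
    have "k t * (z + \<theta> * v) = k t * z + \<theta> * r t" for t z using v by (simp add: k_def field_simps)
    then have "sh (Z \<omega> z) = Z \<omega> (z + \<theta> * v)" for \<omega> z
      by (auto simp: sh_def Z_def restrict_def fun_eq_iff)
    then show ?thesis by simp
  qed
  also have "\<dots> = (\<integral>\<^sup>+\<omega>2. (\<integral>\<^sup>+\<omega>1. ennreal (exp (\<theta> * X t0 \<omega>1 - \<theta>\<^sup>2 * v / 2)) * indicator B (Z \<omega>2 (X t0 \<omega>1)) \<partial>P) \<partial>P)"
    using mZ1 X t0 v by (intro nn_integral_cong nn_integral_shift) (auto intro!: borel_measurable_indicator')
  also have "\<dots> = (\<integral>\<^sup>+\<omega>2. (\<integral>\<^sup>+\<omega>1. ennreal (exp (\<theta> * Z \<omega>2 (X t0 \<omega>1) t0 - \<theta>\<^sup>2 * v / 2)) * indicator B (Z \<omega>2 (X t0 \<omega>1)) \<partial>P) \<partial>P)"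
  proof -
    have "k t0 = 1" using v by (simp add: k_def r power2_eq_square)
    then show ?thesis using t0 by (simp add: Z_def)
  qed
  also have "\<dots> = (\<integral>\<^sup>+\<omega>. ennreal (exp (\<theta> * (\<lambda>t\<in>I. X t \<omega>) t0 - \<theta>\<^sup>2 * v / 2)) * indicator B (\<lambda>t\<in>I. X t \<omega>) \<partial>P)"
    using t0 by (intro fub[symmetric]) measurable
  finally show ?thesis using t0 by simp
qed

text \<open>
  Fernique's rotation: \<open>(X - X') / sqrt 2\<close> and \<open>(X + X') / sqrt 2\<close> are independent copies of the
  family \<open>X\<close>; if the first is at most \<open>s\<close> and the second exceeds \<open>t\<close> somewhere, both \<open>X\<close> and \<open>X'\<close>
  exceed \<open>(t - s) / sqrt 2\<close> there.
\<close>

lemma fernique_rotation: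
  assumes X: "\<And>t. t \<in> I \<Longrightarrow> X t \<in> V" and I: "countable I"
  shows "prob {\<omega>\<in>space P. \<not> (\<exists>t\<in>I. \<bar>X t \<omega>\<bar> > s)} * prob {\<omega>\<in>space P. \<exists>t\<in>I. \<bar>X t \<omega>\<bar> > x}
    \<le> (prob {\<omega>\<in>space P. \<exists>t\<in>I. \<bar>X t \<omega>\<bar> > (x - s) / sqrt 2})\<^sup>2"
proof -
  interpret PP: pair_prob_space P P by standard
  let ?J = "I \<times> (UNIV :: bool set)"
  let ?M = "PiM ?J (\<lambda>_. borel :: real measure)"
  have mX: "X t \<in> borel_measurable P" if "t \<in> I" for t using that X V_meas by auto
  define Y where "Y = (\<lambda>(t, b) \<omega>. if b then X t (fst \<omega>) else X t (snd \<omega>))"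
  define Z where "Z = (\<lambda>(t, b) \<omega>. if b then (X t (fst \<omega>) + X t (snd \<omega>)) / sqrt 2 else (X t (fst \<omega>) - X t (snd \<omega>)) / sqrt 2)"
  have mY: "Y j \<in> borel_measurable (P \<Otimes>\<^sub>M P)" "Z j \<in> borel_measurable (P \<Otimes>\<^sub>M P)" if "j \<in> ?J" for j
    using that mX by (auto simp: Y_def Z_def split: prod.splits)
  have law: "distr (P \<Otimes>\<^sub>M P) ?M (\<lambda>\<omega>. \<lambda>j\<in>?J. Y j \<omega>) = distr (P \<Otimes>\<^sub>M P) ?M (\<lambda>\<omega>. \<lambda>j\<in>?J. Z j \<omega>)"
  proof (rule cramer_wold)
    show "finite_measure (P \<Otimes>\<^sub>M P)" "finite_measure (P \<Otimes>\<^sub>M P)" by unfold_locales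
    fix F a assume F: "finite F" "F \<subseteq> ?J"
    define S where "S = (\<lambda>\<omega>. \<Sum>j\<in>F. (if snd j then a j else 0) * X (fst j) \<omega>)"
    define T where "T = (\<lambda>\<omega>. \<Sum>j\<in>F. (if snd j then 0 else a j) * X (fst j) \<omega>)"
    have ST: "S \<in> V" "T \<in> V" unfolding S_def T_def using F X by (auto intro!: V_sum)
    have 1: "(\<Sum>j\<in>F. a j * Y j \<omega>) = S (fst \<omega>) + T (snd \<omega>)" for \<omega>
      unfolding S_def T_def sum.distrib[symmetric] by (intro sum.cong) (auto simp: Y_def split: prod.splits)
    have 2: "(\<Sum>j\<in>F. a j * Z j \<omega>) = ((1 / sqrt 2) * S (fst \<omega>) + (1 / sqrt 2) * T (fst \<omega>)) + ((1 / sqrt 2) * S (snd \<omega>) + (- 1 / sqrt 2) * T (snd \<omega>))" for \<omega>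
      unfolding S_def T_def sum_distrib_left sum.distrib[symmetric]
      by (intro sum.cong) (auto simp: Z_def add_divide_distrib diff_divide_distrib algebra_simps split: prod.splits)
    have V2: "(\<lambda>\<omega>. (1 / sqrt 2) * S \<omega> + (1 / sqrt 2) * T \<omega>) \<in> V" "(\<lambda>\<omega>. (1 / sqrt 2) * S \<omega> + (- 1 / sqrt 2) * T \<omega>) \<in> V"
      by (rule V_add[OF V_scale[OF ST(1)] V_scale[OF ST(2)]])+
    show "(\<integral>\<omega>. iexp (\<Sum>j\<in>F. a j * Y j \<omega>) \<partial>(P \<Otimes>\<^sub>M P)) = (\<integral>\<omega>. iexp (\<Sum>j\<in>F. a j * Z j \<omega>) \<partial>(P \<Otimes>\<^sub>M P))"
      unfolding 1 2 V_char_pair[OF ST] V_char_pair[OF V2] V_square_lincomb[OF ST]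
      by (simp add: power_divide)
  qed (use mY in auto)
  define B where "B = {y\<in>space ?M. (\<forall>t\<in>I. \<bar>y (t, False)\<bar> \<le> s) \<and> (\<exists>t\<in>I. \<bar>y (t, True)\<bar> > x)}"
  have B [measurable]: "B \<in> sets ?M"
    unfolding B_def using I by measurable
  let ?A = "\<lambda>x. {\<omega>\<in>space P. \<exists>t\<in>I. \<bar>X t \<omega>\<bar> > x}" and ?N = "{\<omega>\<in>space P. \<not> (\<exists>t\<in>I. \<bar>X t \<omega>\<bar> > s)}"
  have A: "?A x \<in> sets P" for x using I mX by measurable
  have N: "?N \<in> sets P" using I mX by measurable
  have mr: "(\<lambda>\<omega>. \<lambda>j\<in>?J. Y j \<omega>) \<in> measurable (P \<Otimes>\<^sub>M P) ?M" "(\<lambda>\<omega>. \<lambda>j\<in>?J. Z j \<omega>) \<in> measurable (P \<Otimes>\<^sub>M P) ?M"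
    by (intro measurable_restrict mY; assumption)+
  have "emeasure P (?A x) * emeasure P ?N = emeasure (P \<Otimes>\<^sub>M P) (?A x \<times> ?N)"
    using A N by (simp add: emeasure_pair_measure_Times)
  also have "?A x \<times> ?N = (\<lambda>\<omega>. \<lambda>j\<in>?J. Y j \<omega>) -` B \<inter> space (P \<Otimes>\<^sub>M P)"
    by (auto simp: B_def Y_def space_PiM space_pair_measure not_less)
  also have "emeasure (P \<Otimes>\<^sub>M P) \<dots> = emeasure (P \<Otimes>\<^sub>M P) ((\<lambda>\<omega>. \<lambda>j\<in>?J. Z j \<omega>) -` B \<inter> space (P \<Otimes>\<^sub>M P))"
    using arg_cong[OF law, of "\<lambda>M. emeasure M B"] mr B by (simp add: emeasure_distr)
  also have "\<dots> \<le> emeasure (P \<Otimes>\<^sub>M P) (?A ((x - s) / sqrt 2) \<times> ?A ((x - s) / sqrt 2))"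
  proof (rule emeasure_mono)
    have key: "\<bar>a\<bar> > (x - s) / sqrt 2 \<and> \<bar>b\<bar> > (x - s) / sqrt 2"
      if "\<bar>(a - b) / sqrt 2\<bar> \<le> s" "\<bar>(a + b) / sqrt 2\<bar> > x" for a b :: real
    proof -
      have "\<bar>a - b\<bar> \<le> sqrt 2 * s" "\<bar>a + b\<bar> > sqrt 2 * x"
        using that by (auto simp: abs_divide field_simps)
      then have "2 * \<bar>a\<bar> > sqrt 2 * (x - s)" "2 * \<bar>b\<bar> > sqrt 2 * (x - s)"
        by (auto simp: right_diff_distrib)
      moreover have "sqrt 2 * (x - s) = 2 * ((x - s) / sqrt 2)" by (simp add: real_div_sqrt field_simps)
      ultimately show ?thesis by linarith
    qed
    show "(\<lambda>\<omega>. \<lambda>j\<in>?J. Z j \<omega>) -` B \<inter> space (P \<Otimes>\<^sub>M P) \<subseteq> ?A ((x - s) / sqrt 2) \<times> ?A ((x - s) / sqrt 2)"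
    proof
      fix \<omega> assume "\<omega> \<in> (\<lambda>\<omega>. \<lambda>j\<in>?J. Z j \<omega>) -` B \<inter> space (P \<Otimes>\<^sub>M P)"
      then obtain t where t: "t \<in> I" "\<bar>(X t (fst \<omega>) - X t (snd \<omega>)) / sqrt 2\<bar> \<le> s"
        "\<bar>(X t (fst \<omega>) + X t (snd \<omega>)) / sqrt 2\<bar> > x" and \<omega>: "\<omega> \<in> space (P \<Otimes>\<^sub>M P)"
        by (auto simp: B_def Z_def)
      from key[OF t(2,3)] t(1) \<omega> show "\<omega> \<in> ?A ((x - s) / sqrt 2) \<times> ?A ((x - s) / sqrt 2)"
        by (auto simp: space_pair_measure mem_Times_iff)
    qed
  qed (use A in auto)
  also have "\<dots> = emeasure P (?A ((x - s) / sqrt 2)) * emeasure P (?A ((x - s) / sqrt 2))"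
    using A by (intro emeasure_pair_measure_Times)
  finally show ?thesis
    by (simp add: emeasure_eq_measure power2_eq_square mult.commute flip: ennreal_mult')
qed

text \<open>
  Iterating the rotation along \<open>t 0 = s\<close>, \<open>t (n + 1) = s + sqrt 2 * t n\<close> squares, in every
  step, the probability relative to that of staying below \<open>s\<close>, while \<open>t n\<close> grows like \<open>s * sqrt 2 ^ n\<close>.
\<close>

theorem fernique:
  assumes X: "\<And>t. t \<in> I \<Longrightarrow> X t \<in> V" and I: "countable I"
    and s: "s > 0" "prob {\<omega>\<in>space P. \<exists>t\<in>I. \<bar>X t \<omega>\<bar> > s} \<le> 1 / 4" and x: "x \<ge> 0"
  shows "prob {\<omega>\<in>space P. \<exists>t\<in>I. \<bar>X t \<omega>\<bar> > x} \<le> 3 * exp (- x\<^sup>2 / (24 * s\<^sup>2))"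
proof -
  have mX: "X t \<in> borel_measurable P" if "t \<in> I" for t using that X V_meas by auto
  let ?A = "\<lambda>x. {\<omega>\<in>space P. \<exists>t\<in>I. \<bar>X t \<omega>\<bar> > x}"
  have A: "?A x \<in> sets P" for x using I mX by measurable
  define q where "q = prob {\<omega>\<in>space P. \<not> (\<exists>t\<in>I. \<bar>X t \<omega>\<bar> > s)}"
  have q: "q \<ge> 3 / 4" "q \<le> 1" using prob_neg[OF A, of s] s by (simp_all add: q_def)
  define t where "t = rec_nat s (\<lambda>_ x. s + sqrt 2 * x)"
  define K where "K = sqrt 2 + (1::real)"
  have t0: "t 0 = s" and tS: "t (Suc m) = s + sqrt 2 * t m" for m by (simp_all add: t_def)
  have t_eq: "t n = sqrt 2 ^ n * ((1 + K) * s) - K * s" for n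
  proof (induction n)
    case (Suc n)
    have "t (Suc n) = s + sqrt 2 * t n" by (simp add: tS)
    also have "\<dots> = sqrt 2 ^ Suc n * ((1 + K) * s) - K * s"
      unfolding Suc by (simp add: K_def algebra_simps)
    finally show ?case .
  qed (simp add: t0 algebra_simps)
  have step: "prob (?A (t n)) \<le> q * (1 / 3) ^ (2 ^ n)" for n
  proof (induction n)
    case 0
    then show ?case using s q by (simp add: t0)
  next
    case (Suc n)
    have "q * prob (?A (t (Suc n))) \<le> (prob (?A ((t (Suc n) - s) / sqrt 2)))\<^sup>2"
      unfolding q_def by (rule fernique_rotation[OF X I])
    also have "(t (Suc n) - s) / sqrt 2 = t n" by (simp add: tS)
    also have "(prob (?A (t n)))\<^sup>2 \<le> (q * (1 / 3) ^ (2 ^ n))\<^sup>2"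
      using Suc by (intro power_mono) auto
    also have "\<dots> = q * (q * (1 / 3) ^ (2 ^ Suc n))"
      by (simp add: power_mult_distrib power2_eq_square mult_2 flip: power_add)
    finally show ?case using q by simp
  qed
  define z where "z = x\<^sup>2 / (12 * s\<^sup>2)"
  have zx: "x\<^sup>2 / (24 * s\<^sup>2) = z / 2" by (simp add: z_def)
  show ?thesis
  proof (cases "z \<ge> 1")
    case False
    have "1 \<le> 3 * exp (- (1::real))" using exp_le by (simp add: exp_minus field_simps)
    also have "\<dots> \<le> 3 * exp (- x\<^sup>2 / (24 * s\<^sup>2))"
      using False zx by (simp add: minus_divide_left[symmetric])
    finally show ?thesis using order.trans[OF prob_le_1] by blast
  next
    case True
    obtain n :: nat where n: "2 ^ n \<le> z" "z < 2 ^ (n + 1)"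
    proof -
      have "1 \<le> nat \<lfloor>z\<rfloor>" using True by (simp add: Suc_le_eq)
      then obtain n where "2 ^ n \<le> nat \<lfloor>z\<rfloor>" "nat \<lfloor>z\<rfloor> < 2 ^ (n + 1)"
        using ex_power_ivl1[of 2 "nat \<lfloor>z\<rfloor>"] by auto
      then have "2 ^ n \<le> z" "z < 2 ^ (n + 1)"
        using True by (simp_all add: le_nat_iff nat_less_iff le_floor_iff floor_less_iff)
      then show thesis by (rule that)
    qed
    have tx: "t n \<le> x"
    proof -
      have K: "K \<ge> 0" by (simp add: K_def)
      have "(1 + K)\<^sup>2 \<le> 12"
      proof -
        have "sqrt 2 \<le> (3/2 :: real)" by (intro real_le_lsqrt) (auto simp: power2_eq_square)
        then show ?thesis by (simp add: K_def power2_eq_square algebra_simps)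
      qed
      then have "(sqrt 2 ^ n * ((1 + K) * s))\<^sup>2 \<le> 2 ^ n * (12 * s\<^sup>2)"
        using mult_right_mono[of "(1 + K)\<^sup>2" 12 "s\<^sup>2"]
        by (simp add: power_mult_distrib flip: power_mult) (simp add: power_mult mult.commute[of n])
      also have "\<dots> \<le> z * (12 * s\<^sup>2)" using n by (intro mult_right_mono) auto
      also have "\<dots> = x\<^sup>2" using s by (simp add: z_def)
      finally have "sqrt 2 ^ n * ((1 + K) * s) \<le> x" using x by (rule power2_le_imp_le)
      moreover have "K * s \<ge> 0" using K s by simp
      ultimately show ?thesis unfolding t_eq by linarith
    qed
    have "prob (?A x) \<le> prob (?A (t n))"
      using tx A by (intro finite_measure_mono) force+
    also have "\<dots> \<le> q * (1 / 3) ^ (2 ^ n)" by (rule step)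
    also have "\<dots> \<le> 1 * exp (- 1) ^ (2 ^ n)"
      using q exp_le by (intro mult_mono power_mono) (auto simp: exp_minus field_simps)
    also have "\<dots> = exp (- (2 ^ n))" by (simp flip: exp_of_nat_mult)
    also have "\<dots> \<le> exp (- (z / 2))" using n by simp
    also have "\<dots> \<le> 3 * exp (- x\<^sup>2 / (24 * s\<^sup>2))"
    proof -
      have *: "- x\<^sup>2 / (24 * s\<^sup>2) = - (z / 2)" by (simp add: z_def)
      show ?thesis unfolding * by simp
    qed
    finally show ?thesis .
  qed
qed

end

section \<open>Path bounds for self-similar Gaussian processes\<close>

lemma (in prob_space) prob_tendsto_0_of_eventually_notin:
  assumes A: "\<And>n::nat. A n \<in> events" and dec: "\<And>m n. m \<le> n \<Longrightarrow> A n \<subseteq> A m"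
    and ae: "AE \<omega> in M. \<exists>n. \<omega> \<notin> A n"
  shows "(\<lambda>n. prob (A n)) \<longlonglongrightarrow> 0"
proof -
  have "(\<lambda>n. prob (A n)) \<longlonglongrightarrow> prob (\<Inter>n. A n)"
    using A dec by (intro finite_Lim_measure_decseq) (auto simp: decseq_def)
  moreover have "prob (\<Inter>n. A n) = 0"
    using ae A by (subst prob_eq_0) (auto elim!: AE_mp)
  ultimately show ?thesis by simp
qed

text \<open>
  Fernique's bound has the constant \<open>1 / (24 s\<^sup>2)\<close> in the exponent, where \<open>s\<close> is a bound
  that holds with probability \<open>3/4\<close>; hence the tails of a family that shrinks to zero are eventually
  lighter than any prescribed Gaussian tail.
\<close>

lemma (in gaussian_space) fernique_shrinking:
  fixes D :: "nat \<Rightarrow> 'i set"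
  assumes Y: "\<And>r. r \<in> D 0 \<Longrightarrow> Y r \<in> V" and D: "countable (D 0)" "\<And>m n. m \<le> n \<Longrightarrow> D n \<subseteq> D m"
    and ae: "AE \<omega> in P. \<forall>e>0. \<exists>n. \<forall>r\<in>D n. \<bar>Y r \<omega>\<bar> \<le> e" and K: "K > 0"
  shows "\<exists>n. \<forall>x\<ge>0. prob {\<omega>\<in>space P. \<exists>r\<in>D n. \<bar>Y r \<omega>\<bar> > x} \<le> 3 * exp (- K * x\<^sup>2)"
proof -
  define s where "s = 1 / sqrt (24 * K)"
  have s: "s > 0" "s\<^sup>2 = 1 / (24 * K)" using K by (simp_all add: s_def power_divide)
  have mY: "Y r \<in> borel_measurable P" if "r \<in> D n" for r n
    using that D(2)[of 0 n] Y V_meas by auto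
  have cD: "countable (D n)" for n using D(2)[of 0 n] D(1) countable_subset by auto
  have ev: "{\<omega>\<in>space P. \<exists>r\<in>D n. \<bar>Y r \<omega>\<bar> > s} \<in> events" for n using cD mY by measurable
  have "(\<lambda>n. prob {\<omega>\<in>space P. \<exists>r\<in>D n. \<bar>Y r \<omega>\<bar> > s}) \<longlonglongrightarrow> 0"
  proof (rule prob_tendsto_0_of_eventually_notin)
    show "AE \<omega> in P. \<exists>n. \<omega> \<notin> {\<omega>\<in>space P. \<exists>r\<in>D n. \<bar>Y r \<omega>\<bar> > s}"
      using ae by eventually_elim (use s in \<open>auto simp: not_less\<close>)
  qed (use ev D(2) in \<open>blast+\<close>)
  then have "eventually (\<lambda>n. prob {\<omega>\<in>space P. \<exists>r\<in>D n. \<bar>Y r \<omega>\<bar> > s} < 1/4) sequentially"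
    by (rule order_tendstoD) simp
  then obtain n where n: "prob {\<omega>\<in>space P. \<exists>r\<in>D n. \<bar>Y r \<omega>\<bar> > s} < 1/4"
    by (auto simp: eventually_sequentially)
  have "prob {\<omega>\<in>space P. \<exists>r\<in>D n. \<bar>Y r \<omega>\<bar> > x} \<le> 3 * exp (- K * x\<^sup>2)" if "x \<ge> 0" for x
  proof -
    have "prob {\<omega>\<in>space P. \<exists>r\<in>D n. \<bar>Y r \<omega>\<bar> > x} \<le> 3 * exp (- x\<^sup>2 / (24 * s\<^sup>2))"
      using Y D(2)[of 0 n] cD s n that by (intro fernique) auto
    also have "- x\<^sup>2 / (24 * s\<^sup>2) = - K * x\<^sup>2" using K by (simp add: s field_simps)
    finally show ?thesis .
  qed
  then show ?thesis by blast
qed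

text \<open>The barrier \<open>u + c t\<^sup>\<beta>\<close> seen on the time scale \<open>t = u powr (1 / \<beta>) * s\<close>.\<close>

definition barrier :: "real \<Rightarrow> real \<Rightarrow> real \<Rightarrow> real" where
  "barrier c \<beta> s = 1 + c * s powr \<beta>"

lemma barrier_ge_1: "c > 0 \<Longrightarrow> barrier c \<beta> s \<ge> 1"
  by (simp add: barrier_def)

lemma continuous_on_barrier: "\<beta> > 0 \<Longrightarrow> continuous_on {0..} (barrier c \<beta>)"
  unfolding barrier_def by (intro continuous_intros continuous_on_powr') auto

locale drifted_process =
  fixes P :: "'w measure" and H :: real and X :: "real \<Rightarrow> 'w \<Rightarrow> real"
    and c \<beta> :: real and D :: "real set"
  assumes ssg: "self_similar_gaussian P H X" and H: "0 < H"
    and c: "c > 0" and \<beta>: "\<beta> > H"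
    and D: "countable D" "D \<subseteq> {0..}"
begin

sublocale gaussian_space P "linear_functionals X"
  using ssg unfolding self_similar_gaussian_def by (intro gaussian_space_linear_functionals) auto

lemma X_in: "t \<ge> 0 \<Longrightarrow> X t \<in> linear_functionals X"
  by (rule linear_functionals_I)

lemma X_meas: "t \<ge> 0 \<Longrightarrow> X t \<in> borel_measurable P"
  by (rule V_meas[OF X_in])

lemma X_meas_D: "t \<in> D \<Longrightarrow> X t \<in> borel_measurable P"
  using D by (intro X_meas) auto

lemma X_var: "t \<ge> 0 \<Longrightarrow> expectation (\<lambda>\<omega>. (X t \<omega>)\<^sup>2) = t powr (2 * H)"
  using ssg V_expectation[OF X_in, of t] unfolding self_similar_gaussian_def by auto

lemma X_cont: "AE \<omega> in P. continuous_on {0..} (\<lambda>t. X t \<omega>)"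
  using ssg unfolding self_similar_gaussian_def as_continuous_paths_def by auto

lemma sample_path_meas: "sample_path X \<in> measurable P path_space"
  unfolding sample_path_def using X_meas by (intro measurable_restrict) auto

lemma X_scale:
  assumes a: "a > 0" and B: "B \<in> sets path_space"
  shows "prob {\<omega>\<in>space P. (\<lambda>t\<in>{0..}. X (a * t) \<omega>) \<in> B} = prob {\<omega>\<in>space P. (\<lambda>t\<in>{0..}. a powr H * X t \<omega>) \<in> B}"
proof -
  have eq: "process_law P (\<lambda>t. X (a * t)) = process_law P (\<lambda>t \<omega>. a powr H * X t \<omega>)"
    using ssg a by (auto simp: self_similar_gaussian_def self_similar_def)
  have m: "sample_path (\<lambda>t. X (a * t)) \<in> measurable P path_space"
    "sample_path (\<lambda>t \<omega>. a powr H * X t \<omega>) \<in> measurable P path_space"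
    unfolding sample_path_def using X_meas a by (auto intro!: measurable_restrict)
  show ?thesis
    using arg_cong[OF eq, of "\<lambda>M. measure M B"] m B
    by (simp add: process_law_def measure_distr) (simp add: sample_path_def vimage_def Int_def conj_commute)
qed

lemma barrier_D: "barrier c \<beta> s \<ge> 1"
  using c by (rule barrier_ge_1)

lemma barrier_pos: "barrier c \<beta> s > 0"
  using barrier_D[of s] by linarith

lemma \<beta>_pos: "\<beta> > 0"
  using H \<beta> by linarith

text \<open>Fernique's bound is weakened to \<open>C / x\<close>, which suffices for summing over dyadic blocks.\<close>

lemma block_tail:
  assumes T: "countable T" "T \<subseteq> {1..2}"
  shows "\<exists>C\<ge>0. \<forall>x>0. prob {\<omega>\<in>space P. \<exists>t\<in>T. \<bar>X t \<omega>\<bar> > x} \<le> C / x"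
proof -
  have T0: "t \<in> T \<Longrightarrow> X t \<in> linear_functionals X" "t \<in> T \<Longrightarrow> X t \<in> borel_measurable P" for t
    using T by (auto intro!: X_in X_meas)
  have "(\<lambda>n. prob {\<omega>\<in>space P. \<exists>t\<in>T. \<bar>X t \<omega>\<bar> > real n}) \<longlonglongrightarrow> 0"
  proof (rule prob_tendsto_0_of_eventually_notin)
    show "{\<omega>\<in>space P. \<exists>t\<in>T. \<bar>X t \<omega>\<bar> > real n} \<in> events" for n
      using T0 T by measurable
    show "AE \<omega> in P. \<exists>n. \<omega> \<notin> {\<omega>\<in>space P. \<exists>t\<in>T. \<bar>X t \<omega>\<bar> > real n}"
      using X_cont
    proof eventually_elim
      case (elim \<omega>)
      have "compact ((\<lambda>t. X t \<omega>) ` {1..2})"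
        using elim by (intro compact_continuous_image) (auto elim: continuous_on_subset)
      then obtain b where "\<forall>y\<in>(\<lambda>t. X t \<omega>) ` {1..2}. norm y \<le> b"
        using compact_imp_bounded bounded_iff by blast
      then have b: "\<And>t. t \<in> T \<Longrightarrow> \<bar>X t \<omega>\<bar> \<le> b" using T by auto
      obtain n where "b \<le> real n" using real_arch_simple by blast
      then show ?case using b by (intro exI[of _ n]) (force simp: not_less)
    qed
    show "{\<omega>\<in>space P. \<exists>t\<in>T. \<bar>X t \<omega>\<bar> > real n} \<subseteq> {\<omega>\<in>space P. \<exists>t\<in>T. \<bar>X t \<omega>\<bar> > real m}"
      if "m \<le> n" for m n
    proof -
      have "real m \<le> real n" using that by simp
      then show ?thesis by (blast intro: le_less_trans)
    qed
  qed
  then have "eventually (\<lambda>n. prob {\<omega>\<in>space P. \<exists>t\<in>T. \<bar>X t \<omega>\<bar> > real n} < 1/4) sequentially"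
    by (rule order_tendstoD) simp
  then obtain n where n: "n \<ge> 1" "prob {\<omega>\<in>space P. \<exists>t\<in>T. \<bar>X t \<omega>\<bar> > real n} < 1/4"
    using eventually_happens[OF eventually_conj[OF eventually_ge_at_top[of "1::nat"]]] by auto
  define C where "C = 3 * (sqrt 24 * n)"
  have "prob {\<omega>\<in>space P. \<exists>t\<in>T. \<bar>X t \<omega>\<bar> > x} \<le> C / x" if x: "x > 0" for x
  proof -
    define y where "y = x / (sqrt 24 * n)"
    have y: "y > 0" "x\<^sup>2 / (24 * (real n)\<^sup>2) = y\<^sup>2" using x n by (simp_all add: y_def power_divide power_mult_distrib)
    have "prob {\<omega>\<in>space P. \<exists>t\<in>T. \<bar>X t \<omega>\<bar> > x} \<le> 3 * exp (- x\<^sup>2 / (24 * (real n)\<^sup>2))"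
      using T0 T n x by (intro fernique) auto
    also have "\<dots> = 3 * exp (- y\<^sup>2)" using y by simp
    also have "exp (- y\<^sup>2) \<le> 1 / y"
    proof -
      have "y \<le> 1 + y\<^sup>2" using sum_squares_ge_zero[of "y - 1" 0] y by (simp add: power2_eq_square algebra_simps)
      also have "\<dots> \<le> exp (y\<^sup>2)" by (rule exp_ge_add_one_self)
      finally show ?thesis using y by (simp add: exp_minus field_simps)
    qed
    also have "3 * (1 / y) = C / x" using n by (simp add: C_def y_def)
    finally show ?thesis by simp
  qed
  moreover have "C \<ge> 0" by (simp add: C_def)
  ultimately show ?thesis by blast
qed

text \<open>
  By self-similarity the block \<open>{2 ^ k..2 ^ Suc k}\<close> exceeds \<open>e * r powr \<beta>\<close> with a probability of order
  \<open>2 powr (- k * (\<beta> - H))\<close>; the Borel--Cantelli lemma applies because \<open>\<beta> > H\<close>.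
\<close>

lemma X_negligible_at_infinity:
  assumes e: "e > 0"
  shows "AE \<omega> in P. \<exists>n. \<forall>r\<in>D. r \<ge> 2 ^ n \<longrightarrow> \<bar>X r \<omega>\<bar> \<le> e * r powr \<beta>"
proof -
  define T where "T = (\<Union>k::nat. (\<lambda>r. r / 2 ^ k) ` {r\<in>D. 2 ^ k \<le> r \<and> r \<le> 2 ^ Suc k})"
  have T: "countable T" "T \<subseteq> {1..2}"
    unfolding T_def using D by (auto simp: field_simps)
  obtain C where C: "C \<ge> 0" "\<And>x. x > 0 \<Longrightarrow> prob {\<omega>\<in>space P. \<exists>t\<in>T. \<bar>X t \<omega>\<bar> > x} \<le> C / x"
    using block_tail[OF T] by blast
  have T0: "t \<in> T \<Longrightarrow> t \<ge> 0" "t \<in> T \<Longrightarrow> X t \<in> borel_measurable P" for t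
    using T by (auto intro!: X_meas)
  define A where "A = (\<lambda>k::nat. {\<omega>\<in>space P. \<exists>r\<in>D. 2 ^ k \<le> r \<and> r \<le> 2 ^ Suc k \<and> \<bar>X r \<omega>\<bar> > e * r powr \<beta>})"
  have A: "A k \<in> events" for k unfolding A_def using D X_meas_D by measurable
  define q where "q = 2 powr (- (\<beta> - H))"
  have q: "0 < q" "q < 1" using \<beta> by (auto simp: q_def intro!: powr_less_one)
  have PA: "prob (A k) \<le> C / e * q ^ k" for k
  proof -
    define a where "a = (2::real) ^ k"
    have a: "a > 0" by (simp add: a_def)
    define B where "B = {y\<in>space path_space. \<exists>t\<in>T. \<bar>y t\<bar> > e * a powr \<beta>}"
    have [measurable]: "(\<lambda>y. y t) \<in> borel_measurable path_space" "X (a * t) \<in> borel_measurable P" if "t \<in> T" for t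
      using T0(1)[OF that] a by (auto intro!: measurable_component_singleton X_meas)
    have B: "B \<in> sets path_space"
      unfolding B_def using T by measurable
    have m1: "{\<omega>\<in>space P. (\<lambda>t\<in>{0..}. X (a * t) \<omega>) \<in> B} = {\<omega>\<in>space P. \<exists>t\<in>T. \<bar>X (a * t) \<omega>\<bar> > e * a powr \<beta>}"
      "{\<omega>\<in>space P. (\<lambda>t\<in>{0..}. a powr H * X t \<omega>) \<in> B} = {\<omega>\<in>space P. \<exists>t\<in>T. \<bar>a powr H * X t \<omega>\<bar> > e * a powr \<beta>}"
      using T0(1) by (auto simp: B_def space_PiM)
    have "prob (A k) \<le> prob {\<omega>\<in>space P. \<exists>t\<in>T. \<bar>X (a * t) \<omega>\<bar> > e * a powr \<beta>}"
    proof (rule finite_measure_mono)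
      show "{\<omega>\<in>space P. \<exists>t\<in>T. \<bar>X (a * t) \<omega>\<bar> > e * a powr \<beta>} \<in> events"
        using T by measurable
      show "A k \<subseteq> {\<omega>\<in>space P. \<exists>t\<in>T. \<bar>X (a * t) \<omega>\<bar> > e * a powr \<beta>}"
      proof
        fix \<omega> assume "\<omega> \<in> A k"
        then obtain r where r: "\<omega> \<in> space P" "r \<in> D" "a \<le> r" "r \<le> 2 ^ Suc k" "\<bar>X r \<omega>\<bar> > e * r powr \<beta>"
          by (auto simp: A_def a_def)
        have "r / a \<in> T" unfolding T_def a_def using r by (auto simp: a_def)
        moreover have "e * a powr \<beta> \<le> e * r powr \<beta>"
          using r a e \<beta>_pos by (intro mult_left_mono powr_mono2) auto
        ultimately show "\<omega> \<in> {\<omega>\<in>space P. \<exists>t\<in>T. \<bar>X (a * t) \<omega>\<bar> > e * a powr \<beta>}"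
          using r a by (auto intro!: bexI[of _ "r / a"])
      qed
    qed
    also have "\<dots> = prob {\<omega>\<in>space P. \<exists>t\<in>T. \<bar>a powr H * X t \<omega>\<bar> > e * a powr \<beta>}"
      using X_scale[OF a B] unfolding m1 .
    also have "{\<omega>\<in>space P. \<exists>t\<in>T. \<bar>a powr H * X t \<omega>\<bar> > e * a powr \<beta>} = {\<omega>\<in>space P. \<exists>t\<in>T. \<bar>X t \<omega>\<bar> > e * a powr (\<beta> - H)}"
      using a by (simp add: abs_mult powr_diff field_simps)
    also have "prob \<dots> \<le> C / (e * a powr (\<beta> - H))" using e a by (intro C) simp
    also have "\<dots> = C / e * q ^ k"
    proof -
      have "a powr (\<beta> - H) = (2 powr (\<beta> - H)) ^ k"
        unfolding a_def by (simp add: powr_powr mult.commute flip: powr_realpow)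
      moreover have "q ^ k = 1 / (2 powr (\<beta> - H)) ^ k"
        unfolding q_def powr_minus_divide by (simp add: power_one_over)
      ultimately show ?thesis by simp
    qed
    finally show ?thesis .
  qed
  have "summable (\<lambda>k. prob (A k))"
  proof (rule summable_comparison_test')
    show "summable (\<lambda>k. C / e * q ^ k)" using q by (intro summable_mult summable_geometric) simp
    show "norm (prob (A k)) \<le> C / e * q ^ k" for k using PA[of k] by simp
  qed
  then have "AE \<omega> in P. eventually (\<lambda>k. \<omega> \<in> space P - A k) sequentially"
    using A by (intro borel_cantelli_AE1) (auto simp: emeasure_eq_measure)
  then show ?thesis
  proof eventually_elim
    case (elim \<omega>)
    then obtain n where n: "\<And>k. k \<ge> n \<Longrightarrow> \<omega> \<in> space P - A k" by (auto simp: eventually_sequentially)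
    have "\<bar>X r \<omega>\<bar> \<le> e * r powr \<beta>" if r: "r \<in> D" "r \<ge> 2 ^ n" for r
    proof -
      define k where "k = nat \<lfloor>log 2 r\<rfloor>"
      have r1: "r \<ge> 1" using r(2) one_le_power[of "2::real" n] by linarith
      then have l0: "log 2 r \<ge> 0" by simp
      have k1: "2 ^ k \<le> r"
      proof -
        have "real k \<le> log 2 r" using l0 by (simp add: k_def)
        then have "2 powr real k \<le> r" using r1 by (simp add: le_log_iff)
        then show ?thesis by (simp add: powr_realpow)
      qed
      have k2: "r \<le> 2 ^ Suc k"
      proof -
        have "log 2 r \<le> real (Suc k)" using l0 by (simp add: k_def) linarith
        then have "r \<le> 2 powr real (Suc k)" using r1 by (simp add: log_le_iff)
        then show ?thesis by (simp only: powr_realpow)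
      qed
      have "n \<le> k"
      proof -
        have "2 powr real n \<le> r" using r(2) by (simp add: powr_realpow)
        then have "real n \<le> log 2 r" using r1 by (simp add: le_log_iff)
        then show ?thesis by (simp add: k_def le_nat_iff le_floor_iff)
      qed
      then show ?thesis using n[of k] k1 k2 r by (auto simp: A_def not_less)
    qed
    then show ?case by blast
  qed
qed

lemma X_vanishing_at_infinity:
  "AE \<omega> in P. \<forall>e>0. \<exists>n. \<forall>r\<in>D. r \<ge> 2 ^ n \<longrightarrow> \<bar>X r \<omega>\<bar> \<le> e * barrier c \<beta> r"
proof -
  have "AE \<omega> in P. \<forall>k::nat. \<exists>n. \<forall>r\<in>D. r \<ge> 2 ^ n \<longrightarrow> \<bar>X r \<omega>\<bar> \<le> c / Suc k * r powr \<beta>"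
    unfolding AE_all_countable using c by (intro allI X_negligible_at_infinity) simp
  then show ?thesis
  proof eventually_elim
    case (elim \<omega>)
    show ?case
    proof (intro allI impI)
      fix e :: real assume e: "e > 0"
      then obtain k where k: "1 / Suc k < e" using nat_approx_posE by blast
      obtain n where n: "\<And>r. r \<in> D \<Longrightarrow> r \<ge> 2 ^ n \<Longrightarrow> \<bar>X r \<omega>\<bar> \<le> c / Suc k * r powr \<beta>"
        using elim by blast
      have "c / Suc k * r powr \<beta> \<le> e * barrier c \<beta> r" for r
      proof -
        have "c / Suc k * r powr \<beta> = (1 / Suc k) * (c * r powr \<beta>)" by simp
        also have "\<dots> \<le> e * (c * r powr \<beta>)" using k c by (intro mult_right_mono) auto
        also have "\<dots> \<le> e * barrier c \<beta> r" using e by (simp add: barrier_def)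
        finally show ?thesis .
      qed
      then show "\<exists>n. \<forall>r\<in>D. r \<ge> 2 ^ n \<longrightarrow> \<bar>X r \<omega>\<bar> \<le> e * barrier c \<beta> r"
        using n by (meson order.trans)
    qed
  qed
qed

lemma X_bounded_by_barrier: "AE \<omega> in P. \<exists>R. \<forall>r\<in>D. \<bar>X r \<omega>\<bar> \<le> R * barrier c \<beta> r"
  using X_vanishing_at_infinity X_cont
proof eventually_elim
  case (elim \<omega>)
  obtain n where n: "\<And>r. r \<in> D \<Longrightarrow> r \<ge> 2 ^ n \<Longrightarrow> \<bar>X r \<omega>\<bar> \<le> 1 * barrier c \<beta> r"
    using elim(1) zero_less_one by blast
  have "compact ((\<lambda>t. X t \<omega>) ` {0..2 ^ n})"
    using elim(2) by (intro compact_continuous_image) (auto elim: continuous_on_subset)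
  then obtain b where "\<forall>y\<in>(\<lambda>t. X t \<omega>) ` {0..2 ^ n}. norm y \<le> b"
    using compact_imp_bounded bounded_iff by blast
  then have b: "\<And>t. 0 \<le> t \<Longrightarrow> t \<le> 2 ^ n \<Longrightarrow> \<bar>X t \<omega>\<bar> \<le> b" by auto
  have "\<bar>X 0 \<omega>\<bar> \<le> b" by (rule b) auto
  then have b0: "b \<ge> 0" by linarith
  have "\<bar>X r \<omega>\<bar> \<le> (b + 1) * barrier c \<beta> r" if "r \<in> D" for r
  proof (cases "r \<ge> 2 ^ n")
    case True
    have "1 * barrier c \<beta> r \<le> (b + 1) * barrier c \<beta> r"
      using b0 barrier_pos[of r] by (intro mult_right_mono) auto
    then show ?thesis using n[OF that True] by linarith
  next
    case False
    have "\<bar>X r \<omega>\<bar> \<le> b * 1" using b[of r] False that D by auto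
    also have "\<dots> \<le> (b + 1) * barrier c \<beta> r" using b0 barrier_D[of r] by (intro mult_mono) auto
    finally show ?thesis .
  qed
  then show ?case by blast
qed

lemma prob_not_bounded_by_barrier:
  "(\<lambda>n. prob {\<omega>\<in>space P. \<exists>r\<in>D. \<bar>X r \<omega>\<bar> > real n * barrier c \<beta> r}) \<longlonglongrightarrow> 0"
proof (rule prob_tendsto_0_of_eventually_notin)
  show "{\<omega>\<in>space P. \<exists>r\<in>D. \<bar>X r \<omega>\<bar> > real n * barrier c \<beta> r} \<in> events" for n
    using D X_meas_D by measurable
  show "{\<omega>\<in>space P. \<exists>r\<in>D. \<bar>X r \<omega>\<bar> > real n * barrier c \<beta> r} \<subseteq> {\<omega>\<in>space P. \<exists>r\<in>D. \<bar>X r \<omega>\<bar> > real m * barrier c \<beta> r}"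
    if "m \<le> n" for m n
  proof -
    have "real m * barrier c \<beta> r \<le> real n * barrier c \<beta> r" for r
      using that barrier_pos[of r] by simp
    then show ?thesis by (blast intro: le_less_trans)
  qed
  show "AE \<omega> in P. \<exists>n. \<omega> \<notin> {\<omega>\<in>space P. \<exists>r\<in>D. \<bar>X r \<omega>\<bar> > real n * barrier c \<beta> r}"
    using X_bounded_by_barrier
  proof eventually_elim
    case (elim \<omega>)
    then obtain R where R: "\<And>r. r \<in> D \<Longrightarrow> \<bar>X r \<omega>\<bar> \<le> R * barrier c \<beta> r" by blast
    obtain n where "R \<le> real n" using real_arch_simple by blast
    then have "R * barrier c \<beta> r \<le> real n * barrier c \<beta> r" for r
      using barrier_pos[of r] by simp
    then show ?case using R by (intro exI[of _ n]) (auto simp: not_less intro: order.trans)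
  qed
qed

lemma local_oscillation:
  assumes s: "s \<ge> 0" and g: "continuous_on {0..} g" and K: "K > 0"
  shows "\<exists>\<delta>>0. \<forall>x\<ge>0. prob {\<omega>\<in>space P. \<exists>r\<in>D. \<bar>r - s\<bar> < \<delta> \<and> \<bar>g r * X r \<omega> - g s * X s \<omega>\<bar> > x} \<le> 3 * exp (- K * x\<^sup>2)"
proof -
  define A where "A = (\<lambda>n::nat. {r\<in>D. \<bar>r - s\<bar> < 1 / Suc n})"
  have "\<exists>n. \<forall>x\<ge>0. prob {\<omega>\<in>space P. \<exists>r\<in>A n. \<bar>g r * X r \<omega> - g s * X s \<omega>\<bar> > x} \<le> 3 * exp (- K * x\<^sup>2)"
  proof (rule fernique_shrinking)
    show "(\<lambda>\<omega>. g r * X r \<omega> - g s * X s \<omega>) \<in> linear_functionals X" if "r \<in> A 0" for r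
      using that D s by (intro V_diff V_scale X_in) (auto simp: A_def)
    show "countable (A 0)" using D by (auto simp: A_def)
    show "A n \<subseteq> A m" if "m \<le> n" for m n
    proof -
      have "1 / real (Suc n) \<le> 1 / real (Suc m)" using that by (intro divide_left_mono) auto
      then show ?thesis unfolding A_def by (auto intro: less_le_trans)
    qed
    show "AE \<omega> in P. \<forall>e>0. \<exists>n. \<forall>r\<in>A n. \<bar>g r * X r \<omega> - g s * X s \<omega>\<bar> \<le> e"
      using X_cont
    proof eventually_elim
      case (elim \<omega>)
      have "continuous_on {0..} (\<lambda>r. g r * X r \<omega>)" using elim g by (intro continuous_intros)
      show ?case
      proof (intro allI impI)
        fix e :: real assume "e > 0"
        then obtain d where d: "d > 0" "\<And>r. r \<in> {0..} \<Longrightarrow> dist r s < d \<Longrightarrow> dist (g r * X r \<omega>) (g s * X s \<omega>) < e"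
          using \<open>continuous_on {0..} (\<lambda>r. g r * X r \<omega>)\<close> s unfolding continuous_on_iff by (metis atLeast_iff)
        obtain n where n: "1 / Suc n < d" using d(1) nat_approx_posE by blast
        show "\<exists>n. \<forall>r\<in>A n. \<bar>g r * X r \<omega> - g s * X s \<omega>\<bar> \<le> e"
          using d(2) n D by (intro exI[of _ n]) (force simp: A_def dist_real_def)
      qed
    qed
  qed fact
  then obtain n where n: "\<And>x. x \<ge> 0 \<Longrightarrow> prob {\<omega>\<in>space P. \<exists>r\<in>A n. \<bar>g r * X r \<omega> - g s * X s \<omega>\<bar> > x} \<le> 3 * exp (- K * x\<^sup>2)"
    by blast
  moreover have "(\<exists>r\<in>A n. Q r) \<longleftrightarrow> (\<exists>r\<in>D. \<bar>r - s\<bar> < 1 / Suc n \<and> Q r)" for Q by (auto simp: A_def)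
  ultimately show ?thesis by (intro exI[of _ "1 / Suc n"]) auto
qed

text \<open>
  If the increments over a short time interval had a variance \<open>w\<close> that is not small, they would
  exceed \<open>sqrt w\<close> with a probability bounded from below.
\<close>

lemma covariance_near:
  assumes s: "s > 0"
  shows "\<exists>\<delta>>0. \<forall>r\<in>D. \<bar>r - s\<bar> < \<delta> \<longrightarrow>
    expectation (\<lambda>\<omega>. X r \<omega> * X s \<omega>) \<in> {s powr (2 * H) / 2..2 * s powr (2 * H)}"
proof -
  define v where "v = s powr (2 * H)"
  have v: "v > 0" using s by (simp add: v_def)
  define l where "l = exp (- (1 + 1)\<^sup>2 / 2) / sqrt (2 * pi)"
  have l: "l > 0" by (simp add: l_def)
  \<comment> \<open>Chosen such that \<open>3 * exp (- K * w) < l\<close> for every variance \<open>w > v / 4\<close>.\<close>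
  define K where "K = max 1 (ln (4 / l)) / (v / 4)"
  have K: "K > 0" "K * (v / 4) \<ge> ln (4 / l)" using v by (auto simp: K_def)
  obtain \<delta> where \<delta>: "\<delta> > 0" "\<And>x. x \<ge> 0 \<Longrightarrow> prob {\<omega>\<in>space P. \<exists>r\<in>D. \<bar>r - s\<bar> < \<delta> \<and> \<bar>1 * X r \<omega> - 1 * X s \<omega>\<bar> > x} \<le> 3 * exp (- K * x\<^sup>2)"
    using local_oscillation[OF _ continuous_on_const K(1), of s 1] s by auto
  have "expectation (\<lambda>\<omega>. X r \<omega> * X s \<omega>) \<in> {v / 2..2 * v}" if r: "r \<in> D" "\<bar>r - s\<bar> < \<delta>" for r
  proof -
    define Y where "Y = (\<lambda>\<omega>. X r \<omega> - X s \<omega>)"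
    have Vr: "X r \<in> linear_functionals X" and Vs: "X s \<in> linear_functionals X"
      using r s D by (auto intro!: X_in)
    have Y: "Y \<in> linear_functionals X" using Vr Vs unfolding Y_def by (rule V_diff)
    define w where "w = expectation (\<lambda>\<omega>. (Y \<omega>)\<^sup>2)"
    have w: "w \<le> v / 4"
    proof (rule ccontr)
      assume "\<not> w \<le> v / 4"
      then have w4: "w > v / 4" by simp
      then have w0: "w > 0" using v by simp
      have "l \<le> prob {\<omega>\<in>space P. Y \<omega> > sqrt w * 1}"
        unfolding l_def by (rule normal_tail_lower[OF Y w_def w0]) simp
      also have "\<dots> \<le> prob {\<omega>\<in>space P. \<exists>r\<in>D. \<bar>r - s\<bar> < \<delta> \<and> \<bar>1 * X r \<omega> - 1 * X s \<omega>\<bar> > sqrt w}"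
      proof (rule finite_measure_mono)
        show "{\<omega>\<in>space P. \<exists>r\<in>D. \<bar>r - s\<bar> < \<delta> \<and> \<bar>1 * X r \<omega> - 1 * X s \<omega>\<bar> > sqrt w} \<in> events"
          using D X_meas_D V_meas[OF Vs] by measurable
        show "{\<omega>\<in>space P. Y \<omega> > sqrt w * 1} \<subseteq> {\<omega>\<in>space P. \<exists>r\<in>D. \<bar>r - s\<bar> < \<delta> \<and> \<bar>1 * X r \<omega> - 1 * X s \<omega>\<bar> > sqrt w}"
          using r unfolding Y_def by force
      qed
      also have "\<dots> \<le> 3 * exp (- K * (sqrt w)\<^sup>2)" using w0 by (intro \<delta>) simp
      also have "\<dots> \<le> 3 * exp (- ln (4 / l))"
      proof -
        have "K * (v / 4) \<le> K * w" using K w4 by (intro mult_left_mono) auto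
        then have "ln (4 / l) \<le> K * w" using K(2) by linarith
        then show ?thesis using w0 by simp
      qed
      also have "\<dots> = 3 * l / 4" using l by (simp add: exp_minus)
      finally show False using l by simp
    qed
    have XY: "expectation (\<lambda>\<omega>. X r \<omega> * X s \<omega>) = v + expectation (\<lambda>\<omega>. Y \<omega> * X s \<omega>)"
    proof -
      have "expectation (\<lambda>\<omega>. X r \<omega> * X s \<omega>) = expectation (\<lambda>\<omega>. (X s \<omega>)\<^sup>2 + Y \<omega> * X s \<omega>)"
        by (simp add: Y_def power2_eq_square algebra_simps)
      also have "\<dots> = expectation (\<lambda>\<omega>. (X s \<omega>)\<^sup>2) + expectation (\<lambda>\<omega>. Y \<omega> * X s \<omega>)"
        by (rule Bochner_Integration.integral_add[OF V_integrable_square[OF Vs] V_integrable_mult[OF Y Vs]])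
      finally show ?thesis using X_var[of s] s by (simp add: v_def)
    qed
    have "0 \<le> expectation (\<lambda>\<omega>. (2 * Y \<omega> + 1 * X s \<omega>)\<^sup>2)" "0 \<le> expectation (\<lambda>\<omega>. (2 * Y \<omega> + (- 1) * X s \<omega>)\<^sup>2)"
      by simp_all
    then have "\<bar>expectation (\<lambda>\<omega>. Y \<omega> * X s \<omega>)\<bar> \<le> v / 2"
      unfolding V_square_lincomb[OF Y Vs] using w X_var[of s] s by (simp add: w_def v_def)
    then show ?thesis unfolding XY using v by (simp add: abs_le_iff) linarith
  qed
  then show ?thesis using \<delta>(1) unfolding v_def by blast
qed

end

section \<open>Crossings away from the most likely time\<close>

text \<open>
  Tails are compared by their Gaussian rate only; \<open>a0\<close> will be the rate of the crossing at \<open>s0\<close>.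
\<close>

definition lighter_tail :: "real \<Rightarrow> (real \<Rightarrow> real) \<Rightarrow> bool" where
  "lighter_tail a0 p \<longleftrightarrow> (\<exists>a>a0. \<exists>C. \<forall>x\<ge>0. p x \<le> C * exp (- a * x\<^sup>2))"

lemma lighter_tailI: "a > a0 \<Longrightarrow> (\<And>x. x \<ge> 0 \<Longrightarrow> p x \<le> C * exp (- a * x\<^sup>2)) \<Longrightarrow> lighter_tail a0 p"
  unfolding lighter_tail_def by blast

lemma lighter_tail_add:
  assumes p: "lighter_tail a0 p" and q: "lighter_tail a0 q" and r: "\<And>x. x \<ge> 0 \<Longrightarrow> r x \<le> p x + q x"
  shows "lighter_tail a0 r"
proof -
  obtain a C where p: "a > a0" "\<And>x. x \<ge> 0 \<Longrightarrow> p x \<le> C * exp (- a * x\<^sup>2)"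
    using p unfolding lighter_tail_def by blast
  obtain b E where q: "b > a0" "\<And>x. x \<ge> 0 \<Longrightarrow> q x \<le> E * exp (- b * x\<^sup>2)"
    using q unfolding lighter_tail_def by blast
  show ?thesis
  proof (rule lighter_tailI)
    show "min a b > a0" using p q by simp
    fix x :: real assume x: "x \<ge> 0"
    have e: "exp (- a * x\<^sup>2) \<le> exp (- min a b * x\<^sup>2)" "exp (- b * x\<^sup>2) \<le> exp (- min a b * x\<^sup>2)"
      by (auto intro!: mult_right_mono)
    have "C * exp (- a * x\<^sup>2) \<le> \<bar>C\<bar> * exp (- min a b * x\<^sup>2)" "E * exp (- b * x\<^sup>2) \<le> \<bar>E\<bar> * exp (- min a b * x\<^sup>2)"
      using e by (intro mult_mono; simp)+
    then show "r x \<le> (\<bar>C\<bar> + \<bar>E\<bar>) * exp (- min a b * x\<^sup>2)"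
      using p(2)[OF x] q(2)[OF x] r[OF x] by (simp add: distrib_right)
  qed
qed

lemma lighter_tail_mono:
  assumes "lighter_tail a0 p" "\<And>x. x \<ge> 0 \<Longrightarrow> r x \<le> p x"
  shows "lighter_tail a0 r"
  using assms unfolding lighter_tail_def by (meson order.trans)

text \<open>
  With \<open>p = H / \<beta>\<close> and \<open>w = (s / s0) powr \<beta>\<close> this is the strict weighted inequality between
  the geometric and the arithmetic mean of \<open>1\<close> and \<open>w\<close>.
\<close>

lemma scaled_sd_less:
  assumes H: "0 < H" "H < \<beta>" and c: "c > 0" and s: "s \<ge> 0" "s \<noteq> t_zero H c \<beta>"
  shows "s powr H / barrier c \<beta> s < t_zero H c \<beta> powr H / barrier c \<beta> (t_zero H c \<beta>)"
proof -
  define s0 where "s0 = t_zero H c \<beta>"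
  have b0: "\<beta> > 0" using H by simp
  have s0: "s0 > 0" using H c by (simp add: s0_def t_zero_def)
  have s0b: "c * s0 powr \<beta> = H / (\<beta> - H)"
    using H c b0 by (simp add: s0_def t_zero_def powr_powr)
  have m0: "barrier c \<beta> s0 = \<beta> / (\<beta> - H)"
    using H by (simp add: barrier_def s0b field_simps)
  show ?thesis
  proof (cases "s = 0")
    case True
    then show ?thesis using s0 m0 H by (simp add: s0_def[symmetric])
  next
    case False
    with s have sp: "s > 0" by simp
    define p where "p = H / \<beta>"
    have p: "0 < p" "p < 1" using H by (auto simp: p_def)
    define w where "w = (s / s0) powr \<beta>"
    have w: "w > 0" using sp s0 by (simp add: w_def)
    have w1: "w \<noteq> 1"
    proof
      assume "w = 1"
      then have "\<beta> * ln (s / s0) = 0" using sp s0 ln_powr[of "s / s0" \<beta>] by (simp add: w_def)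
      then have "s / s0 = 1" using sp s0 b0 by simp
      then show False using s s0 by (simp add: s0_def)
    qed
    define A where "A = (1 - p) + p * w"
    have A: "A > 0" using p w by (simp add: A_def add_pos_pos)
    have A1: "A \<noteq> 1" using p w1 by (simp add: A_def algebra_simps)
    have "ln (1 / A) < 1 / A - 1"
      using ln_le_minus_one[of "1 / A"] ln_eq_minus_one[of "1 / A"] A A1 by fastforce
    moreover have "ln (w / A) \<le> w / A - 1" using A w by (intro ln_le_minus_one) simp
    ultimately have "(1 - p) * ln (1 / A) + p * ln (w / A) < (1 - p) * (1 / A - 1) + p * (w / A - 1)"
      using p by (intro add_less_le_mono mult_strict_left_mono mult_left_mono) auto
    also have "\<dots> = A / A - 1" 
    proof -
      have "(1 - p) * (1 / A - 1) + p * (w / A - 1) = ((1 - p) + p * w) / A - 1"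
        using A by (simp add: field_simps)
      then show ?thesis by (simp add: A_def)
    qed
    finally have "p * ln w < ln A" using A w by (simp add: ln_div algebra_simps)
    then have "w powr p < A" using A w by (simp add: powr_def) (metis exp_less_mono exp_ln)
    moreover have "w powr p = (s / s0) powr H" using b0 by (simp add: w_def p_def powr_powr)
    moreover have "barrier c \<beta> s = barrier c \<beta> s0 * A"
    proof -
      have "s powr \<beta> = s0 powr \<beta> * w" using sp s0 by (simp add: w_def powr_divide)
      then have "barrier c \<beta> s = 1 + (c * s0 powr \<beta>) * w" by (simp add: barrier_def)
      also have "\<dots> = barrier c \<beta> s0 * A" unfolding s0b m0 A_def p_def using H by (simp add: field_simps)
      finally show ?thesis .
    qed
    moreover have "barrier c \<beta> s0 > 0" using m0 H by simp
    ultimately show ?thesis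
      using A s0 sp unfolding s0_def[symmetric] by (simp add: powr_divide field_simps)
  qed
qed

locale barrier_crossing = drifted_process +
  fixes s0
  assumes s0_def: "s0 = t_zero H c \<beta>" and s0_D: "s0 \<in> D"
begin

lemma s0_pos: "s0 > 0"
  using H \<beta> c by (simp add: s0_def t_zero_def)

lemma X_var_sq: "t \<ge> 0 \<Longrightarrow> expectation (\<lambda>\<omega>. (X t \<omega>)\<^sup>2) = (t powr H)\<^sup>2"
  unfolding X_var by (simp add: power2_eq_square flip: powr_add)

definition sd0 :: real where "sd0 = s0 powr H / barrier c \<beta> s0"

lemma sd0_pos: "sd0 > 0"
  using s0_pos barrier_pos by (simp add: sd0_def)

definition crossing :: "real set \<Rightarrow> real \<Rightarrow> 'a set" where
  "crossing A x = {\<omega>\<in>space P. \<exists>r\<in>D. r \<in> A \<and> X r \<omega> > x * barrier c \<beta> r}"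

lemma crossing_events [measurable]: "crossing A x \<in> events"
  unfolding crossing_def using D X_meas_D by measurable

lemma prob_crossing_subset_Un:
  assumes "A \<subseteq> B \<union> E"
  shows "prob (crossing A x) \<le> prob (crossing B x) + prob (crossing E x)"
proof -
  have "prob (crossing A x) \<le> prob (crossing B x \<union> crossing E x)"
    by (intro finite_measure_mono sets.Un crossing_events) (use assms in \<open>auto simp: crossing_def\<close>)
  also have "\<dots> \<le> prob (crossing B x) + prob (crossing E x)"
    by (rule measure_Un_le) auto
  finally show ?thesis .
qed

text \<open>
  The standard deviation of \<open>X s / barrier c \<beta> s\<close> is smaller than \<open>sd0\<close>. A crossing near \<open>s\<close>
  needs a large value at \<open>s\<close> or a large oscillation; the proportion \<open>q < 1\<close> of the level given to
  the former is chosen such that its rate still beats that of \<open>s0\<close>.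
\<close>

lemma lighter_tail_near:
  assumes s: "s \<ge> 0" "s \<noteq> s0"
  shows "\<exists>\<delta>>0. lighter_tail (1 / (2 * sd0\<^sup>2)) (\<lambda>x. prob (crossing (ball s \<delta>) x))"
proof -
  define v where "v = (s powr H / barrier c \<beta> s)\<^sup>2"
  have v: "v < sd0\<^sup>2"
  proof -
    have "s powr H / barrier c \<beta> s < sd0"
      using scaled_sd_less[OF H \<beta> c s(1)] s(2) unfolding sd0_def s0_def[symmetric] by blast
    then show ?thesis
      unfolding v_def using barrier_pos[of s] by (intro power_strict_mono) auto
  qed
  define w where "w = (v + sd0\<^sup>2) / 2"
  have v0: "v \<ge> 0" by (simp add: v_def)
  have w: "v \<le> w" "w > 0" "w < sd0\<^sup>2" using v v0 sd0_pos by (auto simp: w_def)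
  define q where "q = sqrt ((w / sd0\<^sup>2 + 1) / 2)"
  have q2: "q\<^sup>2 = (w / sd0\<^sup>2 + 1) / 2" using w by (simp add: q_def)
  have wq: "w / sd0\<^sup>2 < 1" "w / sd0\<^sup>2 > 0" using w sd0_pos by simp_all
  have q: "0 < q" "q < 1" using w wq by (auto simp: q_def)
  define a where "a = q\<^sup>2 / (2 * w)"
  have a: "a > 1 / (2 * sd0\<^sup>2)"
  proof -
    have "w / sd0\<^sup>2 < q\<^sup>2" using q2 wq by simp
    then show ?thesis using w sd0_pos by (simp add: a_def field_simps)
  qed
  have a0: "a > 0" using q w by (simp add: a_def)
  define K where "K = a / (1 - q)\<^sup>2"
  have K: "K > 0" using a0 q by (simp add: K_def)
  define g where "g = (\<lambda>s. 1 / barrier c \<beta> s)"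
  have g: "continuous_on {0..} g"
    unfolding g_def using continuous_on_barrier[OF \<beta>_pos] barrier_pos
    by (intro continuous_intros) (auto simp: less_imp_neq[OF barrier_pos, symmetric])
  obtain \<delta> where \<delta>: "\<delta> > 0" "\<And>x. x \<ge> 0 \<Longrightarrow>
      prob {\<omega>\<in>space P. \<exists>r\<in>D. \<bar>r - s\<bar> < \<delta> \<and> \<bar>g r * X r \<omega> - g s * X s \<omega>\<bar> > x} \<le> 3 * exp (- K * x\<^sup>2)"
    using local_oscillation[OF s(1) g K] by blast
  have Vs: "(\<lambda>\<omega>. g s * X s \<omega>) \<in> linear_functionals X" using s by (intro V_scale X_in)
  have var: "expectation (\<lambda>\<omega>. (g s * X s \<omega>)\<^sup>2) = v"
    using s by (simp add: X_var_sq power_mult_distrib v_def g_def power_divide)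
  have "prob (crossing (ball s \<delta>) x) \<le> 4 * exp (- a * x\<^sup>2)" if x: "x \<ge> 0" for x
  proof -
    let ?A = "{\<omega>\<in>space P. g s * X s \<omega> > q * x}"
    let ?B = "{\<omega>\<in>space P. \<exists>r\<in>D. \<bar>r - s\<bar> < \<delta> \<and> \<bar>g r * X r \<omega> - g s * X s \<omega>\<bar> > (1 - q) * x}"
    have ev: "?A \<in> events" "?B \<in> events"
      using D X_meas_D V_meas[OF Vs] by measurable
    have "crossing (ball s \<delta>) x \<subseteq> ?A \<union> ?B"
    proof
      fix \<omega> assume "\<omega> \<in> crossing (ball s \<delta>) x"
      then obtain r where r: "\<omega> \<in> space P" "r \<in> D" "\<bar>r - s\<bar> < \<delta>" "X r \<omega> > x * barrier c \<beta> r"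
        by (auto simp: crossing_def dist_real_def abs_minus_commute)
      then have "g r * X r \<omega> > x" using barrier_pos[of r] by (simp add: g_def field_simps)
      then have "g s * X s \<omega> > q * x \<or> \<bar>g r * X r \<omega> - g s * X s \<omega>\<bar> > (1 - q) * x"
        by (simp add: left_diff_distrib) linarith
      then show "\<omega> \<in> ?A \<union> ?B" using r by auto
    qed
    then have "prob (crossing (ball s \<delta>) x) \<le> prob (?A \<union> ?B)" using ev by (intro finite_measure_mono) auto
    also have "\<dots> \<le> prob ?A + prob ?B" using ev by (rule measure_Un_le)
    also have "prob ?A \<le> exp (- (q * x)\<^sup>2 / (2 * w))"
      using normal_tail_upper[OF Vs, of w "q * x"] var w q x by simp
    also have "- (q * x)\<^sup>2 / (2 * w) = - a * x\<^sup>2" by (simp add: a_def power_mult_distrib)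
    also have "prob ?B \<le> 3 * exp (- K * ((1 - q) * x)\<^sup>2)" using q x by (intro \<delta>) simp
    also have "- K * ((1 - q) * x)\<^sup>2 = - a * x\<^sup>2" using q by (simp add: K_def power_mult_distrib)
    finally show ?thesis by simp
  qed
  then show ?thesis using \<delta>(1) a by (intro exI[of _ \<delta>] conjI lighter_tailI[of _ a _ 4]) auto
qed

lemma lighter_tail_infinity:
  "\<exists>n. lighter_tail (1 / (2 * sd0\<^sup>2)) (\<lambda>x. prob (crossing {2 ^ n..} x))"
proof -
  define A where "A = (\<lambda>n::nat. {r\<in>D. r \<ge> 2 ^ n})"
  define g where "g = (\<lambda>s. 1 / barrier c \<beta> s)"
  have K: "1 / sd0\<^sup>2 > 0" using sd0_pos by simp
  have "\<exists>n. \<forall>x\<ge>0. prob {\<omega>\<in>space P. \<exists>r\<in>A n. \<bar>g r * X r \<omega>\<bar> > x} \<le> 3 * exp (- (1 / sd0\<^sup>2) * x\<^sup>2)"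
  proof (rule fernique_shrinking)
    show "(\<lambda>\<omega>. g r * X r \<omega>) \<in> linear_functionals X" if "r \<in> A 0" for r
      using that D by (intro V_scale X_in) (auto simp: A_def)
    show "countable (A 0)" using D by (auto simp: A_def)
    show "A n \<subseteq> A m" if "m \<le> n" for m n
      by (auto simp: A_def intro: order.trans[OF power_increasing[OF that one_le_numeral]])
    show "AE \<omega> in P. \<forall>e>0. \<exists>n. \<forall>r\<in>A n. \<bar>g r * X r \<omega>\<bar> \<le> e"
      using X_vanishing_at_infinity
    proof eventually_elim
      case (elim \<omega>)
      show ?case
      proof (intro allI impI)
        fix e :: real assume "e > 0"
        then obtain n where "\<forall>r\<in>D. r \<ge> 2 ^ n \<longrightarrow> \<bar>X r \<omega>\<bar> \<le> e * barrier c \<beta> r" using elim by blast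
        then have "\<forall>r\<in>A n. \<bar>g r * X r \<omega>\<bar> \<le> e"
          using barrier_pos by (auto simp: A_def g_def abs_mult divide_le_eq abs_of_pos)
        then show "\<exists>n. \<forall>r\<in>A n. \<bar>g r * X r \<omega>\<bar> \<le> e" by blast
      qed
    qed
  qed fact
  then obtain n where n: "\<And>x. x \<ge> 0 \<Longrightarrow> prob {\<omega>\<in>space P. \<exists>r\<in>A n. \<bar>g r * X r \<omega>\<bar> > x} \<le> 3 * exp (- (1 / sd0\<^sup>2) * x\<^sup>2)"
    by blast
  have "prob (crossing {2 ^ n..} x) \<le> 3 * exp (- (1 / sd0\<^sup>2) * x\<^sup>2)" if x: "x \<ge> 0" for x
  proof -
    have "prob (crossing {2 ^ n..} x) \<le> prob {\<omega>\<in>space P. \<exists>r\<in>A n. \<bar>g r * X r \<omega>\<bar> > x}"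
    proof (rule finite_measure_mono)
      show "{\<omega>\<in>space P. \<exists>r\<in>A n. \<bar>g r * X r \<omega>\<bar> > x} \<in> events"
      proof -
        have "countable (A n)" "\<And>r. r \<in> A n \<Longrightarrow> X r \<in> borel_measurable P"
          using D X_meas_D by (auto simp: A_def)
        then show ?thesis by measurable
      qed
      show "crossing {2 ^ n..} x \<subseteq> {\<omega>\<in>space P. \<exists>r\<in>A n. \<bar>g r * X r \<omega>\<bar> > x}"
      proof
        fix \<omega> assume "\<omega> \<in> crossing {2 ^ n..} x"
        then obtain r where r: "\<omega> \<in> space P" "r \<in> A n" "X r \<omega> > x * barrier c \<beta> r"
          by (auto simp: crossing_def A_def)
        then have "g r * X r \<omega> > x" using barrier_pos[of r] by (simp add: g_def field_simps)
        then show "\<omega> \<in> {\<omega>\<in>space P. \<exists>r\<in>A n. \<bar>g r * X r \<omega>\<bar> > x}" using r by force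
      qed
    qed
    then show ?thesis using n[OF x] by linarith
  qed
  moreover have "1 / sd0\<^sup>2 > 1 / (2 * sd0\<^sup>2)" using sd0_pos by (simp add: field_simps)
  ultimately show ?thesis by (intro exI[of _ n] lighter_tailI[of _ "1 / sd0\<^sup>2"])
qed

text \<open>
  Crossings away from \<open>s0\<close> have a lighter tail than the crossing at \<open>s0\<close>, by compactness of the
  remaining time interval.
\<close>

lemma lighter_tail_away:
  assumes \<delta>: "\<delta> > 0"
  shows "lighter_tail (1 / (2 * sd0\<^sup>2)) (\<lambda>x. prob (crossing (- ball s0 \<delta>) x))"
proof -
  let ?L = "\<lambda>A. lighter_tail (1 / (2 * sd0\<^sup>2)) (\<lambda>x. prob (crossing A x))"
  obtain n where n: "?L {2 ^ n..}" using lighter_tail_infinity by blast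
  let ?S = "{0..2 ^ n} - ball s0 \<delta>"
  have "\<forall>s\<in>?S. \<exists>\<delta>>0. ?L (ball s \<delta>)"
    using \<delta> by (intro ballI lighter_tail_near) auto
  then obtain d where d: "\<And>s. s \<in> ?S \<Longrightarrow> d s > 0" "\<And>s. s \<in> ?S \<Longrightarrow> ?L (ball s (d s))" by metis
  have cS: "compact ?S" by (intro compact_diff) auto
  have cover: "?S \<subseteq> (\<Union>s\<in>?S. ball s (d s))"
  proof
    fix x assume x: "x \<in> ?S"
    show "x \<in> (\<Union>s\<in>?S. ball s (d s))" using d(1)[OF x] by (intro UN_I[OF x]) simp
  qed
  obtain F where F: "F \<subseteq> ?S" "finite F" "?S \<subseteq> (\<Union>s\<in>F. ball s (d s))"
    by (rule compactE_image[OF cS _ cover, OF open_ball])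
  have "?L (\<Union>s\<in>F. ball s (d s))" using F(2,1)
  proof (induction F)
    case empty
    show ?case by (rule lighter_tailI[of _ "1 / (2 * sd0\<^sup>2) + 1" _ 0]) (auto simp: crossing_def)
  next
    case (insert s F)
    then have "?L (ball s (d s))" "?L (\<Union>s\<in>F. ball s (d s))" using d(2) by auto
    then show ?case
      by (rule lighter_tail_add) (rule prob_crossing_subset_Un, simp)
  qed
  then have "?L (\<Union>s\<in>F. ball s (d s)) " .
  then have "?L ((\<Union>s\<in>F. ball s (d s)) \<union> {2 ^ n..})"
    using n by (rule lighter_tail_add) (rule prob_crossing_subset_Un, simp)
  then show ?thesis
  proof (rule lighter_tail_mono)
    fix x
    have "crossing (- ball s0 \<delta>) x \<subseteq> crossing ((\<Union>s\<in>F. ball s (d s)) \<union> {2 ^ n..}) x"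
    proof
      fix \<omega> assume "\<omega> \<in> crossing (- ball s0 \<delta>) x"
      then obtain r where r: "\<omega> \<in> space P" "r \<in> D" "r \<notin> ball s0 \<delta>" "X r \<omega> > x * barrier c \<beta> r"
        by (auto simp: crossing_def)
      have "r \<in> (\<Union>s\<in>F. ball s (d s)) \<union> {2 ^ n..}"
      proof (cases "r \<ge> 2 ^ n")
        case False
        then have "r \<in> ?S" using r D by auto
        then show ?thesis using F(3) by blast
      qed simp
      then show "\<omega> \<in> crossing ((\<Union>s\<in>F. ball s (d s)) \<union> {2 ^ n..}) x"
        using r by (auto simp only: crossing_def)
    qed
    then show "prob (crossing (- ball s0 \<delta>) x) \<le> prob (crossing ((\<Union>s\<in>F. ball s (d s)) \<union> {2 ^ n..}) x)"
      by (intro finite_measure_mono) auto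
  qed
qed

text \<open>
  The constants \<open>1/4\<close> and \<open>2\<close> are chosen so that outside this event a crossing at level \<open>x\<close> takes
  place within \<open>\<delta>\<close> of \<open>s0\<close> and forces \<open>X s0 / barrier c \<beta> s0\<close> into \<open>{3/4 * x..2 * x}\<close>.
\<close>

definition atypical :: "real \<Rightarrow> real \<Rightarrow> 'a set" where
  "atypical \<delta> x = crossing (- ball s0 \<delta>) x \<union>
    {\<omega>\<in>space P. \<exists>r\<in>D. r \<in> ball s0 \<delta> \<and> \<bar>X r \<omega> / barrier c \<beta> r - X s0 \<omega> / barrier c \<beta> s0\<bar> > x / 4} \<union>
    {\<omega>\<in>space P. X s0 \<omega> > 2 * barrier c \<beta> s0 * x}"

lemma X_meas_s0 [measurable]: "X s0 \<in> borel_measurable P"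
  using s0_D by (rule X_meas_D)

lemma atypical_events [measurable]: "atypical \<delta> x \<in> events"
  unfolding atypical_def using D X_meas_D by measurable

lemma lighter_tail_atypical:
  assumes \<eta>: "\<eta> > 0"
  shows "\<exists>\<delta>>0. \<delta> \<le> \<eta> \<and> lighter_tail (1 / (2 * sd0\<^sup>2)) (\<lambda>x. prob (atypical \<delta> x))"
proof -
  define K where "K = 16 / sd0\<^sup>2"
  have K: "K > 0" using sd0_pos by (simp add: K_def)
  define g where "g = (\<lambda>s. 1 / barrier c \<beta> s)"
  have g: "continuous_on {0..} g"
    unfolding g_def using continuous_on_barrier[OF \<beta>_pos] barrier_pos
    by (intro continuous_intros) (auto simp: less_imp_neq[OF barrier_pos, symmetric])
  obtain d where d: "d > 0" "\<And>x. x \<ge> 0 \<Longrightarrow>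
      prob {\<omega>\<in>space P. \<exists>r\<in>D. \<bar>r - s0\<bar> < d \<and> \<bar>g r * X r \<omega> - g s0 * X s0 \<omega>\<bar> > x} \<le> 3 * exp (- K * x\<^sup>2)"
    using local_oscillation[OF _ g K, of s0] s0_pos by auto
  define \<delta> where "\<delta> = min d \<eta>"
  have \<delta>: "\<delta> > 0" "\<delta> \<le> \<eta>" "\<delta> \<le> d" using d \<eta> by (auto simp: \<delta>_def)
  let ?B = "\<lambda>x. {\<omega>\<in>space P. \<exists>r\<in>D. r \<in> ball s0 \<delta> \<and> \<bar>X r \<omega> / barrier c \<beta> r - X s0 \<omega> / barrier c \<beta> s0\<bar> > x / 4}"
  let ?C = "\<lambda>x. {\<omega>\<in>space P. X s0 \<omega> > 2 * barrier c \<beta> s0 * x}"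
  have ev: "?B x \<in> events" "?C x \<in> events" for x using D X_meas_D by measurable
  have a: "1 / sd0\<^sup>2 > 1 / (2 * sd0\<^sup>2)" "2 / sd0\<^sup>2 > 1 / (2 * sd0\<^sup>2)" using sd0_pos by (auto simp: field_simps)
  have B: "lighter_tail (1 / (2 * sd0\<^sup>2)) (\<lambda>x. prob (?B x))"
  proof (rule lighter_tailI[OF a(1)])
    fix x :: real assume x: "x \<ge> 0"
    have "prob (?B x) \<le> prob {\<omega>\<in>space P. \<exists>r\<in>D. \<bar>r - s0\<bar> < d \<and> \<bar>g r * X r \<omega> - g s0 * X s0 \<omega>\<bar> > x / 4}"
    proof (rule finite_measure_mono)
      show "{\<omega>\<in>space P. \<exists>r\<in>D. \<bar>r - s0\<bar> < d \<and> \<bar>g r * X r \<omega> - g s0 * X s0 \<omega>\<bar> > x / 4} \<in> events"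
        using D X_meas_D by measurable
      show "?B x \<subseteq> {\<omega>\<in>space P. \<exists>r\<in>D. \<bar>r - s0\<bar> < d \<and> \<bar>g r * X r \<omega> - g s0 * X s0 \<omega>\<bar> > x / 4}"
        using \<delta> by (force simp: g_def dist_real_def abs_minus_commute)
    qed
    also have "\<dots> \<le> 3 * exp (- K * (x / 4)\<^sup>2)" using x by (intro d) simp
    also have "- K * (x / 4)\<^sup>2 = - (1 / sd0\<^sup>2) * x\<^sup>2" by (simp add: K_def power_divide)
    finally show "prob (?B x) \<le> 3 * exp (- (1 / sd0\<^sup>2) * x\<^sup>2)" .
  qed
  have C: "lighter_tail (1 / (2 * sd0\<^sup>2)) (\<lambda>x. prob (?C x))"
  proof (rule lighter_tailI[OF a(2)])
    fix x :: real assume x: "x \<ge> 0"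
    have v: "expectation (\<lambda>\<omega>. (X s0 \<omega>)\<^sup>2) = (s0 powr H)\<^sup>2"
      using s0_pos by (simp add: X_var_sq)
    have "prob (?C x) \<le> exp (- (2 * barrier c \<beta> s0 * x)\<^sup>2 / (2 * (s0 powr H)\<^sup>2))"
      using s0_pos x v barrier_pos[of s0] by (intro normal_tail_upper X_in) auto
    also have "- (2 * barrier c \<beta> s0 * x)\<^sup>2 / (2 * (s0 powr H)\<^sup>2) = - (2 / sd0\<^sup>2) * x\<^sup>2"
      using s0_pos barrier_pos[of s0] by (simp add: sd0_def power_divide power_mult_distrib)
    finally show "prob (?C x) \<le> 1 * exp (- (2 / sd0\<^sup>2) * x\<^sup>2)" by simp
  qed
  have "lighter_tail (1 / (2 * sd0\<^sup>2)) (\<lambda>x. prob (?B x) + prob (?C x))"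
    using B C by (rule lighter_tail_add) simp
  with lighter_tail_away[OF \<delta>(1)] have "lighter_tail (1 / (2 * sd0\<^sup>2)) (\<lambda>x. prob (atypical \<delta> x))"
  proof (rule lighter_tail_add)
    fix x
    have "prob (atypical \<delta> x) \<le> prob (crossing (- ball s0 \<delta>) x \<union> ?B x) + prob (?C x)"
      unfolding atypical_def using ev by (intro measure_Un_le) auto
    also have "prob (crossing (- ball s0 \<delta>) x \<union> ?B x) \<le> prob (crossing (- ball s0 \<delta>) x) + prob (?B x)"
      using ev by (intro measure_Un_le) auto
    finally show "prob (atypical \<delta> x) \<le> prob (crossing (- ball s0 \<delta>) x) + (prob (?B x) + prob (?C x))" by simp
  qed
  then show ?thesis using \<delta> by blast
qed

text \<open>
  The rate of the atypical event is strictly larger than that of the crossing at \<open>s0\<close>, which leaves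
  room for lowering the level of the former and raising that of the latter by a factor \<open>1 \<mp> \<epsilon>\<close>; this
  margin will absorb the perturbation of the barrier.
\<close>

lemma atypical_negligible:
  assumes \<eta>: "\<eta> > 0"
  shows "\<exists>\<delta>>0. \<delta> \<le> \<eta> \<and> (\<exists>\<epsilon>>0. \<epsilon> \<le> 1/4 \<and> (\<forall>\<kappa>>0. eventually (\<lambda>x.
     prob (atypical \<delta> ((1 - \<epsilon>) * x)) \<le> \<kappa> * prob {\<omega>\<in>space P. X s0 \<omega> > (1 + \<epsilon>) * x * barrier c \<beta> s0}) at_top))"
proof -
  obtain \<delta> a C where \<delta>: "\<delta> > 0" "\<delta> \<le> \<eta>" and a: "a > 1 / (2 * sd0\<^sup>2)"
    and C: "\<And>x. x \<ge> 0 \<Longrightarrow> prob (atypical \<delta> x) \<le> C * exp (- a * x\<^sup>2)"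
    using lighter_tail_atypical[OF \<eta>] unfolding lighter_tail_def by blast
  have "((\<lambda>\<epsilon>::real. a * (1 - \<epsilon>)\<^sup>2 - (1 + \<epsilon>)\<^sup>2 / (2 * sd0\<^sup>2)) \<longlongrightarrow> a * (1 - 0)\<^sup>2 - (1 + 0)\<^sup>2 / (2 * sd0\<^sup>2)) (at_right 0)"
    using sd0_pos by (intro tendsto_intros) auto
  then have "eventually (\<lambda>\<epsilon>. a * (1 - \<epsilon>)\<^sup>2 - (1 + \<epsilon>)\<^sup>2 / (2 * sd0\<^sup>2) > 0) (at_right 0)"
    using a by (intro order_tendstoD) auto
  moreover have "eventually (\<lambda>\<epsilon>::real. \<epsilon> \<in> {0<..<1/4}) (at_right 0)"
    by (rule eventually_at_right_real) simp
  ultimately obtain \<epsilon> where \<epsilon>: "a * (1 - \<epsilon>)\<^sup>2 - (1 + \<epsilon>)\<^sup>2 / (2 * sd0\<^sup>2) > 0" "\<epsilon> > 0" "\<epsilon> \<le> 1/4"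
    using eventually_happens[OF eventually_conj] trivial_limit_at_right_real
    by (metis (no_types, lifting) greaterThanLessThan_iff less_imp_le)
  define d where "d = a * (1 - \<epsilon>)\<^sup>2 - (1 + \<epsilon>)\<^sup>2 / (2 * sd0\<^sup>2)"
  define B where "B = (1 + \<epsilon>) / sd0"
  have d: "d > 0" using \<epsilon> by (simp add: d_def)
  have lim: "((\<lambda>x. (C * sqrt (2 * pi)) * exp (- d * x\<^sup>2 + B * x + 1/2)) \<longlongrightarrow> 0) at_top"
  proof -
    have "filterlim (\<lambda>x. d * x) at_top at_top"
      using d by (intro filterlim_tendsto_pos_mult_at_top[OF tendsto_const _ filterlim_ident])
    then have "filterlim (\<lambda>x. - B + d * x) at_top at_top"
      by (intro filterlim_tendsto_add_at_top[OF tendsto_const])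
    then have "filterlim (\<lambda>x. x * (- B + d * x)) at_top at_top"
      by (intro filterlim_at_top_mult_at_top filterlim_ident)
    then have "filterlim (\<lambda>x. - 1/2 + x * (- B + d * x)) at_top at_top"
      by (intro filterlim_tendsto_add_at_top[OF tendsto_const])
    then have "filterlim (\<lambda>x. - (- 1/2 + x * (- B + d * x))) at_bot at_top"
      by (simp add: filterlim_uminus_at_bot)
    also have "(\<lambda>x. - (- 1/2 + x * (- B + d * x))) = (\<lambda>x. - d * x\<^sup>2 + B * x + 1/2)"
      by (simp add: fun_eq_iff power2_eq_square algebra_simps)
    finally show ?thesis
      by (intro tendsto_mult_right_zero filterlim_compose[OF exp_at_bot])
  qed
  have v: "expectation (\<lambda>\<omega>. (X s0 \<omega>)\<^sup>2) = (s0 powr H)\<^sup>2"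
    using s0_pos by (simp add: X_var_sq)
  have low: "prob {\<omega>\<in>space P. X s0 \<omega> > (1 + \<epsilon>) * x * barrier c \<beta> s0} \<ge> exp (- (B * x + 1)\<^sup>2 / 2) / sqrt (2 * pi)"
    if x: "x \<ge> 0" for x
  proof -
    have B: "B \<ge> 0" using \<epsilon> sd0_pos by (simp add: B_def)
    have *: "sqrt ((s0 powr H)\<^sup>2) * (B * x) = (1 + \<epsilon>) * x * barrier c \<beta> s0"
      using s0_pos barrier_pos[of s0] by (simp add: B_def sd0_def)
    show ?thesis
      unfolding *[symmetric] using s0_pos B x by (intro normal_tail_lower X_in v[symmetric]) auto
  qed
  have ineq: "eventually (\<lambda>x. prob (atypical \<delta> ((1 - \<epsilon>) * x)) \<le> \<kappa> * prob {\<omega>\<in>space P. X s0 \<omega> > (1 + \<epsilon>) * x * barrier c \<beta> s0}) at_top"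
    if \<kappa>: "\<kappa> > 0" for \<kappa>
  proof -
    have "eventually (\<lambda>x. (C * sqrt (2 * pi)) * exp (- d * x\<^sup>2 + B * x + 1/2) < \<kappa>) at_top"
      using order_tendstoD(2)[OF lim \<kappa>] .
    moreover have "eventually (\<lambda>x::real. x \<ge> 0) at_top" by (rule eventually_ge_at_top)
    ultimately show ?thesis
    proof eventually_elim
      case (elim x)
      let ?E = "exp (- (B * x + 1)\<^sup>2 / 2)"
      have "prob (atypical \<delta> ((1 - \<epsilon>) * x)) \<le> C * exp (- a * ((1 - \<epsilon>) * x)\<^sup>2)"
        using elim \<epsilon> by (intro C) simp
      also have "exp (- a * ((1 - \<epsilon>) * x)\<^sup>2) = exp (- d * x\<^sup>2 + B * x + 1/2) * ?E"
        using sd0_pos by (simp add: mult_exp_exp d_def B_def power2_eq_square field_simps)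
      also have "C * (exp (- d * x\<^sup>2 + B * x + 1/2) * ?E) = ((C * sqrt (2 * pi)) * exp (- d * x\<^sup>2 + B * x + 1/2)) * (?E / sqrt (2 * pi))"
        by simp
      also have "\<dots> \<le> \<kappa> * (?E / sqrt (2 * pi))"
        using elim by (intro mult_right_mono) auto
      also have "\<dots> \<le> \<kappa> * prob {\<omega>\<in>space P. X s0 \<omega> > (1 + \<epsilon>) * x * barrier c \<beta> s0}"
        using low[of x] elim \<kappa> by (intro mult_left_mono) auto
      finally show ?case .
    qed
  qed
  show ?thesis using \<delta> \<epsilon> ineq by blast
qed

end

section \<open>Sensitivity of the crossing probability\<close>

context drifted_process
begin

text \<open>
  In the application \<open>g\<close> is a scaled path of the common input, and this is the conditional tail of
  one term of the sequence.
\<close>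

definition hit_prob :: "real \<Rightarrow> (real \<Rightarrow> real) \<Rightarrow> real" where
  "hit_prob x g = prob {\<omega>\<in>space P. \<exists>s\<in>D. X s \<omega> > x * barrier c \<beta> s - g s}"

lemma hit_events [measurable]: "{\<omega>\<in>space P. \<exists>s\<in>D. X s \<omega> > x * barrier c \<beta> s - g s} \<in> events"
  using D X_meas_D by measurable

lemma hit_prob_le_1: "hit_prob x g \<le> 1" and hit_prob_nonneg: "hit_prob x g \<ge> 0"
  by (simp_all add: hit_prob_def)

lemma hit_prob_mono:
  assumes "\<And>s. s \<in> D \<Longrightarrow> x * barrier c \<beta> s - g s \<ge> x' * barrier c \<beta> s - g' s"
  shows "hit_prob x g \<le> hit_prob x' g'"
  unfolding hit_prob_def using assms
  by (intro finite_measure_mono) (auto intro: le_less_trans)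

lemma hit_prob_bounds:
  assumes "\<And>s. s \<in> D \<Longrightarrow> \<bar>g s\<bar> \<le> \<rho> * barrier c \<beta> s"
  shows "hit_prob (x + \<rho>) (\<lambda>_. 0) \<le> hit_prob x g" "hit_prob x g \<le> hit_prob (x - \<rho>) (\<lambda>_. 0)"
  by (intro hit_prob_mono; use assms in \<open>force simp: algebra_simps abs_le_iff\<close>)+

lemma hit_prob_antimono: "x \<le> x' \<Longrightarrow> hit_prob x' (\<lambda>_. 0) \<le> hit_prob x (\<lambda>_. 0)"
  using barrier_pos by (intro hit_prob_mono) (simp add: mult_right_mono less_imp_le)

lemma hit_prob_tendsto_0:
  assumes "e > 0"
  shows "eventually (\<lambda>x. hit_prob x (\<lambda>_. 0) \<le> e) at_top"
proof -
  have "eventually (\<lambda>n. prob {\<omega>\<in>space P. \<exists>r\<in>D. \<bar>X r \<omega>\<bar> > real n * barrier c \<beta> r} < e) sequentially"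
    using prob_not_bounded_by_barrier assms by (rule order_tendstoD)
  then obtain n where n: "prob {\<omega>\<in>space P. \<exists>r\<in>D. \<bar>X r \<omega>\<bar> > real n * barrier c \<beta> r} < e"
    by (auto simp: eventually_sequentially)
  have "hit_prob (real n) (\<lambda>_. 0) \<le> prob {\<omega>\<in>space P. \<exists>r\<in>D. \<bar>X r \<omega>\<bar> > real n * barrier c \<beta> r}"
    unfolding hit_prob_def
  proof (rule finite_measure_mono)
    show "{\<omega>\<in>space P. \<exists>r\<in>D. \<bar>X r \<omega>\<bar> > real n * barrier c \<beta> r} \<in> events"
      using D X_meas_D by measurable
  qed force
  then have "hit_prob x (\<lambda>_. 0) \<le> e" if "x \<ge> real n" for x
    using hit_prob_antimono[OF that] n by linarith
  then show ?thesis by (auto simp: eventually_at_top_linorder)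
qed

lemma hit_prob_pos:
  assumes s: "s \<in> D" "s > 0"
  shows "hit_prob x g > 0"
proof -
  have V: "X s \<in> linear_functionals X" using s by (intro X_in) simp
  have v: "expectation (\<lambda>\<omega>. (X s \<omega>)\<^sup>2) > 0" using X_var[of s] s by simp
  define z where "z = x * barrier c \<beta> s - g s"
  define t where "t = max 0 z / sqrt (expectation (\<lambda>\<omega>. (X s \<omega>)\<^sup>2))"
  have t: "t \<ge> 0" "sqrt (expectation (\<lambda>\<omega>. (X s \<omega>)\<^sup>2)) * t \<ge> z" using v by (auto simp: t_def)
  have "0 < exp (- (t + 1)\<^sup>2 / 2) / sqrt (2 * pi)" by simp
  also have "\<dots> \<le> prob {\<omega>\<in>space P. X s \<omega> > sqrt (expectation (\<lambda>\<omega>. (X s \<omega>)\<^sup>2)) * t}"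
    using V v t by (intro normal_tail_lower) auto
  also have "\<dots> \<le> hit_prob x g"
    unfolding hit_prob_def using t s by (intro finite_measure_mono hit_events) (auto simp: z_def intro!: bexI[of _ s])
  finally show ?thesis .
qed

lemma emeasure_shifted_path:
  assumes s: "s > 0" and A: "A \<in> sets path_space"
  shows "emeasure P {\<omega>\<in>space P. (\<lambda>t\<in>{0..}. X t \<omega> + \<theta> * expectation (\<lambda>\<omega>. X t \<omega> * X s \<omega>)) \<in> A} =
    (\<integral>\<^sup>+\<omega>. ennreal (exp (\<theta> * X s \<omega> - \<theta>\<^sup>2 * s powr (2 * H) / 2)) * indicator A (\<lambda>t\<in>{0..}. X t \<omega>) \<partial>P)"
  using s A by (intro cameron_martin) (auto simp: X_in X_var)

lemma path_events [measurable]: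
  assumes "A \<in> sets path_space"
  shows "{\<omega>\<in>space P. (\<lambda>t\<in>{0..}. X t \<omega>) \<in> A} \<in> events"
  using measurable_sets[OF sample_path_meas assms] by (simp add: sample_path_def vimage_def Int_def conj_commute)

lemma shifted_path_events [measurable]:
  assumes "A \<in> sets path_space"
  shows "{\<omega>\<in>space P. (\<lambda>t\<in>{0..}. X t \<omega> + r t) \<in> A} \<in> events"
proof -
  have "(\<lambda>\<omega>. \<lambda>t\<in>{0..}. X t \<omega> + r t) \<in> measurable P path_space"
    using X_meas by (intro measurable_restrict) auto
  from measurable_sets[OF this assms] show ?thesis by (simp add: vimage_def Int_def conj_commute)
qed

lemma prob_shifted_path_ge:
  assumes s: "s > 0" and A: "A \<in> sets path_space" and k: "\<And>y. y \<in> A \<Longrightarrow> k \<le> \<theta> * y s"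
  shows "exp (k - \<theta>\<^sup>2 * s powr (2 * H) / 2) * prob {\<omega>\<in>space P. (\<lambda>t\<in>{0..}. X t \<omega>) \<in> A} \<le>
    prob {\<omega>\<in>space P. (\<lambda>t\<in>{0..}. X t \<omega> + \<theta> * expectation (\<lambda>\<omega>. X t \<omega> * X s \<omega>)) \<in> A}"
proof -
  have [measurable]: "X s \<in> borel_measurable P" using s by (intro X_meas) simp
  have "ennreal (exp (k - \<theta>\<^sup>2 * s powr (2 * H) / 2)) * emeasure P {\<omega>\<in>space P. (\<lambda>t\<in>{0..}. X t \<omega>) \<in> A} =
     (\<integral>\<^sup>+\<omega>. ennreal (exp (k - \<theta>\<^sup>2 * s powr (2 * H) / 2)) * indicator {\<omega>\<in>space P. (\<lambda>t\<in>{0..}. X t \<omega>) \<in> A} \<omega> \<partial>P)"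
    using path_events[OF A] by (simp add: nn_integral_cmult_indicator)
  also have "\<dots> \<le> (\<integral>\<^sup>+\<omega>. ennreal (exp (\<theta> * X s \<omega> - \<theta>\<^sup>2 * s powr (2 * H) / 2)) * indicator A (\<lambda>t\<in>{0..}. X t \<omega>) \<partial>P)"
    using k[of "\<lambda>t\<in>{0..}. X t _"] s by (intro nn_integral_mono) (auto simp: indicator_def intro!: ennreal_leI)
  also have "\<dots> = emeasure P {\<omega>\<in>space P. (\<lambda>t\<in>{0..}. X t \<omega> + \<theta> * expectation (\<lambda>\<omega>. X t \<omega> * X s \<omega>)) \<in> A}"
    by (rule emeasure_shifted_path[OF s A, symmetric])
  finally show ?thesis by (simp add: emeasure_eq_measure flip: ennreal_mult')
qed

text \<open>
  Absolute continuity of the translated law, uniformly in the event: where \<open>X s\<close> is not large the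
  Cameron--Martin density is bounded.
\<close>

lemma prob_shifted_path_small:
  assumes s: "s > 0" and e: "e > 0"
  shows "\<exists>d>0. \<forall>A\<in>sets path_space. prob {\<omega>\<in>space P. (\<lambda>t\<in>{0..}. X t \<omega>) \<in> A} \<le> d \<longrightarrow>
    prob {\<omega>\<in>space P. (\<lambda>t\<in>{0..}. X t \<omega> + \<theta> * expectation (\<lambda>\<omega>. X t \<omega> * X s \<omega>)) \<in> A} \<le> e"
proof -
  have [measurable]: "X s \<in> borel_measurable P" using s by (intro X_meas) simp
  define r where "r = (\<lambda>t. \<theta> * expectation (\<lambda>\<omega>. X t \<omega> * X s \<omega>))"
  let ?B = "\<lambda>n::nat. {\<omega>\<in>space P. \<theta> * (X s \<omega> + r s) > real n}"
  have B: "?B n \<in> events" for n by measurable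
  have "(\<lambda>n. prob (?B n)) \<longlonglongrightarrow> 0"
  proof (rule prob_tendsto_0_of_eventually_notin[OF B])
    show "?B n \<subseteq> ?B m" if "m \<le> n" for m n
      using that by (auto intro: le_less_trans[of "real m" "real n"])
    show "AE \<omega> in P. \<exists>n. \<omega> \<notin> ?B n"
      using real_arch_simple by (intro AE_I2) (auto simp: not_less)
  qed
  then have "eventually (\<lambda>n. prob (?B n) < e / 2) sequentially"
    using e by (intro order_tendstoD) auto
  then obtain n where n: "prob (?B n) < e / 2" by (auto simp: eventually_sequentially)
  define d where "d = e / 2 / exp (real n)"
  have "prob {\<omega>\<in>space P. (\<lambda>t\<in>{0..}. X t \<omega> + r t) \<in> A} \<le> e"
    if A: "A \<in> sets path_space" and small: "prob {\<omega>\<in>space P. (\<lambda>t\<in>{0..}. X t \<omega>) \<in> A} \<le> d" for A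
  proof -
    define A' where "A' = {y\<in>space path_space. y \<in> A \<and> \<theta> * y s \<le> real n}"
    have [measurable]: "(\<lambda>y. y s) \<in> borel_measurable path_space"
      using s by (intro measurable_component_singleton) simp
    have A': "A' \<in> sets path_space" unfolding A'_def using A by measurable
    have "emeasure P {\<omega>\<in>space P. (\<lambda>t\<in>{0..}. X t \<omega> + r t) \<in> A'} =
        (\<integral>\<^sup>+\<omega>. ennreal (exp (\<theta> * X s \<omega> - \<theta>\<^sup>2 * s powr (2 * H) / 2)) * indicator A' (\<lambda>t\<in>{0..}. X t \<omega>) \<partial>P)"
      unfolding r_def by (rule emeasure_shifted_path[OF s A'])
    also have "\<dots> \<le> (\<integral>\<^sup>+\<omega>. ennreal (exp (real n)) * indicator {\<omega>\<in>space P. (\<lambda>t\<in>{0..}. X t \<omega>) \<in> A} \<omega> \<partial>P)"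
    proof (intro nn_integral_mono)
      fix \<omega> assume \<omega>: "\<omega> \<in> space P"
      have "\<theta> * X s \<omega> - \<theta>\<^sup>2 * s powr (2 * H) / 2 \<le> real n" if "\<theta> * X s \<omega> \<le> real n"
        using that zero_le_power2[of \<theta>] by (smt (verit) divide_nonneg_nonneg mult_nonneg_nonneg powr_ge_zero)
      then show "ennreal (exp (\<theta> * X s \<omega> - \<theta>\<^sup>2 * s powr (2 * H) / 2)) * indicator A' (\<lambda>t\<in>{0..}. X t \<omega>)
          \<le> ennreal (exp (real n)) * indicator {\<omega>\<in>space P. (\<lambda>t\<in>{0..}. X t \<omega>) \<in> A} \<omega>"
        using \<omega> s by (auto simp: A'_def indicator_def intro!: ennreal_leI)
    qed
    also have "\<dots> = ennreal (exp (real n)) * emeasure P {\<omega>\<in>space P. (\<lambda>t\<in>{0..}. X t \<omega>) \<in> A}"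
      using path_events[OF A] by (simp add: nn_integral_cmult_indicator)
    finally have "prob {\<omega>\<in>space P. (\<lambda>t\<in>{0..}. X t \<omega> + r t) \<in> A'} \<le> exp (real n) * prob {\<omega>\<in>space P. (\<lambda>t\<in>{0..}. X t \<omega>) \<in> A}"
      by (simp add: emeasure_eq_measure flip: ennreal_mult')
    also have "\<dots> \<le> exp (real n) * d" using small by simp
    also have "\<dots> = e / 2" by (simp add: d_def)
    finally have 1: "prob {\<omega>\<in>space P. (\<lambda>t\<in>{0..}. X t \<omega> + r t) \<in> A'} \<le> e / 2" .
    have "{\<omega>\<in>space P. (\<lambda>t\<in>{0..}. X t \<omega> + r t) \<in> A} \<subseteq> {\<omega>\<in>space P. (\<lambda>t\<in>{0..}. X t \<omega> + r t) \<in> A'} \<union> ?B n"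
      using s by (auto simp: A'_def space_PiM)
    then have "prob {\<omega>\<in>space P. (\<lambda>t\<in>{0..}. X t \<omega> + r t) \<in> A} \<le> prob ({\<omega>\<in>space P. (\<lambda>t\<in>{0..}. X t \<omega> + r t) \<in> A'} \<union> ?B n)"
      using shifted_path_events[OF A'] B by (intro finite_measure_mono) auto
    also have "\<dots> \<le> prob {\<omega>\<in>space P. (\<lambda>t\<in>{0..}. X t \<omega> + r t) \<in> A'} + prob (?B n)"
      using shifted_path_events[OF A'] B by (intro measure_Un_le) auto
    finally show ?thesis using 1 n by linarith
  qed
  moreover have "d > 0" using e by (simp add: d_def)
  ultimately show ?thesis unfolding r_def by blast
qed

end

context barrier_crossing
begin

text \<open>
  The range for \<open>y s0\<close> is wider than in \<open>atypical\<close>, which is used at the lower level \<open>(1 - \<epsilon>) * x\<close>.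
\<close>

definition local_hit :: "real \<Rightarrow> real \<Rightarrow> (real \<Rightarrow> real) \<Rightarrow> (real \<Rightarrow> real) set" where
  "local_hit \<delta> x g = {y\<in>space path_space. (\<exists>s\<in>D. s \<in> ball s0 \<delta> \<and> y s > x * barrier c \<beta> s - g s) \<and>
     x * barrier c \<beta> s0 / 2 \<le> y s0 \<and> y s0 \<le> 2 * barrier c \<beta> s0 * x}"

lemma local_hit_sets [measurable]: "local_hit \<delta> x g \<in> sets path_space"
proof -
  have [measurable]: "(\<lambda>y. y s) \<in> borel_measurable path_space" if "s \<in> D" for s
    using that D by (intro measurable_component_singleton) auto
  show ?thesis unfolding local_hit_def using D s0_D by measurable
qed

text \<open>
  A crossing happens near \<open>s0\<close> and with a value of \<open>X s0\<close> of the order \<open>x\<close>: by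
  \<open>atypical_negligible\<close> the exceptions are negligible with respect to the event that the barrier is crossed at
  \<open>s0\<close> itself.
\<close>

lemma localisation:
  assumes \<eta>: "\<eta> > 0"
  shows "\<exists>\<delta>>0. \<delta> \<le> \<eta> \<and> (\<exists>\<epsilon>>0. \<forall>\<kappa>>0. eventually (\<lambda>x. \<forall>g. (\<forall>s\<in>D. \<bar>g s\<bar> \<le> \<epsilon> * x * barrier c \<beta> s) \<longrightarrow>
    (1 - \<kappa>) * hit_prob x g \<le> prob {\<omega>\<in>space P. (\<lambda>t\<in>{0..}. X t \<omega>) \<in> local_hit \<delta> x g}) at_top)"
proof -
  obtain \<delta> \<epsilon> where \<delta>: "\<delta> > 0" "\<delta> \<le> \<eta>" and \<epsilon>: "\<epsilon> > 0" "\<epsilon> \<le> 1/4" and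
    neg: "\<And>\<kappa>. \<kappa> > 0 \<Longrightarrow> eventually (\<lambda>x. prob (atypical \<delta> ((1 - \<epsilon>) * x)) \<le>
         \<kappa> * prob {\<omega>\<in>space P. X s0 \<omega> > (1 + \<epsilon>) * x * barrier c \<beta> s0}) at_top"
    using atypical_negligible[OF \<eta>] by blast
  have "eventually (\<lambda>x. \<forall>g. (\<forall>s\<in>D. \<bar>g s\<bar> \<le> \<epsilon> * x * barrier c \<beta> s) \<longrightarrow>
    (1 - \<kappa>) * hit_prob x g \<le> prob {\<omega>\<in>space P. (\<lambda>t\<in>{0..}. X t \<omega>) \<in> local_hit \<delta> x g}) at_top" if \<kappa>: "\<kappa> > 0" for \<kappa>
    using neg[OF \<kappa>] eventually_ge_at_top[of "0::real"]
  proof eventually_elim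
    case (elim x)
    show ?case
    proof (intro allI impI)
      fix g assume g: "\<forall>s\<in>D. \<bar>g s\<bar> \<le> \<epsilon> * x * barrier c \<beta> s"
      let ?E = "{\<omega>\<in>space P. \<exists>s\<in>D. X s \<omega> > x * barrier c \<beta> s - g s}"
      let ?L = "{\<omega>\<in>space P. (\<lambda>t\<in>{0..}. X t \<omega>) \<in> local_hit \<delta> x g}"
      let ?N = "atypical \<delta> ((1 - \<epsilon>) * x)"
      have "?E \<subseteq> ?L \<union> ?N"
      proof
        fix \<omega> assume "\<omega> \<in> ?E"
        then obtain s where s: "\<omega> \<in> space P" "s \<in> D" "X s \<omega> > x * barrier c \<beta> s - g s" by blast
        have s': "X s \<omega> > ((1 - \<epsilon>) * x) * barrier c \<beta> s"
          using s(3) g[rule_format, OF s(2)] by (simp add: algebra_simps)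
        show "\<omega> \<in> ?L \<union> ?N"
        proof (cases "\<omega> \<in> ?N")
          case False
          have ball: "s \<in> ball s0 \<delta>"
            using False s s' by (auto simp: atypical_def crossing_def)
          have osc: "\<bar>X s \<omega> / barrier c \<beta> s - X s0 \<omega> / barrier c \<beta> s0\<bar> \<le> (1 - \<epsilon>) * x / 4"
            using False s ball by (auto simp: atypical_def not_less)
          have up: "X s0 \<omega> \<le> 2 * barrier c \<beta> s0 * ((1 - \<epsilon>) * x)"
            using False s by (auto simp: atypical_def not_less)
          have "X s \<omega> / barrier c \<beta> s > (1 - \<epsilon>) * x" using s' barrier_pos[of s] by (simp add: field_simps)
          with osc have "X s0 \<omega> / barrier c \<beta> s0 \<ge> 3/4 * ((1 - \<epsilon>) * x)" by linarith
          also have "3/4 * ((1 - \<epsilon>) * x) \<ge> 3/4 * (3/4 * x)" using \<epsilon> elim by (intro mult_left_mono mult_right_mono) auto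
          finally have "X s0 \<omega> / barrier c \<beta> s0 \<ge> x / 2" using elim by linarith
          then have low: "x * barrier c \<beta> s0 / 2 \<le> X s0 \<omega>" using barrier_pos[of s0] by (simp add: field_simps)
          have "(1 - \<epsilon>) * x \<le> 1 * x" using \<epsilon> elim by (intro mult_right_mono) auto
          then have "2 * barrier c \<beta> s0 * ((1 - \<epsilon>) * x) \<le> 2 * barrier c \<beta> s0 * x"
            using barrier_pos[of s0] by (intro mult_left_mono) auto
          with up have "X s0 \<omega> \<le> 2 * barrier c \<beta> s0 * x" by linarith
          then have "\<omega> \<in> ?L" using low s ball s0_pos D
            by (auto simp: local_hit_def space_PiM intro!: bexI[of _ s])
          then show ?thesis by blast
        qed simp
      qed
      then have "hit_prob x g \<le> prob (?L \<union> ?N)"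
        unfolding hit_prob_def by (intro finite_measure_mono) auto
      also have "\<dots> \<le> prob ?L + prob ?N" by (intro measure_Un_le) auto
      also have "prob ?N \<le> \<kappa> * prob {\<omega>\<in>space P. X s0 \<omega> > (1 + \<epsilon>) * x * barrier c \<beta> s0}" by fact
      also have "\<dots> \<le> \<kappa> * hit_prob x g"
        unfolding hit_prob_def
      proof (intro mult_left_mono finite_measure_mono)
        show "{\<omega>\<in>space P. X s0 \<omega> > (1 + \<epsilon>) * x * barrier c \<beta> s0} \<subseteq> ?E"
          using g[rule_format, OF s0_D] s0_D by (auto simp: algebra_simps abs_le_iff intro!: bexI[of _ s0])
      qed (use \<kappa> in auto)
      finally show "(1 - \<kappa>) * hit_prob x g \<le> prob ?L" unfolding left_diff_distrib mult_1_left by linarith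
    qed
  qed
  then show ?thesis using \<delta> \<epsilon>(1) by blast
qed

text \<open>
  Raising the perturbation \<open>g\<close> by an amount of order \<open>y\<close> near \<open>s0\<close> has at least the effect of a
  Cameron--Martin shift of \<open>X\<close> by \<open>\<theta>\<close> of order \<open>y\<close>; as \<open>X s0\<close> is of order \<open>x\<close> when the barrier is
  crossed, this multiplies the probability by \<open>exp\<close> of a multiple of \<open>x * y\<close>.
\<close>

lemma hit_prob_doubling:
  assumes \<eta>: "\<eta> > 0" and w: "w > 0"
  shows "\<exists>q>0. \<exists>\<epsilon>>0. eventually (\<lambda>x. \<forall>y g h. 0 \<le> y \<and> w \<le> x * y \<and> y \<le> \<epsilon> * x \<and>
      (\<forall>s\<in>D. \<bar>g s\<bar> \<le> \<epsilon> * x * barrier c \<beta> s) \<and> (\<forall>s\<in>D. \<bar>s - s0\<bar> < \<eta> \<longrightarrow> y * q \<le> h s) \<longrightarrow>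
      2 * hit_prob x g \<le> hit_prob x (\<lambda>s. g s + h s)) at_top"
proof -
  define v where "v = s0 powr (2 * H)"
  have v: "v > 0" using s0_pos by (simp add: v_def)
  define m0 where "m0 = barrier c \<beta> s0"
  have m0: "m0 > 0" using barrier_pos by (simp add: m0_def)
  define r where "r = (\<lambda>s. expectation (\<lambda>\<omega>. X s \<omega> * X s0 \<omega>))"
  obtain \<delta>1 where \<delta>1: "\<delta>1 > 0" "\<And>s. s \<in> D \<Longrightarrow> \<bar>s - s0\<bar> < \<delta>1 \<Longrightarrow> r s \<in> {v / 2..2 * v}"
    using covariance_near[OF s0_pos] unfolding r_def v_def by blast
  have "min \<eta> \<delta>1 > 0" using \<eta> \<delta>1 by simp
  from localisation[OF this] obtain \<delta> \<epsilon> where \<delta>: "\<delta> > 0" "\<delta> \<le> min \<eta> \<delta>1" and \<epsilon>: "\<epsilon> > 0" and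
    loc: "\<And>\<kappa>. \<kappa> > 0 \<Longrightarrow> eventually (\<lambda>x. \<forall>g. (\<forall>s\<in>D. \<bar>g s\<bar> \<le> \<epsilon> * x * barrier c \<beta> s) \<longrightarrow>
    (1 - \<kappa>) * hit_prob x g \<le> prob {\<omega>\<in>space P. (\<lambda>t\<in>{0..}. X t \<omega>) \<in> local_hit \<delta> x g}) at_top"
    by blast
  \<comment> \<open>The shift is to gain a factor 4, half of which is lost in the localisation.\<close>
  define b where "b = 4 * ln 4 / (m0 * w)"
  have b: "b > 0" using m0 w by (simp add: b_def)
  define q where "q = 2 * v * b"
  have q: "q > 0" using v b by (simp add: q_def)
  define \<epsilon>' where "\<epsilon>' = min \<epsilon> (m0 / (2 * b * v))"
  have \<epsilon>': "\<epsilon>' > 0" using \<epsilon> m0 b v by (simp add: \<epsilon>'_def)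
  have main: "2 * hit_prob x g \<le> hit_prob x (\<lambda>s. g s + h s)"
    if L: "\<forall>g. (\<forall>s\<in>D. \<bar>g s\<bar> \<le> \<epsilon> * x * barrier c \<beta> s) \<longrightarrow>
       (1 - 1/2) * hit_prob x g \<le> prob {\<omega>\<in>space P. (\<lambda>t\<in>{0..}. X t \<omega>) \<in> local_hit \<delta> x g}"
      and x: "x \<ge> 0" and y: "0 \<le> y" "w \<le> x * y" "y \<le> \<epsilon>' * x"
      and g: "\<forall>s\<in>D. \<bar>g s\<bar> \<le> \<epsilon>' * x * barrier c \<beta> s"
      and h: "\<forall>s\<in>D. \<bar>s - s0\<bar> < \<eta> \<longrightarrow> y * q \<le> h s" for x y g h
  proof -
    define \<theta> where "\<theta> = b * y"
    have \<theta>: "\<theta> \<ge> 0" using b y by (simp add: \<theta>_def)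
    have "\<epsilon>' * x * barrier c \<beta> s \<le> \<epsilon> * x * barrier c \<beta> s" for s
      using x barrier_pos[of s] by (intro mult_right_mono) (auto simp: \<epsilon>'_def)
    then have "\<forall>s\<in>D. \<bar>g s\<bar> \<le> \<epsilon> * x * barrier c \<beta> s" using g by (meson order.trans)
    then have half: "(1 - 1/2) * hit_prob x g \<le> prob {\<omega>\<in>space P. (\<lambda>t\<in>{0..}. X t \<omega>) \<in> local_hit \<delta> x g}"
      using L by blast
    have "y \<le> (m0 / (2 * b * v)) * x"
    proof -
      have "\<epsilon>' * x \<le> (m0 / (2 * b * v)) * x" using x by (intro mult_right_mono) (auto simp: \<epsilon>'_def)
      then show ?thesis using y by linarith
    qed
    \<comment> \<open>The quadratic term costs at most half of the linear one because \<open>y\<close> is small compared with \<open>x\<close>.\<close>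
    then have "\<theta> * v \<le> m0 * x / 2" using b v by (simp add: \<theta>_def field_simps)
    then have "\<theta> * (\<theta> * v) \<le> \<theta> * (m0 * x / 2)" using \<theta> by (intro mult_left_mono)
    then have "\<theta> * (x * m0 / 2) - \<theta>\<^sup>2 * v / 2 \<ge> \<theta> * (x * m0) / 4" by (simp add: power2_eq_square algebra_simps)
    moreover have "\<theta> * (x * m0) / 4 \<ge> ln 4"
    proof -
      have "b * m0 / 4 * w \<le> b * m0 / 4 * (x * y)" using b m0 y by (intro mult_left_mono) auto
      moreover have "b * m0 / 4 * w = ln 4" using m0 w by (simp add: b_def)
      ultimately show ?thesis by (simp add: \<theta>_def mult_ac)
    qed
    ultimately have "exp (ln 4) \<le> exp (\<theta> * (x * m0 / 2) - \<theta>\<^sup>2 * v / 2)" by (simp only: exp_le_cancel_iff)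
    then have e4: "4 \<le> exp (\<theta> * (x * m0 / 2) - \<theta>\<^sup>2 * v / 2)" by simp
    have "2 * hit_prob x g \<le> 4 * prob {\<omega>\<in>space P. (\<lambda>t\<in>{0..}. X t \<omega>) \<in> local_hit \<delta> x g}"
      using half by simp
    also have "\<dots> \<le> exp (\<theta> * (x * m0 / 2) - \<theta>\<^sup>2 * v / 2) * prob {\<omega>\<in>space P. (\<lambda>t\<in>{0..}. X t \<omega>) \<in> local_hit \<delta> x g}"
      using e4 by (intro mult_right_mono) auto
    also have "\<dots> \<le> prob {\<omega>\<in>space P. (\<lambda>t\<in>{0..}. X t \<omega> + \<theta> * r t) \<in> local_hit \<delta> x g}"
      unfolding r_def v_def
    proof (rule prob_shifted_path_ge[OF s0_pos local_hit_sets])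
      fix y assume "y \<in> local_hit \<delta> x g"
      then have "x * m0 / 2 \<le> y s0" by (simp add: local_hit_def m0_def)
      then show "\<theta> * (x * m0 / 2) \<le> \<theta> * y s0" using \<theta> by (rule mult_left_mono)
    qed
    also have "\<dots> \<le> hit_prob x (\<lambda>s. g s + h s)"
      unfolding hit_prob_def
    proof (intro finite_measure_mono hit_events subsetI)
      fix \<omega> assume "\<omega> \<in> {\<omega>\<in>space P. (\<lambda>t\<in>{0..}. X t \<omega> + \<theta> * r t) \<in> local_hit \<delta> x g}"
      then obtain s where s: "\<omega> \<in> space P" "s \<in> D" "\<bar>s - s0\<bar> < \<delta>" "X s \<omega> + \<theta> * r s > x * barrier c \<beta> s - g s"
        using D by (auto simp: local_hit_def dist_real_def abs_minus_commute subset_iff)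
      have "\<theta> * r s \<le> \<theta> * (2 * v)" using \<delta>1(2)[OF s(2)] s(3) \<delta>(2) \<theta> by (intro mult_left_mono) auto
      also have "\<dots> = y * q" by (simp add: \<theta>_def q_def)
      also have "\<dots> \<le> h s" using h s \<delta> by auto
      finally have "X s \<omega> > x * barrier c \<beta> s - (g s + h s)" using s(4) by linarith
      then show "\<omega> \<in> {\<omega>\<in>space P. \<exists>s\<in>D. X s \<omega> > x * barrier c \<beta> s - (g s + h s)}" using s by auto
    qed
    finally show ?thesis .
  qed
  have "eventually (\<lambda>x. \<forall>y g h. 0 \<le> y \<and> w \<le> x * y \<and> y \<le> \<epsilon>' * x \<and>
      (\<forall>s\<in>D. \<bar>g s\<bar> \<le> \<epsilon>' * x * barrier c \<beta> s) \<and> (\<forall>s\<in>D. \<bar>s - s0\<bar> < \<eta> \<longrightarrow> y * q \<le> h s) \<longrightarrow>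
      2 * hit_prob x g \<le> hit_prob x (\<lambda>s. g s + h s)) at_top"
    using loc[OF half_gt_zero[OF zero_less_one]] eventually_ge_at_top[of "0::real"]
    by eventually_elim (intro allI impI, elim conjE, rule main)
  then show ?thesis using q \<epsilon>' by blast
qed

text \<open>
  Raising the level by \<open>d\<close> costs no more than a Cameron--Martin shift by \<open>\<theta>\<close> of order \<open>- d\<close>, whose
  density on typical crossings is at least \<open>exp\<close> of a multiple of \<open>- x * d\<close>.
\<close>

lemma hit_prob_long_tailed:
  assumes \<kappa>: "\<kappa> > 0"
  shows "\<exists>h>0. eventually (\<lambda>x. \<forall>d\<ge>0. x * d \<le> h \<longrightarrow>
    (1 - \<kappa>) * hit_prob x (\<lambda>_. 0) \<le> hit_prob (x + d) (\<lambda>_. 0)) at_top"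
proof -
  define v where "v = s0 powr (2 * H)"
  have v: "v > 0" using s0_pos by (simp add: v_def)
  define m0 where "m0 = barrier c \<beta> s0"
  have m0: "m0 > 0" using barrier_pos by (simp add: m0_def)
  define r where "r = (\<lambda>s. expectation (\<lambda>\<omega>. X s \<omega> * X s0 \<omega>))"
  obtain \<delta>1 where \<delta>1: "\<delta>1 > 0" "\<And>s. s \<in> D \<Longrightarrow> \<bar>s - s0\<bar> < \<delta>1 \<Longrightarrow> r s \<in> {v / 2..2 * v}"
    using covariance_near[OF s0_pos] unfolding r_def v_def by blast
  from localisation[OF \<delta>1(1)] obtain \<delta> \<epsilon> where \<delta>: "\<delta> > 0" "\<delta> \<le> \<delta>1" and \<epsilon>: "\<epsilon> > 0" and
    loc: "\<And>\<kappa>. \<kappa> > 0 \<Longrightarrow> eventually (\<lambda>x. \<forall>g. (\<forall>s\<in>D. \<bar>g s\<bar> \<le> \<epsilon> * x * barrier c \<beta> s) \<longrightarrow>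
    (1 - \<kappa>) * hit_prob x g \<le> prob {\<omega>\<in>space P. (\<lambda>t\<in>{0..}. X t \<omega>) \<in> local_hit \<delta> x g}) at_top"
    by blast
  define m1 where "m1 = barrier c \<beta> (s0 + \<delta>)"
  have m1: "m1 > 0" using barrier_pos by (simp add: m1_def)
  define b where "b = 2 * m1 / v"
  have b: "b > 0" using m1 v by (simp add: b_def)
  define Z where "Z = 2 * b * m0 + b\<^sup>2 * v / 2"
  have Z: "Z > 0" using b m0 v by (simp add: Z_def add_pos_nonneg)
  define h where "h = min 1 (\<kappa> / 2 / Z)"
  have h: "h > 0" "h \<le> 1" "Z * h \<le> \<kappa> / 2" using \<kappa> Z by (auto simp: h_def min_def field_simps)
  have main: "(1 - \<kappa>) * hit_prob x (\<lambda>_. 0) \<le> hit_prob (x + d) (\<lambda>_. 0)"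
    if L: "\<forall>g. (\<forall>s\<in>D. \<bar>g s\<bar> \<le> \<epsilon> * x * barrier c \<beta> s) \<longrightarrow>
       (1 - \<kappa>/2) * hit_prob x g \<le> prob {\<omega>\<in>space P. (\<lambda>t\<in>{0..}. X t \<omega>) \<in> local_hit \<delta> x g}"
      and x: "x \<ge> 1" and d: "0 \<le> d" "x * d \<le> h" for x d
  proof -
    let ?L = "local_hit \<delta> x (\<lambda>_. 0)"
    define \<theta> where "\<theta> = - (b * d)"
    have \<theta>: "\<theta> \<le> 0" using b d by (simp add: \<theta>_def)
    have "1 * d \<le> x * d" using x d by (intro mult_right_mono) auto
    then have dh: "d \<le> h" using d by linarith
    have half: "(1 - \<kappa>/2) * hit_prob x (\<lambda>_. 0) \<le> prob {\<omega>\<in>space P. (\<lambda>t\<in>{0..}. X t \<omega>) \<in> ?L}"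
      using L \<epsilon> x barrier_pos by (simp add: less_imp_le)
    have "d\<^sup>2 \<le> h"
    proof -
      have "d * d \<le> h * 1" using dh d h by (intro mult_mono) auto
      then show ?thesis by (simp add: power2_eq_square)
    qed
    then have "2 * b * m0 * (x * d) + b\<^sup>2 * v / 2 * d\<^sup>2 \<le> 2 * b * m0 * h + b\<^sup>2 * v / 2 * h"
      using b m0 v d by (intro add_mono mult_left_mono) auto
    then have "2 * b * m0 * (x * d) + b\<^sup>2 * v / 2 * d\<^sup>2 \<le> \<kappa> / 2"
      using h(3) by (simp add: Z_def distrib_right)
    then have ex: "\<theta> * (2 * m0 * x) - \<theta>\<^sup>2 * v / 2 \<ge> - (\<kappa> / 2)"
      by (simp add: \<theta>_def power_mult_distrib algebra_simps)
    have e1: "1 - \<kappa> / 2 \<le> exp (\<theta> * (2 * m0 * x) - \<theta>\<^sup>2 * v / 2)"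
      using exp_ge_add_one_self[of "\<theta> * (2 * m0 * x) - \<theta>\<^sup>2 * v / 2"] ex by linarith
    have "(1 - \<kappa>) * hit_prob x (\<lambda>_. 0) \<le> exp (\<theta> * (2 * m0 * x) - \<theta>\<^sup>2 * v / 2) * prob {\<omega>\<in>space P. (\<lambda>t\<in>{0..}. X t \<omega>) \<in> ?L}"
    proof (cases "\<kappa> \<le> 1")
      case True
      have "(1 - \<kappa>) * hit_prob x (\<lambda>_. 0) \<le> ((1 - \<kappa> / 2) * (1 - \<kappa> / 2)) * hit_prob x (\<lambda>_. 0)"
        using hit_prob_nonneg by (intro mult_right_mono) (auto simp: algebra_simps)
      also have "\<dots> = (1 - \<kappa> / 2) * ((1 - \<kappa> / 2) * hit_prob x (\<lambda>_. 0))" by simp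
      also have "\<dots> \<le> exp (\<theta> * (2 * m0 * x) - \<theta>\<^sup>2 * v / 2) * prob {\<omega>\<in>space P. (\<lambda>t\<in>{0..}. X t \<omega>) \<in> ?L}"
        using e1 half True hit_prob_nonneg by (intro mult_mono) auto
      finally show ?thesis .
    next
      case False
      then have "(1 - \<kappa>) * hit_prob x (\<lambda>_. 0) \<le> 0" using hit_prob_nonneg by (simp add: mult_le_0_iff)
      also have "0 \<le> exp (\<theta> * (2 * m0 * x) - \<theta>\<^sup>2 * v / 2) * prob {\<omega>\<in>space P. (\<lambda>t\<in>{0..}. X t \<omega>) \<in> ?L}" by simp
      finally show ?thesis .
    qed
    also have "\<dots> \<le> prob {\<omega>\<in>space P. (\<lambda>t\<in>{0..}. X t \<omega> + \<theta> * r t) \<in> ?L}"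
      unfolding r_def v_def
      by (rule prob_shifted_path_ge[OF s0_pos local_hit_sets]) (auto simp: local_hit_def m0_def intro!: mult_left_mono_neg \<theta>)
    also have "\<dots> \<le> hit_prob (x + d) (\<lambda>_. 0)"
      unfolding hit_prob_def
    proof (intro finite_measure_mono hit_events subsetI)
      fix \<omega> assume "\<omega> \<in> {\<omega>\<in>space P. (\<lambda>t\<in>{0..}. X t \<omega> + \<theta> * r t) \<in> ?L}"
      then obtain s where s: "\<omega> \<in> space P" "s \<in> D" "s \<ge> 0" "\<bar>s - s0\<bar> < \<delta>" "X s \<omega> + \<theta> * r s > x * barrier c \<beta> s"
        using D by (auto simp: local_hit_def dist_real_def abs_minus_commute subset_iff)
      have "s powr \<beta> \<le> (s0 + \<delta>) powr \<beta>" using s \<beta>_pos by (intro powr_mono2) auto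
      then have "barrier c \<beta> s \<le> m1" using c by (simp add: barrier_def m1_def)
      then have "d * barrier c \<beta> s \<le> d * m1" using d by (intro mult_left_mono)
      also have "\<dots> = b * d * (v / 2)" using v by (simp add: b_def)
      also have "\<dots> \<le> b * d * r s" using \<delta>1(2)[OF s(2)] s(4) \<delta>(2) b d by (intro mult_left_mono) auto
      finally have "X s \<omega> > (x + d) * barrier c \<beta> s - 0" using s(5) by (simp add: \<theta>_def algebra_simps)
      then show "\<omega> \<in> {\<omega>\<in>space P. \<exists>s\<in>D. X s \<omega> > (x + d) * barrier c \<beta> s - 0}" using s by auto
    qed
    finally show ?thesis .
  qed
  have "eventually (\<lambda>x. \<forall>d\<ge>0. x * d \<le> h \<longrightarrow>
    (1 - \<kappa>) * hit_prob x (\<lambda>_. 0) \<le> hit_prob (x + d) (\<lambda>_. 0)) at_top"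
    using loc[OF half_gt_zero[OF \<kappa>]] eventually_ge_at_top[of "1::real"]
    by eventually_elim (intro allI impI, rule main)
  then show ?thesis using h by blast
qed

end

section \<open>Conditional independence and scaling\<close>

text \<open>
  Countability makes the supremum over the grid measurable and density makes it equal to the full
  supremum for continuous paths; \<open>s0\<close> is included because the crossing at \<open>s0\<close> is the lower bound
  with which all other crossings are compared.
\<close>

definition time_grid :: "real \<Rightarrow> real set" where
  "time_grid s0 = insert s0 {t. 0 \<le> t \<and> t \<in> \<rat>}"

lemma countable_time_grid: "countable (time_grid s0)"
proof -
  have "{t. 0 \<le> t \<and> t \<in> \<rat>} \<subseteq> (\<rat> :: real set)" by auto
  then have "countable {t::real. 0 \<le> t \<and> t \<in> \<rat>}" using countable_rat countable_subset by blast
  then show ?thesis by (simp add: time_grid_def)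
qed

lemma closure_scaled_time_grid:
  assumes a: "a > 0" and s0: "s0 \<ge> 0"
  shows "closure ((\<lambda>s. a * s) ` time_grid s0) = {0..}"
proof
  show "closure ((\<lambda>s. a * s) ` time_grid s0) \<subseteq> {0..}"
    using a s0 by (intro closure_minimal) (auto simp: time_grid_def)
  show "{0..} \<subseteq> closure ((\<lambda>s. a * s) ` time_grid s0)"
  proof
    fix t :: real assume t: "t \<in> {0..}"
    show "t \<in> closure ((\<lambda>s. a * s) ` time_grid s0)"
      unfolding closure_approachable
    proof (intro allI impI)
      fix e :: real assume e: "e > 0"
      have "t / a < (t + e) / a" using a e by (intro divide_strict_right_mono) auto
      then obtain q where q: "q \<in> \<rat>" "t / a < q" "q < (t + e) / a"
        using Rats_dense_in_real by blast
      have "0 \<le> t / a" using a t by simp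
      with q(2) have "q \<ge> 0" by linarith
      moreover have "t < a * q" "a * q < t + e" using q a by (simp_all add: field_simps)
      ultimately show "\<exists>y\<in>(\<lambda>s. a * s) ` time_grid s0. dist y t < e"
        using q by (intro bexI[of _ "a * q"]) (auto simp: time_grid_def dist_real_def)
    qed
  qed
qed

lemma bounded_above_of_eventually:
  fixes Y :: "real \<Rightarrow> real"
  assumes Y: "continuous_on {0..} Y" and D: "closure D = {0..}" and T: "\<And>r. r \<in> D \<Longrightarrow> r \<ge> T \<Longrightarrow> Y r \<le> 1"
  shows "bdd_above (Y ` {0..})"
proof -
  have "compact (Y ` {0..T})" using Y by (intro compact_continuous_image) (auto elim: continuous_on_subset)
  then obtain b where "\<forall>y\<in>Y ` {0..T}. norm y \<le> b" using compact_imp_bounded bounded_iff by blast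
  then have b: "Y t \<le> b" if "0 \<le> t" "t \<le> T" for t using that by (auto simp: abs_le_iff)
  have D0: "r \<in> D \<Longrightarrow> r \<ge> 0" for r using D closure_subset[of D] by auto
  have "Y t \<le> max b 1" if "t \<ge> 0" for t
  proof (rule continuous_le_on_closure[of D Y])
    show "continuous_on (closure D) Y" "t \<in> closure D" using D Y that by auto
    show "Y r \<le> max b 1" if "r \<in> D" for r
      using b[of r] T[of r] D0[of r] that by (cases "r \<ge> T") (auto simp: le_max_iff_disj)
  qed
  then show ?thesis by (intro bdd_aboveI[of _ "max b 1"]) auto
qed

lemma (in prob_space) completion_AE_eq_set:
  assumes A: "A \<in> events" and B: "B \<subseteq> space M" and ae: "AE \<omega> in M. \<omega> \<in> B \<longleftrightarrow> \<omega> \<in> A"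
  shows "B \<in> sets (completion M)" "measure (completion M) B = prob A"
proof -
  obtain Z where Z: "{\<omega>\<in>space M. \<not> (\<omega> \<in> B \<longleftrightarrow> \<omega> \<in> A)} \<subseteq> Z" "Z \<in> null_sets M"
    using ae unfolding eventually_ae_filter by auto
  have "B \<inter> Z \<in> null_sets (completion M)"
    using null_sets_completion_subset[OF _ null_sets_completionI[OF Z(2)], of "B \<inter> Z"] by simp
  then have "(A - Z) \<union> (B \<inter> Z) \<in> sets (completion M)"
    using A Z(2) by (intro sets.Un) auto
  also have "(A - Z) \<union> (B \<inter> Z) = B"
    using Z(1) B sets.sets_into_space[OF A] by blast
  finally show *: "B \<in> sets (completion M)" .
  have "measure (completion M) B = measure (completion M) A"
    using ae * A by (intro measure_eq_AE AE_completion) auto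
  then show "measure (completion M) B = prob A" using A by simp
qed

lemma (in drifted_process) measurable_hit_prob:
  "(\<lambda>f. hit_prob x (\<lambda>s. y * f s)) \<in> borel_measurable path_space"
proof -
  have [measurable]: "(\<lambda>y. y s) \<in> borel_measurable path_space" "X s \<in> borel_measurable P" if "s \<in> D" for s
    using that D X_meas_D by (auto intro!: measurable_component_singleton)
  show ?thesis
    unfolding hit_prob_def
  proof (rule measurable_measure)
    show "{f \<in> space (path_space \<Otimes>\<^sub>M P). snd f \<in> {\<omega>\<in>space P. \<exists>s\<in>D. X s \<omega> > x * barrier c \<beta> s - y * fst f s}} \<in> sets (path_space \<Otimes>\<^sub>M P)"
    proof -
      have "{f \<in> space (path_space \<Otimes>\<^sub>M P). snd f \<in> {\<omega>\<in>space P. \<exists>s\<in>D. X s \<omega> > x * barrier c \<beta> s - y * fst f s}} =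
         {f \<in> space (path_space \<Otimes>\<^sub>M P). \<exists>s\<in>D. X s (snd f) > x * barrier c \<beta> s - y * fst f s}"
        by (auto simp: space_pair_measure)
      also have "\<dots> \<in> sets (path_space \<Otimes>\<^sub>M P)" using D by measurable
      finally show ?thesis .
    qed
  qed auto
qed

locale shared_input_queues =
  fixes M :: "'w measure" and N :: "'v measure"
    and Xs :: "nat \<Rightarrow> real \<Rightarrow> 'w \<Rightarrow> real" and X :: "real \<Rightarrow> 'w \<Rightarrow> real" and XH :: "real \<Rightarrow> 'v \<Rightarrow> real"
    and H H0 \<sigma>0 c \<beta> :: real
  assumes H: "0 < H" and H0: "0 < H0" and \<sigma>0: "\<sigma>0 > 0" and c: "c > 0"
    and XH: "self_similar_gaussian N H XH" and Xs: "independent_copies M Xs N XH"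
    and X: "self_similar_gaussian M H0 X" and indep: "independent_of_sequence M X Xs"
    and \<beta>: "\<beta> > max H H0"
begin

abbreviation "s0 \<equiv> t_zero H c \<beta>"
abbreviation "D \<equiv> time_grid s0"

lemma s0_pos: "s0 > 0"
  using H c \<beta> by (simp add: t_zero_def)

lemma grid: "countable D" "D \<subseteq> {0..}"
  using countable_time_grid s0_pos by (auto simp: time_grid_def)

sublocale BH: barrier_crossing N H XH c \<beta> D s0
  using XH H c \<beta> grid by unfold_locales (auto simp: time_grid_def)

sublocale BX: drifted_process M H0 X c \<beta> D
  using X H0 c \<beta> grid by unfold_locales auto

definition input_law :: "(real \<Rightarrow> real) measure" where
  "input_law = process_law N XH"

lemma sets_input_law [measurable_cong, simp]: "sets input_law = sets path_space"
  by (simp add: input_law_def process_law_def)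

lemma space_input_law [simp]: "space input_law = space path_space"
  by (simp add: input_law_def process_law_def)

lemma prob_space_input_law: "prob_space input_law"
  unfolding input_law_def process_law_def by (rule BH.prob_space_distr[OF BH.sample_path_meas])

lemma Xs_copy:
  assumes "i \<ge> 1"
  shows Xs_meas: "t \<ge> 0 \<Longrightarrow> Xs i t \<in> borel_measurable M"
    and Xs_cont: "AE \<omega> in M. continuous_on {0..} (\<lambda>t. Xs i t \<omega>)"
    and Xs_law: "process_law M (Xs i) = input_law"
    and Xs_path_meas: "sample_path (Xs i) \<in> measurable M path_space"
proof -
  have *: "stochastic_process M (Xs i)" "as_continuous_paths M (Xs i)" "process_law M (Xs i) = process_law N XH"
    using Xs assms by (auto simp: independent_copies_def)
  show m: "Xs i t \<in> borel_measurable M" if "t \<ge> 0" for t using * that by (auto simp: stochastic_process_def)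
  show "AE \<omega> in M. continuous_on {0..} (\<lambda>t. Xs i t \<omega>)" using * by (simp add: as_continuous_paths_def)
  show "process_law M (Xs i) = input_law" using * by (simp add: input_law_def)
  show "sample_path (Xs i) \<in> measurable M path_space"
    unfolding sample_path_def using m by (intro measurable_restrict) auto
qed

lemma Xs_negligible_at_infinity:
  assumes i: "i \<ge> 1"
  shows "AE \<omega> in M. \<exists>n::nat. \<forall>r\<in>D. r \<ge> 2 ^ n \<longrightarrow> \<bar>Xs i r \<omega>\<bar> \<le> 1/2 * barrier c \<beta> r"
proof -
  let ?Q = "\<lambda>y. \<exists>n::nat. \<forall>r\<in>D. r \<ge> 2 ^ n \<longrightarrow> \<bar>y r\<bar> \<le> 1/2 * barrier c \<beta> r"
  have path: "?Q (sample_path Z \<omega>) \<longleftrightarrow> ?Q (\<lambda>r. Z r \<omega>)" for Z :: "real \<Rightarrow> 'z \<Rightarrow> real" and \<omega>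
  proof -
    have "sample_path Z \<omega> r = Z r \<omega>" if "r \<in> D" for r using that grid by (auto simp: sample_path_def)
    then show ?thesis by simp
  qed
  have [measurable]: "(\<lambda>y. y r) \<in> borel_measurable path_space" if "r \<in> D" for r
    using that grid by (intro measurable_component_singleton) auto
  have Q: "{y\<in>space path_space. ?Q y} \<in> sets path_space" using grid by measurable
  have "AE \<omega> in N. ?Q (\<lambda>r. XH r \<omega>)"
    using BH.X_vanishing_at_infinity by eventually_elim (metis half_gt_zero zero_less_one)
  then have "AE y in input_law. ?Q y"
    unfolding input_law_def process_law_def AE_distr_iff[OF BH.sample_path_meas Q] path .
  then have "AE \<omega> in M. ?Q (sample_path (Xs i) \<omega>)"
    unfolding Xs_law[OF i, symmetric] process_law_def AE_distr_iff[OF Xs_path_meas[OF i] Q] .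
  then show ?thesis unfolding path .
qed

text \<open>
  Each of the two inputs is eventually at most half the barrier \<open>1 + c * r powr \<beta>\<close>, so the supremum
  is that of a continuous function over a compact interval.
\<close>

lemma content_bounded_above:
  "AE \<omega> in M. \<forall>i\<ge>1. continuous_on {0..} (\<lambda>t. Xs i t \<omega> + \<sigma>0 * X t \<omega> - c * t powr \<beta>) \<and>
     bdd_above ((\<lambda>t. Xs i t \<omega> + \<sigma>0 * X t \<omega> - c * t powr \<beta>) ` {0..})"
proof -
  have "AE \<omega> in M. \<forall>i. i \<ge> 1 \<longrightarrow> continuous_on {0..} (\<lambda>t. Xs i t \<omega>)"
    unfolding AE_all_countable using Xs_cont by auto
  moreover have "AE \<omega> in M. \<forall>i. i \<ge> 1 \<longrightarrow> (\<exists>n::nat. \<forall>r\<in>D. r \<ge> 2 ^ n \<longrightarrow> \<bar>Xs i r \<omega>\<bar> \<le> 1/2 * barrier c \<beta> r)"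
    unfolding AE_all_countable using Xs_negligible_at_infinity by auto
  ultimately show ?thesis
    using BX.X_cont BX.X_vanishing_at_infinity
  proof eventually_elim
    case (elim \<omega>)
    show ?case
    proof (intro allI impI)
      fix i :: nat assume i: "i \<ge> 1"
      let ?Y = "\<lambda>t. Xs i t \<omega> + \<sigma>0 * X t \<omega> - c * t powr \<beta>"
      have cont: "continuous_on {0..} ?Y"
        using elim(1,3) i BH.\<beta>_pos by (intro continuous_intros continuous_on_powr') auto
      obtain n1 :: nat where n1: "\<And>r. r \<in> D \<Longrightarrow> r \<ge> 2 ^ n1 \<Longrightarrow> \<bar>Xs i r \<omega>\<bar> \<le> 1/2 * barrier c \<beta> r"
        using elim(2) i by blast
      have "1 / (2 * \<sigma>0) > 0" using \<sigma>0 by simp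
      then obtain n2 :: nat where n2: "\<And>r. r \<in> D \<Longrightarrow> r \<ge> 2 ^ n2 \<Longrightarrow> \<bar>X r \<omega>\<bar> \<le> 1 / (2 * \<sigma>0) * barrier c \<beta> r"
        using elim(4) by blast
      have "bdd_above (?Y ` {0..})"
      proof (rule bounded_above_of_eventually[OF cont, of D "max (2 ^ n1) (2 ^ n2)"])
        show "closure D = {0..}" using closure_scaled_time_grid[of 1 s0] s0_pos by simp
        fix r assume r: "r \<in> D" "max (2 ^ n1) (2 ^ n2) \<le> r"
        have "\<sigma>0 * \<bar>X r \<omega>\<bar> \<le> \<sigma>0 * (1 / (2 * \<sigma>0) * barrier c \<beta> r)"
          using n2[of r] r \<sigma>0 by (intro mult_left_mono) auto
        also have "\<dots> = 1/2 * barrier c \<beta> r" using \<sigma>0 by simp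
        finally have "\<bar>\<sigma>0 * X r \<omega>\<bar> \<le> 1/2 * barrier c \<beta> r" using \<sigma>0 by (simp add: abs_mult)
        moreover have "\<bar>Xs i r \<omega>\<bar> \<le> 1/2 * barrier c \<beta> r" using n1 r by simp
        ultimately have "Xs i r \<omega> + \<sigma>0 * X r \<omega> \<le> barrier c \<beta> r" by linarith
        then show "?Y r \<le> 1" by (simp add: barrier_def)
      qed
      with cont show "continuous_on {0..} ?Y \<and> bdd_above (?Y ` {0..})" by blast
    qed
  qed
qed

text \<open>The measurable modification of the event that the maximum of the first \<open>n\<close> terms is at most \<open>u\<close>.\<close>

definition grid_event :: "real \<Rightarrow> nat \<Rightarrow> real \<Rightarrow> 'w set" where
  "grid_event a n u = {\<omega>\<in>space M. \<forall>i\<in>{1..n}. \<forall>s\<in>D. Xs i (a * s) \<omega> + \<sigma>0 * X (a * s) \<omega> - c * (a * s) powr \<beta> \<le> u}"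

lemma grid_event_events: "a > 0 \<Longrightarrow> grid_event a n u \<in> BX.events"
proof -
  assume a: "a > 0"
  have [measurable]: "X (a * s) \<in> borel_measurable M" if "s \<in> D" for s
    using that grid a by (intro BX.X_meas) auto
  have [measurable]: "Xs i (a * s) \<in> borel_measurable M" if "i \<in> {1..n}" "s \<in> D" for s i
    using that grid a by (intro Xs_meas) auto
  show ?thesis unfolding grid_event_def using grid by measurable
qed

abbreviation "max_event n u \<equiv> {\<omega>\<in>space M. (MAX i\<in>{1..n}. sup_with_drift Xs X \<sigma>0 c \<beta> i \<omega>) \<le> u}"

lemma max_event_AE:
  assumes a: "a > 0" and n: "n \<ge> 1"
  shows "AE \<omega> in M. \<omega> \<in> max_event n u \<longleftrightarrow> \<omega> \<in> grid_event a n u"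
  using content_bounded_above AE_space
proof eventually_elim
  case (elim \<omega>)
  have "sup_with_drift Xs X \<sigma>0 c \<beta> i \<omega> \<le> u \<longleftrightarrow> (\<forall>s\<in>D. Xs i (a * s) \<omega> + \<sigma>0 * X (a * s) \<omega> - c * (a * s) powr \<beta> \<le> u)"
    if i: "i \<in> {1..n}" for i
  proof -
    let ?Y = "\<lambda>t. Xs i t \<omega> + \<sigma>0 * X t \<omega> - c * t powr \<beta>"
    have Y: "continuous_on {0..} ?Y" "bdd_above (?Y ` {0..})" using elim(1) i by auto
    have "sup_with_drift Xs X \<sigma>0 c \<beta> i \<omega> \<le> u \<longleftrightarrow> (\<forall>t\<in>{0..}. ?Y t \<le> u)"
      unfolding sup_with_drift_def using Y(2) by (intro cSUP_le_iff) auto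
    also have "\<dots> \<longleftrightarrow> (\<forall>s\<in>D. ?Y (a * s) \<le> u)"
    proof (intro iffI ballI)
      fix s assume "\<forall>t\<in>{0..}. ?Y t \<le> u" "s \<in> D"
      then show "?Y (a * s) \<le> u" using grid a by auto
    next
      fix t :: real assume *: "\<forall>s\<in>D. ?Y (a * s) \<le> u" and t: "t \<in> {0..}"
      have cl: "closure ((\<lambda>s. a * s) ` D) = {0..}" using a s0_pos by (intro closure_scaled_time_grid) auto
      show "?Y t \<le> u"
        by (rule continuous_le_on_closure[of "(\<lambda>s. a * s) ` D" ?Y]) (use Y(1) cl t * in auto)
    qed
    finally show ?thesis .
  qed
  moreover have "(MAX i\<in>{1..n}. sup_with_drift Xs X \<sigma>0 c \<beta> i \<omega>) \<le> u \<longleftrightarrow> (\<forall>i\<in>{1..n}. sup_with_drift Xs X \<sigma>0 c \<beta> i \<omega> \<le> u)"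
    using n by (subst Max_le_iff) auto
  ultimately show ?case using elim(2) unfolding grid_event_def by simp
qed

lemma max_event_sets:
  assumes "n \<ge> 1"
  shows "max_event n u \<in> sets (completion M)"
  by (rule BX.completion_AE_eq_set(1)[OF grid_event_events[OF zero_less_one] _ max_event_AE[OF zero_less_one assms]]) auto

lemma measure_max_event:
  assumes "n \<ge> 1" "a > 0"
  shows "measure (completion M) (max_event n u) = BX.prob (grid_event a n u)"
  by (rule BX.completion_AE_eq_set(2)[OF grid_event_events[OF assms(2)] _ max_event_AE[OF assms(2,1)]]) auto

text \<open>It suffices to compare rectangles, where the two independence hypotheses apply in turn.\<close>

lemma joint_law:
  "distr M (path_space \<Otimes>\<^sub>M PiM {1..} (\<lambda>_. path_space)) (\<lambda>\<omega>. (sample_path X \<omega>, \<lambda>i\<in>{1..}. sample_path (Xs i) \<omega>)) =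
    process_law M X \<Otimes>\<^sub>M PiM {1..} (\<lambda>_. input_law)"
proof -
  let ?\<Pi> = "PiM {1..} (\<lambda>_. path_space)" and ?\<Xi> = "\<lambda>\<omega>. \<lambda>i\<in>{1::nat..}. sample_path (Xs i) \<omega>"
  have mX: "sample_path X \<in> measurable M path_space" by (rule BX.sample_path_meas)
  have m\<Xi>: "?\<Xi> \<in> measurable M ?\<Pi>" using Xs_path_meas by (intro measurable_restrict) auto
  have "distr M ?\<Pi> ?\<Xi> = PiM {1..} (\<lambda>i. distr M path_space (sample_path (Xs i)))"
    using Xs Xs_path_meas unfolding independent_copies_def
    by (subst BX.indep_vars_iff_distr_eq_PiM'[symmetric]) auto
  also have "\<dots> = PiM {1..} (\<lambda>_. input_law)"
    using Xs_law by (intro PiM_cong) (auto simp: process_law_def)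
  finally have law: "distr M ?\<Pi> ?\<Xi> = PiM {1..} (\<lambda>_. input_law)" .
  show ?thesis
  proof (rule pair_measure_eqI[symmetric])
    show "sigma_finite_measure (process_law M X)"
      unfolding process_law_def using BX.prob_space_distr[OF mX] by (rule prob_space_imp_sigma_finite)
    show "sigma_finite_measure (PiM {1::nat..} (\<lambda>_. input_law))"
      using prob_space_input_law by (intro prob_space_imp_sigma_finite prob_space_PiM)
    have "sets (PiM {1::nat..} (\<lambda>_. input_law)) = sets ?\<Pi>" by (intro sets_PiM_cong) auto
    then show "sets (process_law M X \<Otimes>\<^sub>M PiM {1..} (\<lambda>_. input_law)) =
       sets (distr M (path_space \<Otimes>\<^sub>M ?\<Pi>) (\<lambda>\<omega>. (sample_path X \<omega>, ?\<Xi> \<omega>)))"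
      by (auto simp: process_law_def intro!: sets_pair_measure_cong)
    fix A B assume A: "A \<in> sets (process_law M X)" and B: "B \<in> sets (PiM {1::nat..} (\<lambda>_. input_law))"
    have A': "A \<in> sets path_space" using A by (simp add: process_law_def)
    have B': "B \<in> sets ?\<Pi>" using B \<open>sets (PiM {1::nat..} (\<lambda>_. input_law)) = sets ?\<Pi>\<close> by simp
    let ?a = "sample_path X -` A \<inter> space M" and ?b = "?\<Xi> -` B \<inter> space M"
    have "BX.prob (?a \<inter> ?b) = BX.prob ?a * BX.prob ?b"
      by (rule BX.indep_setD[OF indep[unfolded independent_of_sequence_def]]) (intro in_vimage_algebra A' B')+
    moreover have "(\<lambda>\<omega>. (sample_path X \<omega>, ?\<Xi> \<omega>)) -` (A \<times> B) \<inter> space M = ?a \<inter> ?b" by auto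
    ultimately show "emeasure (process_law M X) A * emeasure (PiM {1..} (\<lambda>_. input_law)) B =
       emeasure (distr M (path_space \<Otimes>\<^sub>M ?\<Pi>) (\<lambda>\<omega>. (sample_path X \<omega>, ?\<Xi> \<omega>))) (A \<times> B)"
      unfolding law[symmetric] process_law_def using A' B' mX m\<Xi>
      by (simp add: emeasure_distr BX.emeasure_eq_measure flip: ennreal_mult')
  qed
qed

text \<open>
  By \<open>joint_law\<close> and Fubini's theorem; for a fixed path of \<open>X\<close> the event is a rectangle of the
  infinite product, which gives the power.
\<close>

lemma prob_conditionally_independent:
  assumes S: "S \<in> sets (path_space \<Otimes>\<^sub>M path_space)"
  shows "BX.prob {\<omega>\<in>space M. \<forall>i\<in>{1..n}. (sample_path X \<omega>, sample_path (Xs i) \<omega>) \<in> S} =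
    (\<integral>\<omega>. (measure input_law {y\<in>space path_space. (sample_path X \<omega>, y) \<in> S}) ^ n \<partial>M)"
proof -
  interpret L: prob_space input_law by (rule prob_space_input_law)
  interpret PL: product_prob_space "\<lambda>_. input_law" "{1::nat..}" by standard
  let ?\<Pi> = "PiM {1..} (\<lambda>_. path_space)" and ?\<Xi> = "\<lambda>\<omega>. \<lambda>i\<in>{1::nat..}. sample_path (Xs i) \<omega>"
  let ?\<nu> = "PiM {1::nat..} (\<lambda>_. input_law)"
  have mX: "sample_path X \<in> measurable M path_space" by (rule BX.sample_path_meas)
  have m\<Xi>: "?\<Xi> \<in> measurable M ?\<Pi>" using Xs_path_meas by (intro measurable_restrict) auto
  have mJ: "(\<lambda>\<omega>. (sample_path X \<omega>, ?\<Xi> \<omega>)) \<in> measurable M (path_space \<Otimes>\<^sub>M ?\<Pi>)"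
    using mX m\<Xi> by (rule measurable_Pair)
  have sets\<nu>: "sets ?\<nu> = sets ?\<Pi>" by (intro sets_PiM_cong) auto
  have space\<nu>: "space ?\<nu> = space ?\<Pi>" using sets\<nu> by (rule sets_eq_imp_space_eq)
  define Sf where "Sf = (\<lambda>f. {y\<in>space path_space. (f, y) \<in> S})"
  have Sf: "Sf f \<in> sets path_space" for f
  proof -
    have "Sf f = Pair f -` S" using sets.sets_into_space[OF S] by (auto simp: Sf_def space_pair_measure)
    then show ?thesis using S by (simp add: sets_Pair1)
  qed
  define B where "B = {z\<in>space (path_space \<Otimes>\<^sub>M ?\<Pi>). \<forall>i\<in>{1..n}. (fst z, snd z i) \<in> S}"
  have [measurable]: "(\<lambda>z. (fst z, snd z i)) \<in> measurable (path_space \<Otimes>\<^sub>M ?\<Pi>) (path_space \<Otimes>\<^sub>M path_space)"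
    if "i \<in> {1..n}" for i
    using that by (intro measurable_Pair measurable_fst measurable_compose[OF measurable_snd] measurable_component_singleton) auto
  have B: "B \<in> sets (path_space \<Otimes>\<^sub>M ?\<Pi>)" unfolding B_def using S by measurable
  have B': "B \<in> sets (process_law M X \<Otimes>\<^sub>M ?\<nu>)"
    using B sets_pair_measure_cong[OF _ sets\<nu>, of "process_law M X" path_space] by (simp add: process_law_def)
  have "{\<omega>\<in>space M. \<forall>i\<in>{1..n}. (sample_path X \<omega>, sample_path (Xs i) \<omega>) \<in> S} =
     (\<lambda>\<omega>. (sample_path X \<omega>, ?\<Xi> \<omega>)) -` B \<inter> space M"
    using measurable_space[OF mJ] by (auto simp: B_def)
  then have "emeasure M {\<omega>\<in>space M. \<forall>i\<in>{1..n}. (sample_path X \<omega>, sample_path (Xs i) \<omega>) \<in> S} =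
     emeasure (process_law M X \<Otimes>\<^sub>M ?\<nu>) B"
    unfolding joint_law[symmetric] using mJ B by (simp add: emeasure_distr)
  also have "\<dots> = (\<integral>\<^sup>+f. emeasure ?\<nu> (Pair f -` B) \<partial>process_law M X)"
    using B' by (rule PL.P.emeasure_pair_measure_alt)
  also have "\<dots> = (\<integral>\<^sup>+\<omega>. emeasure ?\<nu> (Pair (sample_path X \<omega>) -` B) \<partial>M)"
    unfolding process_law_def using mX B'
    by (intro nn_integral_distr PL.P.measurable_emeasure_Pair) (auto simp: process_law_def cong: measurable_cong_sets)
  also have "\<dots> = (\<integral>\<^sup>+\<omega>. ennreal ((measure input_law (Sf (sample_path X \<omega>))) ^ n) \<partial>M)"
  proof (intro nn_integral_cong)
    fix \<omega> assume "\<omega> \<in> space M"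
    then have f: "sample_path X \<omega> \<in> space path_space" by (rule measurable_space[OF mX])
    have "Pair (sample_path X \<omega>) -` B = {h\<in>space ?\<nu>. \<forall>i\<in>{1..n}. h i \<in> Sf (sample_path X \<omega>)}"
    proof -
      have "h i \<in> space path_space" if "h \<in> space ?\<Pi>" "i \<in> {1..n}" for h :: "nat \<Rightarrow> real \<Rightarrow> real" and i
        using that unfolding space_PiM[of "{1::nat..}" "\<lambda>_. path_space"] by auto
      then show ?thesis
        using f unfolding space\<nu> B_def Sf_def space_pair_measure by auto
    qed
    also have "emeasure ?\<nu> \<dots> = (\<Prod>i\<in>{1..n}. emeasure input_law (Sf (sample_path X \<omega>)))"
      using Sf by (intro PL.emeasure_PiM_Collect) auto
    finally show "emeasure ?\<nu> (Pair (sample_path X \<omega>) -` B) = ennreal ((measure input_law (Sf (sample_path X \<omega>))) ^ n)"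
      by (simp add: L.emeasure_eq_measure ennreal_power)
  qed
  also have "\<dots> = ennreal (\<integral>\<omega>. (measure input_law (Sf (sample_path X \<omega>))) ^ n \<partial>M)"
  proof (rule nn_integral_eq_integral)
    have "(\<lambda>f. measure input_law (Sf f)) \<in> borel_measurable path_space"
    proof (rule L.measurable_measure)
      have "{x \<in> space (path_space \<Otimes>\<^sub>M input_law). snd x \<in> Sf (fst x)} = S"
        using sets.sets_into_space[OF S] by (auto simp: Sf_def space_pair_measure)
      then show "{x \<in> space (path_space \<Otimes>\<^sub>M input_law). snd x \<in> Sf (fst x)} \<in> sets (path_space \<Otimes>\<^sub>M input_law)"
        using S sets_pair_measure_cong[OF refl sets_input_law, of path_space] by simp
    qed (auto simp: Sf_def)
    from measurable_compose[OF mX this]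
    show "integrable M (\<lambda>\<omega>. (measure input_law (Sf (sample_path X \<omega>))) ^ n)"
      by (intro BX.integrable_const_bound[where B=1]) (auto intro!: AE_I2 simp: power_le_one)
  qed simp
  finally show ?thesis
    by (simp add: BX.emeasure_eq_measure Sf_def integral_nonneg_AE)
qed

text \<open>
  After the time change \<open>t = u powr (1 / \<beta>) * s\<close> and division by \<open>u powr (H / \<beta>)\<close>, the level \<open>u\<close>
  becomes \<open>level u\<close> and the common input becomes \<open>amplitude u * X\<close> in law.
\<close>

definition level :: "real \<Rightarrow> real" where "level u = u powr (1 - H / \<beta>)"
definition amplitude :: "real \<Rightarrow> real" where "amplitude u = \<sigma>0 * u powr ((H0 - H) / \<beta>)"

text \<open>
  The grid is stretched by \<open>u powr (1 / \<beta>)\<close> first, so that self-similarity of \<open>XH\<close> and then of \<open>X\<close>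
  brings both processes back to the same grid for every \<open>u\<close>.
\<close>

theorem measure_max_event_eq:
  assumes n: "n \<ge> 1" and u: "u > 0"
  shows "measure (completion M) (max_event n u) =
    (\<integral>\<omega>. (1 - BH.hit_prob (level u) (\<lambda>s. amplitude u * X s \<omega>)) ^ n \<partial>M)"
proof -
  define a where "a = u powr (1 / \<beta>)"
  have a: "a > 0" using u by (simp add: a_def)
  have ab: "a powr \<beta> = u" using u BH.\<beta>_pos by (simp add: a_def powr_powr)
  have x: "u / a powr H = level u"
    using u by (simp add: a_def level_def powr_powr powr_diff)
  have y: "\<sigma>0 * a powr H0 / a powr H = amplitude u"
    using u by (simp add: a_def amplitude_def powr_powr diff_divide_distrib powr_diff)
  have as: "a * s \<in> {0..}" if "s \<in> D" for s using that grid a by auto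
  have comp [measurable]: "(\<lambda>y. y (a * s)) \<in> borel_measurable path_space" if "s \<in> D" for s
    using as[OF that] by (intro measurable_component_singleton) auto
  define S where "S = {z\<in>space (path_space \<Otimes>\<^sub>M path_space). \<forall>s\<in>D. snd z (a * s) + \<sigma>0 * fst z (a * s) - c * (a * s) powr \<beta> \<le> u}"
  have S: "S \<in> sets (path_space \<Otimes>\<^sub>M path_space)" unfolding S_def using grid by measurable
  have path: "sample_path Z \<omega> (a * s) = Z (a * s) \<omega>" if "s \<in> D" for Z :: "real \<Rightarrow> 'z \<Rightarrow> real" and \<omega> s
    using as[OF that] by (simp add: sample_path_def)
  have pX: "sample_path X \<omega> \<in> space path_space" if "\<omega> \<in> space M" for \<omega>
    using that by (rule measurable_space[OF BX.sample_path_meas])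
  have "measure (completion M) (max_event n u) = BX.prob (grid_event a n u)"
    using n a by (rule measure_max_event)
  also have "grid_event a n u = {\<omega>\<in>space M. \<forall>i\<in>{1..n}. (sample_path X \<omega>, sample_path (Xs i) \<omega>) \<in> S}"
    using pX measurable_space[OF Xs_path_meas]
    by (auto simp: grid_event_def S_def space_pair_measure path)
  also have "BX.prob \<dots> = (\<integral>\<omega>. (measure input_law {y\<in>space path_space. (sample_path X \<omega>, y) \<in> S}) ^ n \<partial>M)"
    by (rule prob_conditionally_independent[OF S])
  also have "\<dots> = (\<integral>\<omega>. (1 - BH.hit_prob (level u) (\<lambda>s. \<sigma>0 / a powr H * sample_path (\<lambda>t. X (a * t)) \<omega> s)) ^ n \<partial>M)"
  proof (intro Bochner_Integration.integral_cong refl arg_cong[where f="\<lambda>z. z ^ n"])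
    fix \<omega> assume \<omega>: "\<omega> \<in> space M"
    let ?f = "\<lambda>s. X (a * s) \<omega>"
    define B where "B = {y\<in>space path_space. \<forall>s\<in>D. y s \<le> u * barrier c \<beta> s - \<sigma>0 * ?f s}"
    have "{y\<in>space path_space. (sample_path X \<omega>, y) \<in> S} \<in> sets path_space"
      unfolding S_def using pX[OF \<omega>] grid by (simp add: space_pair_measure) measurable
    then have "measure input_law {y\<in>space path_space. (sample_path X \<omega>, y) \<in> S} =
       BH.prob (sample_path XH -` {y\<in>space path_space. (sample_path X \<omega>, y) \<in> S} \<inter> space N)"
      unfolding input_law_def process_law_def using BH.sample_path_meas by (simp add: measure_distr)
    also have "sample_path XH -` {y\<in>space path_space. (sample_path X \<omega>, y) \<in> S} \<inter> space N =
       {\<omega>'\<in>space N. (\<lambda>t\<in>{0..}. XH (a * t) \<omega>') \<in> B}"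
    proof -
      have drift: "c * (a * s) powr \<beta> = u * barrier c \<beta> s - u" if "s \<in> D" for s
        using that grid a ab by (auto simp: barrier_def powr_mult algebra_simps)
      have iff: "z + \<sigma>0 * w - c * (a * s) powr \<beta> \<le> u \<longleftrightarrow> z \<le> u * barrier c \<beta> s - \<sigma>0 * w" if "s \<in> D" for s z w
        unfolding drift[OF that] by linarith
      have pH: "sample_path XH \<omega>' \<in> space path_space" if "\<omega>' \<in> space N" for \<omega>'
        using that by (rule measurable_space[OF BH.sample_path_meas])
      have S': "(sample_path X \<omega>, sample_path XH \<omega>') \<in> S \<longleftrightarrow> (\<forall>s\<in>D. XH (a * s) \<omega>' \<le> u * barrier c \<beta> s - \<sigma>0 * ?f s)"
        if "\<omega>' \<in> space N" for \<omega>'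
        using pX[OF \<omega>] pH[OF that] by (simp add: S_def space_pair_measure path iff cong: ball_cong)
      have B': "(\<lambda>t\<in>{0..}. XH (a * t) \<omega>') \<in> B \<longleftrightarrow> (\<forall>s\<in>D. XH (a * s) \<omega>' \<le> u * barrier c \<beta> s - \<sigma>0 * ?f s)" for \<omega>'
        using grid by (auto simp: B_def space_PiM subset_iff)
      show ?thesis using S' B' pH by auto
    qed
    also have "BH.prob \<dots> = BH.prob {\<omega>'\<in>space N. (\<lambda>t\<in>{0..}. a powr H * XH t \<omega>') \<in> B}"
    proof (rule BH.X_scale[OF a])
      have [measurable]: "(\<lambda>y. y s) \<in> borel_measurable path_space" if "s \<in> D" for s
        using that grid by (intro measurable_component_singleton) auto
      show "B \<in> sets path_space" unfolding B_def using grid by measurable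
    qed
    also have "{\<omega>'\<in>space N. (\<lambda>t\<in>{0..}. a powr H * XH t \<omega>') \<in> B} =
       space N - {\<omega>'\<in>space N. \<exists>s\<in>D. XH s \<omega>' > level u * barrier c \<beta> s - \<sigma>0 / a powr H * sample_path (\<lambda>t. X (a * t)) \<omega> s}"
      (is "?l = ?r")
    proof -
      have "a powr H * z \<le> u * b - \<sigma>0 * w \<longleftrightarrow> \<not> (z > level u * b - \<sigma>0 / a powr H * w)" for z b w
        unfolding x[symmetric] using a by (simp add: not_less field_simps)
      moreover have "sample_path (\<lambda>t. X (a * t)) \<omega> s = X (a * s) \<omega>" if "s \<in> D" for s
        using that grid by (auto simp: sample_path_def)
      ultimately show ?thesis using grid by (auto simp: B_def space_PiM subset_iff)
    qed
    also have "BH.prob \<dots> = 1 - BH.hit_prob (level u) (\<lambda>s. \<sigma>0 / a powr H * sample_path (\<lambda>t. X (a * t)) \<omega> s)"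
      unfolding BH.hit_prob_def by (rule BH.prob_compl) (rule BH.hit_events)
    finally show "measure input_law {y\<in>space path_space. (sample_path X \<omega>, y) \<in> S} = \<dots>" .
  qed
  also have "\<dots> = (\<integral>f. (1 - BH.hit_prob (level u) (\<lambda>s. \<sigma>0 / a powr H * f s)) ^ n \<partial>process_law M (\<lambda>t. X (a * t)))"
  proof -
    have m: "sample_path (\<lambda>t. X (a * t)) \<in> measurable M path_space"
      unfolding sample_path_def using BX.X_meas a by (intro measurable_restrict) auto
    show ?thesis
      unfolding process_law_def
      by (rule integral_distr[OF m, symmetric])
         (intro borel_measurable_power borel_measurable_diff borel_measurable_const BH.measurable_hit_prob)
  qed
  also have "process_law M (\<lambda>t. X (a * t)) = process_law M (\<lambda>t \<omega>. a powr H0 * X t \<omega>)"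
    using X a by (auto simp: self_similar_gaussian_def self_similar_def)
  also have "(\<integral>f. (1 - BH.hit_prob (level u) (\<lambda>s. \<sigma>0 / a powr H * f s)) ^ n \<partial>process_law M (\<lambda>t \<omega>. a powr H0 * X t \<omega>)) =
    (\<integral>\<omega>. (1 - BH.hit_prob (level u) (\<lambda>s. \<sigma>0 / a powr H * sample_path (\<lambda>t \<omega>. a powr H0 * X t \<omega>) \<omega> s)) ^ n \<partial>M)"
  proof -
    have m: "sample_path (\<lambda>t \<omega>. a powr H0 * X t \<omega>) \<in> measurable M path_space"
      unfolding sample_path_def using BX.X_meas by (intro measurable_restrict) auto
    show ?thesis
      unfolding process_law_def
      by (rule integral_distr[OF m])
         (intro borel_measurable_power borel_measurable_diff borel_measurable_const BH.measurable_hit_prob)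
  qed
  also have "\<dots> = (\<integral>\<omega>. (1 - BH.hit_prob (level u) (\<lambda>s. amplitude u * X s \<omega>)) ^ n \<partial>M)"
  proof (intro Bochner_Integration.integral_cong refl arg_cong[where f="\<lambda>z. (1 - z) ^ n"])
    fix \<omega>
    have "\<sigma>0 / a powr H * sample_path (\<lambda>t \<omega>. a powr H0 * X t \<omega>) \<omega> s = amplitude u * X s \<omega>" if "s \<in> D" for s
      using that grid by (auto simp: sample_path_def y[symmetric])
    then show "BH.hit_prob (level u) (\<lambda>s. \<sigma>0 / a powr H * sample_path (\<lambda>t \<omega>. a powr H0 * X t \<omega>) \<omega> s) =
       BH.hit_prob (level u) (\<lambda>s. amplitude u * X s \<omega>)"
      unfolding BH.hit_prob_def by (intro arg_cong[where f=BH.prob]) auto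
  qed
  finally show ?thesis .
qed

end

section \<open>Phantom distribution functions\<close>

text \<open>The convergence along all sequences of levels is uniform convergence.\<close>

lemma phantom_df_uniform:
  assumes G: "phantom_df M \<xi> G" and e: "e > 0"
  shows "\<exists>n0. \<forall>n\<ge>n0. \<forall>u. \<bar>measure M {\<omega> \<in> space M. (MAX i\<in>{1..n}. \<xi> i \<omega>) \<le> u} - G u ^ n\<bar> < e"
proof -
  define q where "q = (\<lambda>n u. \<bar>measure M {\<omega> \<in> space M. (MAX i\<in>{1..n}. \<xi> i \<omega>) \<le> u} - G u ^ n\<bar>)"
  define u where "u = (\<lambda>n. SOME u. \<not> q n u < e)"
  have "(\<lambda>n. measure M {\<omega> \<in> space M. (MAX i\<in>{1..n}. \<xi> i \<omega>) \<le> u n} - G (u n) ^ n) \<longlonglongrightarrow> 0"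
    using G unfolding phantom_df_def by blast
  then obtain n0 where n0: "\<And>n. n \<ge> n0 \<Longrightarrow> q n (u n) < e"
    using e unfolding lim_sequentially q_def by (auto simp: dist_real_def)
  have "q n v < e" if "n \<ge> n0" for n v
    using n0[OF that] someI[of "\<lambda>u. \<not> q n u < e" v] unfolding u_def by blast
  then show ?thesis unfolding q_def by blast
qed

text \<open>The mean value theorem, and \<open>n * z * (1 - z) ^ (n - 1) \<le> 1\<close> for \<open>z = g / 2\<close>.\<close>

lemma power_close:
  fixes a g \<epsilon> :: real
  assumes a: "0 \<le> a" "a \<le> 1" and g: "0 \<le> g" "g \<le> 1" and \<epsilon>: "0 \<le> \<epsilon>" "\<epsilon> \<le> 1/2" and close: "\<bar>a - g\<bar> \<le> \<epsilon> * g"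
  shows "\<bar>(1 - a) ^ n - (1 - g) ^ n\<bar> \<le> 2 * \<epsilon>"
proof (cases n)
  case 0
  then show ?thesis using \<epsilon> by simp
next
  case (Suc k)
  define m where "m = 1 - g / 2"
  have m: "0 \<le> m" "m \<le> 1" using g by (auto simp: m_def)
  have "\<epsilon> * g \<le> 1/2 * g" using \<epsilon> g by (intro mult_right_mono)
  then have am: "1 - a \<le> m" using close unfolding m_def by linarith
  have gm: "1 - g \<le> m" using g by (simp add: m_def)
  have "(1 - a) ^ n - (1 - g) ^ n = ((1 - a) - (1 - g)) * (\<Sum>i<n. (1 - a) ^ i * (1 - g) ^ (k - i))"
    unfolding Suc by (rule power_diff_sumr2[of "1 - a" "Suc k" "1 - g", unfolded diff_Suc_Suc, simplified mult.commute[of "(1 - g) ^ _"]])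
  then have "\<bar>(1 - a) ^ n - (1 - g) ^ n\<bar> = \<bar>a - g\<bar> * \<bar>\<Sum>i<n. (1 - a) ^ i * (1 - g) ^ (k - i)\<bar>"
    by (simp add: abs_mult abs_minus_commute)
  also have "\<bar>\<Sum>i<n. (1 - a) ^ i * (1 - g) ^ (k - i)\<bar> = (\<Sum>i<n. (1 - a) ^ i * (1 - g) ^ (k - i))"
    using a g by (intro abs_of_nonneg sum_nonneg mult_nonneg_nonneg zero_le_power) auto
  also have "(\<Sum>i<n. (1 - a) ^ i * (1 - g) ^ (k - i)) \<le> (\<Sum>i<n. m ^ k)"
  proof (rule sum_mono)
    fix i assume i: "i \<in> {..<n}"
    have "(1 - a) ^ i * (1 - g) ^ (k - i) \<le> m ^ i * m ^ (k - i)"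
      using a g am gm m by (intro mult_mono power_mono) auto
    also have "\<dots> = m ^ k" using i Suc by (simp flip: power_add)
    finally show "(1 - a) ^ i * (1 - g) ^ (k - i) \<le> m ^ k" .
  qed
  also have "\<bar>a - g\<bar> * (\<Sum>i<n. m ^ k) \<le> (\<epsilon> * g) * (\<Sum>i<n. m ^ k)"
    using close m by (intro mult_right_mono sum_nonneg) auto
  also have "\<dots> = 2 * \<epsilon> * ((1 - m) * (\<Sum>i<n. m ^ k))" by (simp add: m_def)
  also have "(1 - m) * (\<Sum>i<n. m ^ k) \<le> (1 - m) * (\<Sum>i<n. m ^ i)"
    using m Suc by (intro mult_left_mono sum_mono power_decreasing) auto
  also have "(1 - m) * (\<Sum>i<n. m ^ i) = 1 - m ^ n"
    by (rule one_diff_power_eq[symmetric])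
  also have "2 * \<epsilon> * (1 - m ^ n) \<le> 2 * \<epsilon> * 1"
    using \<epsilon> m by (intro mult_left_mono) auto
  finally show ?thesis using \<epsilon> by (simp add: mult_left_mono)
qed

text \<open>
  Every distribution function \<open>F\<close> has a continuous one between \<open>F u\<close> and \<open>F (u + 1)\<close>, namely
  the smallest increasing function with Lipschitz constant 1 above it.
\<close>

lemma continuous_df_between:
  fixes F :: "real \<Rightarrow> real"
  assumes mono: "\<And>u v. u \<le> v \<Longrightarrow> F u \<le> F v" and F01: "\<And>u. 0 \<le> F u" "\<And>u. F u \<le> 1"
    and bot: "(F \<longlongrightarrow> 0) at_bot" and top: "(F \<longlongrightarrow> 1) at_top"
  obtains G \<mu> where "real_distribution \<mu>" "G = cdf \<mu>" "continuous_on UNIV G"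
    "\<And>u. F u \<le> G u" "\<And>u. G u \<le> F (u + 1)"
proof -
  define G where "G = (\<lambda>u. SUP v. F v - max 0 (v - u))"
  have bdd: "bdd_above (range (\<lambda>v. F v - max 0 (v - u)))" for u
  proof -
    have "F v - max 0 (v - u) \<le> 1" for v
      using F01(2)[of v] max.cobounded1[of 0 "v - u"] by linarith
    then show ?thesis by (intro bdd_aboveI[of _ 1]) auto
  qed
  have le: "F v - max 0 (v - u) \<le> G u" for u v
    unfolding G_def using bdd by (rule cSUP_upper[OF UNIV_I])
  have FG: "F u \<le> G u" for u using le[of u u] by simp
  have GF: "G u \<le> F (u + 1)" for u
    unfolding G_def
  proof (rule cSUP_least)
    fix v
    show "F v - max 0 (v - u) \<le> F (u + 1)"
    proof (cases "v \<le> u + 1")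
      case True
      then show ?thesis using mono[OF True] by simp
    next
      case False
      then show ?thesis using F01(2)[of v] F01(1)[of "u + 1"] by simp
    qed
  qed simp
  have lip: "G u \<le> G u' + \<bar>u - u'\<bar>" for u u'
  proof -
    have Gu: "G u = (SUP v. F v - max 0 (v - u))" by (simp add: G_def)
    show ?thesis unfolding Gu
    proof (rule cSUP_least)
      fix v
      have "F v - max 0 (v - u) \<le> F v - max 0 (v - u') + \<bar>u - u'\<bar>" by (auto simp: max_def abs_if)
      also have "\<dots> \<le> G u' + \<bar>u - u'\<bar>" using le[of v u'] by simp
      finally show "F v - max 0 (v - u) \<le> G u' + \<bar>u - u'\<bar>" .
    qed simp
  qed
  have monoG: "G u \<le> G u'" if "u \<le> u'" for u u'
    unfolding G_def
  proof (rule cSUP_mono[OF _ bdd])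
    fix v
    show "\<exists>w\<in>UNIV. F v - max 0 (v - u) \<le> F w - max 0 (w - u')"
      using that by (intro bexI[of _ v]) auto
  qed simp
  have cont: "continuous_on UNIV G"
    unfolding continuous_on_iff
  proof (intro ballI allI impI)
    fix u e :: real assume e: "e > 0"
    have "dist (G u') (G u) < e" if "dist u' u < e" for u'
      using lip[of u u'] lip[of u' u] that by (auto simp: dist_real_def abs_minus_commute)
    then show "\<exists>d>0. \<forall>u'\<in>UNIV. dist u' u < d \<longrightarrow> dist (G u') (G u) < e" using e by blast
  qed
  have top': "(G \<longlongrightarrow> 1) at_top"
  proof (rule tendsto_sandwich[OF _ _ top tendsto_const])
    show "eventually (\<lambda>u. F u \<le> G u) at_top" "eventually (\<lambda>u. G u \<le> 1) at_top"
      using FG GF F01(2) by (auto intro!: always_eventually intro: order.trans)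
  qed
  have "((\<lambda>u. F (u + 1)) \<longlongrightarrow> 0) at_bot"
  proof -
    have "filterlim (\<lambda>u::real. u + 1) at_bot at_bot"
      unfolding filterlim_at_bot eventually_at_bot_linorder
      by (intro allI, rule_tac x="Z - 1" in exI) auto
    then show ?thesis by (rule filterlim_compose[OF bot])
  qed
  then have bot': "(G \<longlongrightarrow> 0) at_bot"
  proof (rule tendsto_sandwich[OF _ _ tendsto_const, rotated 2])
    show "eventually (\<lambda>u. 0 \<le> G u) at_bot" "eventually (\<lambda>u. G u \<le> F (u + 1)) at_bot"
      using FG GF F01(1) by (auto intro!: always_eventually intro: order.trans)
  qed
  have rc: "continuous (at_right u) G" for u
    using cont by (auto simp: continuous_on_eq_continuous_within intro: continuous_within_subset)
  have rd: "real_distribution (interval_measure G)"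
    using monoG rc bot' top' by (intro real_distribution_interval_measure) auto
  have cdf: "cdf (interval_measure G) = G"
    using monoG rc bot' top' by (intro cdf_interval_measure) auto
  show thesis
    by (rule that[OF rd _ cont FG GF]) (simp add: cdf)
qed

context shared_input_queues
begin

definition cross :: "real \<Rightarrow> 'w \<Rightarrow> real" where
  "cross u \<omega> = BH.hit_prob (level u) (\<lambda>s. amplitude u * X s \<omega>)"

definition excess :: "real \<Rightarrow> 'w set" where
  "excess R = {\<omega>\<in>space M. \<exists>r\<in>D. \<bar>X r \<omega>\<bar> > R * barrier c \<beta> r}"

lemma excess_events [measurable]: "excess R \<in> BX.events"
  unfolding excess_def using grid BX.X_meas_D by measurable

lemma excess_small:
  assumes "e > 0"
  obtains R where "R > 0" "BX.prob (excess R) \<le> e"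
proof -
  have "eventually (\<lambda>n. BX.prob (excess (real n)) < e) sequentially"
    using BX.prob_not_bounded_by_barrier assms unfolding excess_def by (rule order_tendstoD)
  then obtain n where "n \<ge> 1" "BX.prob (excess (real n)) < e"
    using eventually_happens[OF eventually_conj[OF eventually_ge_at_top[of "1::nat"]]] by auto
  then show thesis by (intro that[of "real n"]) auto
qed

lemma hit_prob_sample_path:
  "BH.hit_prob x (\<lambda>s. y * (\<lambda>t\<in>{0..}. f t) s) = BH.hit_prob x (\<lambda>s. y * f s)"
proof -
  have "(\<lambda>t\<in>{0..}. f t) s = f s" if "s \<in> D" for s using that grid by auto
  then show ?thesis unfolding BH.hit_prob_def by (intro arg_cong[where f=BH.prob]) auto
qed

lemma cross_sample_path: "cross u \<omega> = BH.hit_prob (level u) (\<lambda>s. amplitude u * sample_path X \<omega> s)"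
  unfolding cross_def sample_path_def by (rule hit_prob_sample_path[symmetric])

lemma cross_meas [measurable]: "cross u \<in> borel_measurable M"
  unfolding cross_sample_path[abs_def]
  by (rule measurable_compose[OF BX.sample_path_meas BH.measurable_hit_prob])

lemma cross_01: "0 \<le> cross u \<omega>" "cross u \<omega> \<le> 1"
  by (simp_all add: cross_def BH.hit_prob_nonneg BH.hit_prob_le_1)

lemma cross_pos: "cross u \<omega> > 0"
  unfolding cross_def using s0_pos by (intro BH.hit_prob_pos[of s0]) (auto simp: time_grid_def)

definition max_df :: "nat \<Rightarrow> real \<Rightarrow> real" where
  "max_df n u = measure (completion M) (max_event n u)"

lemma max_df_eq: "n \<ge> 1 \<Longrightarrow> u > 0 \<Longrightarrow> max_df n u = (\<integral>\<omega>. (1 - cross u \<omega>) ^ n \<partial>M)"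
  unfolding max_df_def cross_def by (rule measure_max_event_eq)

lemma integrable_cross: "integrable M (\<lambda>\<omega>. (1 - cross u \<omega>) ^ n)"
  using cross_01 by (intro BX.integrable_const_bound[where B=1]) (auto intro!: AE_I2 simp: power_le_one)

lemma max_df_mono:
  assumes "n \<ge> 1" "u \<le> u'"
  shows "max_df n u \<le> max_df n u'"
proof -
  interpret C: prob_space "completion M" using BX.prob_space_axioms by (rule prob_space.prob_space_completion)
  show ?thesis
    unfolding max_df_def using max_event_sets[OF assms(1)] assms(2) by (intro C.finite_measure_mono) auto
qed

lemma max_df_nonneg: "0 \<le> max_df n u"
  by (simp add: max_df_def)

lemma max_df_tendsto_0:
  assumes u: "u > 0"
  shows "(\<lambda>n. max_df n u) \<longlonglongrightarrow> 0"
proof -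
  have "(\<lambda>n. \<integral>\<omega>. (1 - cross u \<omega>) ^ n \<partial>M) \<longlonglongrightarrow> (\<integral>\<omega>. 0 \<partial>M)"
  proof (rule integral_dominated_convergence[where w="\<lambda>_. 1"])
    show "AE \<omega> in M. (\<lambda>n. (1 - cross u \<omega>) ^ n) \<longlonglongrightarrow> 0"
      using cross_01 cross_pos by (intro AE_I2 LIMSEQ_realpow_zero) auto
    show "AE \<omega> in M. norm ((1 - cross u \<omega>) ^ n) \<le> 1" for n
      using cross_01 by (intro AE_I2) (auto simp: power_le_one)
  qed auto
  moreover have "eventually (\<lambda>n. (\<integral>\<omega>. (1 - cross u \<omega>) ^ n \<partial>M) = max_df n u) sequentially"
    using eventually_ge_at_top[of "1::nat"] by eventually_elim (simp add: max_df_eq u)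
  ultimately show ?thesis using filterlim_cong[OF refl refl] by (simp add: tendsto_cong)
qed

lemma exponent_pos: "1 - H / \<beta> > 0"
  using BH.\<beta> BH.\<beta>_pos by simp

lemma level_at_top: "filterlim level at_top at_top"
proof -
  have "filterlim (\<lambda>u. exp ((1 - H / \<beta>) * ln u)) at_top at_top"
    by (intro filterlim_compose[OF exp_at_top] filterlim_tendsto_pos_mult_at_top[OF tendsto_const exponent_pos] ln_at_top)
  moreover have "eventually (\<lambda>u. exp ((1 - H / \<beta>) * ln u) = level u) at_top"
    using eventually_gt_at_top[of 0] by eventually_elim (simp add: level_def powr_def)
  ultimately show ?thesis by (simp add: filterlim_cong[OF refl refl])
qed

lemma level_times_amplitude:
  assumes "u > 0"
  shows "level u * amplitude u = \<sigma>0 * u powr (1 + (H0 - 2 * H) / \<beta>)"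
proof -
  have e: "(1 - H / \<beta>) + (H0 - H) / \<beta> = 1 + (H0 - 2 * H) / \<beta>"
    by (simp add: diff_divide_distrib)
  show ?thesis
    unfolding e[symmetric] powr_add by (simp add: level_def amplitude_def)
qed

lemma amplitude_eq:
  assumes "u > 0"
  shows "amplitude u = \<sigma>0 * u powr (H0 / \<beta> - 1) * level u"
proof -
  have e: "(H0 - H) / \<beta> = (H0 / \<beta> - 1) + (1 - H / \<beta>)" by (simp add: diff_divide_distrib)
  show ?thesis
    unfolding level_def amplitude_def e powr_add by simp
qed

lemma amplitude_nonneg: "amplitude u \<ge> 0"
  using \<sigma>0 by (simp add: amplitude_def)

lemma level_nonneg: "level u \<ge> 0"
  by (simp add: level_def)

lemma amplitude_small:
  assumes e: "e > 0"
  shows "eventually (\<lambda>u. amplitude u \<le> e * level u) at_top"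
proof -
  have "((\<lambda>u. u powr (H0 / \<beta> - 1)) \<longlongrightarrow> 0) at_top"
    using BX.\<beta> BX.\<beta>_pos by (intro tendsto_neg_powr filterlim_ident) auto
  then have "((\<lambda>u. \<sigma>0 * u powr (H0 / \<beta> - 1)) \<longlongrightarrow> 0) at_top" by (rule tendsto_mult_right_zero)
  then have "eventually (\<lambda>u. \<sigma>0 * u powr (H0 / \<beta> - 1) < e) at_top"
    using e by (rule order_tendstoD)
  then show ?thesis using eventually_gt_at_top[of 0]
  proof eventually_elim
    case (elim u)
    then have "\<sigma>0 * u powr (H0 / \<beta> - 1) * level u \<le> e * level u"
      using level_nonneg by (intro mult_right_mono) auto
    then show ?case using elim amplitude_eq by simp
  qed
qed

lemma scaled_path_bound:
  assumes "\<omega> \<in> space M - excess R" "r \<in> D" "y \<ge> 0" 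
  shows "\<bar>y * X r \<omega>\<bar> \<le> y * R * barrier c \<beta> r"
proof -
  have "\<bar>X r \<omega>\<bar> \<le> R * barrier c \<beta> r" using assms by (auto simp: excess_def not_less)
  then have "y * \<bar>X r \<omega>\<bar> \<le> y * (R * barrier c \<beta> r)" using assms by (intro mult_left_mono)
  then show ?thesis using assms by (simp add: abs_mult mult.assoc)
qed

text \<open>
  If \<open>G\<close> were a phantom distribution function, then \<open>max_df (2 * n) u\<close> would be close to
  \<open>(max_df n u)\<^sup>2\<close>, so that the random variable \<open>(1 - cross u) ^ n\<close> would have a small variance,
  uniformly in \<open>u\<close>. But it changes by a fixed amount when \<open>X\<close> is shifted in a suitable direction,
  and the law of the shifted process is absolutely continuous with respect to that of \<open>X\<close>.
\<close>

theorem no_phantom_df: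
  assumes large: "\<beta> \<ge> 2 * H - H0"
  shows "\<not> phantom_df (completion M) (sup_with_drift Xs X \<sigma>0 c \<beta>) G"
proof
  assume G: "phantom_df (completion M) (sup_with_drift Xs X \<sigma>0 c \<beta>) G"
  obtain \<mu> where \<mu>: "real_distribution \<mu>" "G = cdf \<mu>" using G unfolding phantom_df_def by blast
  interpret \<mu>: real_distribution \<mu> by fact
  have G01: "0 \<le> G u" "G u \<le> 1" for u
    using \<mu>.cdf_nonneg \<mu>.cdf_bounded_prob by (auto simp: \<mu>)
  define v where "v = s0 powr (2 * H0)"
  have v: "v > 0" using s0_pos by (simp add: v_def)
  define r where "r = (\<lambda>s. BX.expectation (\<lambda>\<omega>. X s \<omega> * X s0 \<omega>))"
  obtain \<eta> where \<eta>: "\<eta> > 0" "\<And>s. s \<in> D \<Longrightarrow> \<bar>s - s0\<bar> < \<eta> \<Longrightarrow> r s \<in> {v / 2..2 * v}"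
    using BX.covariance_near[OF s0_pos] unfolding r_def v_def by blast
  obtain q \<epsilon> where q: "q > 0" and \<epsilon>: "\<epsilon> > 0" and doubling:
    "eventually (\<lambda>x. \<forall>y g h. 0 \<le> y \<and> \<sigma>0 \<le> x * y \<and> y \<le> \<epsilon> * x \<and>
      (\<forall>s\<in>D. \<bar>g s\<bar> \<le> \<epsilon> * x * barrier c \<beta> s) \<and> (\<forall>s\<in>D. \<bar>s - s0\<bar> < \<eta> \<longrightarrow> y * q \<le> h s) \<longrightarrow>
      2 * BH.hit_prob x g \<le> BH.hit_prob x (\<lambda>s. g s + h s)) at_top"
    using BH.hit_prob_doubling[OF \<eta>(1) \<sigma>0] by blast
  define \<theta> where "\<theta> = 2 * q / v"
  have \<theta>: "\<theta> > 0" using q v by (simp add: \<theta>_def)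
  obtain R where R: "R > 0" "BX.prob (excess R) \<le> 1/4" using excess_small[of "1/4"] by auto
  obtain d0 where d0: "d0 > 0" and shift: "\<And>A. A \<in> sets path_space \<Longrightarrow> BX.prob {\<omega>\<in>space M. (\<lambda>t\<in>{0..}. X t \<omega>) \<in> A} \<le> d0 \<Longrightarrow>
    BX.prob {\<omega>\<in>space M. (\<lambda>t\<in>{0..}. X t \<omega> + \<theta> * r t) \<in> A} \<le> 1/8"
    using BX.prob_shifted_path_small[OF s0_pos, of "1/8" \<theta>] unfolding r_def by auto
  define \<delta> where "\<delta> = (1/32)\<^sup>2 * min (1/8) d0"
  have \<delta>: "\<delta> > 0" using d0 by (simp add: \<delta>_def)
  obtain n0 where n0: "\<And>n u. n \<ge> n0 \<Longrightarrow> \<bar>max_df n u - G u ^ n\<bar> < \<delta> / 3"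
    using phantom_df_uniform[OF G, of "\<delta> / 3"] \<delta> unfolding max_df_def by auto
  define k where "k = max 1 n0"
  have k: "k \<ge> 1" "k \<ge> n0" by (auto simp: k_def)
  have ev: "eventually (\<lambda>u. BH.hit_prob (level u / 2) (\<lambda>_. 0) \<le> 1 / (4 * real k)) at_top"
  proof -
    have "filterlim (\<lambda>u. (1/2) * level u) at_top at_top"
      by (rule filterlim_tendsto_pos_mult_at_top[OF tendsto_const _ level_at_top]) simp
    then have "filterlim (\<lambda>u. level u / 2) at_top at_top" by simp
    moreover have "eventually (\<lambda>x. BH.hit_prob x (\<lambda>_. 0) \<le> 1 / (4 * real k)) at_top"
      using k by (intro BH.hit_prob_tendsto_0) simp
    ultimately show ?thesis by (rule eventually_compose_filterlim[rotated])
  qed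
  have "eventually (\<lambda>u. u \<ge> 1 \<and> amplitude u \<le> \<epsilon> * level u \<and> amplitude u \<le> \<epsilon> / R * level u \<and>
      amplitude u \<le> 1 / (2 * R) * level u \<and> BH.hit_prob (level u / 2) (\<lambda>_. 0) \<le> 1 / (4 * real k) \<and>
     (\<forall>y g h. 0 \<le> y \<and> \<sigma>0 \<le> level u * y \<and> y \<le> \<epsilon> * level u \<and>
      (\<forall>s\<in>D. \<bar>g s\<bar> \<le> \<epsilon> * level u * barrier c \<beta> s) \<and> (\<forall>s\<in>D. \<bar>s - s0\<bar> < \<eta> \<longrightarrow> y * q \<le> h s) \<longrightarrow>
      2 * BH.hit_prob (level u) g \<le> BH.hit_prob (level u) (\<lambda>s. g s + h s))) at_top"
    using eventually_ge_at_top[of 1] amplitude_small[OF \<epsilon>] amplitude_small[of "\<epsilon> / R"] amplitude_small[of "1 / (2 * R)"]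
      ev eventually_compose_filterlim[OF doubling level_at_top] R \<epsilon>
    by (intro eventually_conj) auto
  then obtain u where u: "u \<ge> 1" and amp: "amplitude u \<le> \<epsilon> * level u" "amplitude u \<le> \<epsilon> / R * level u"
      "amplitude u \<le> 1 / (2 * R) * level u" and small: "BH.hit_prob (level u / 2) (\<lambda>_. 0) \<le> 1 / (4 * real k)" and
     dbl: "\<And>y g h. 0 \<le> y \<Longrightarrow> \<sigma>0 \<le> level u * y \<Longrightarrow> y \<le> \<epsilon> * level u \<Longrightarrow>
      (\<forall>s\<in>D. \<bar>g s\<bar> \<le> \<epsilon> * level u * barrier c \<beta> s) \<Longrightarrow> (\<forall>s\<in>D. \<bar>s - s0\<bar> < \<eta> \<longrightarrow> y * q \<le> h s) \<Longrightarrow>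
      2 * BH.hit_prob (level u) g \<le> BH.hit_prob (level u) (\<lambda>s. g s + h s)"
    using eventually_happens by (smt (verit, best) trivial_limit_at_top_linorder)
  have u0: "u > 0" using u by simp
  have amp0: "amplitude u \<ge> 0" by (rule amplitude_nonneg)
  have ampR: "amplitude u * R \<le> \<epsilon> * level u" "amplitude u * R \<le> level u / 2"
    using amp(2,3) R by (simp_all add: field_simps)
  have lev: "\<sigma>0 \<le> level u * amplitude u"
  proof -
    have "1 + (H0 - 2 * H) / \<beta> \<ge> 0" using large BH.\<beta>_pos by (simp add: field_simps)
    then have "1 \<le> u powr (1 + (H0 - 2 * H) / \<beta>)" using u by (simp add: ge_one_powr_ge_zero)
    then show ?thesis using \<sigma>0 u0 by (simp add: level_times_amplitude)
  qed
  have shifted: "2 * cross u \<omega> \<le> BH.hit_prob (level u) (\<lambda>s. amplitude u * (X s \<omega> + \<theta> * r s))"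
    if \<omega>: "\<omega> \<in> space M - excess R" for \<omega>
  proof -
    have "2 * BH.hit_prob (level u) (\<lambda>s. amplitude u * X s \<omega>) \<le>
       BH.hit_prob (level u) (\<lambda>s. amplitude u * X s \<omega> + amplitude u * (\<theta> * r s))"
    proof (rule dbl[OF amp0 lev amp(1)])
      show "\<forall>s\<in>D. \<bar>amplitude u * X s \<omega>\<bar> \<le> \<epsilon> * level u * barrier c \<beta> s"
      proof
        fix s assume s: "s \<in> D"
        have "\<bar>amplitude u * X s \<omega>\<bar> \<le> amplitude u * R * barrier c \<beta> s"
          by (rule scaled_path_bound[OF \<omega> s amp0])
        also have "\<dots> \<le> \<epsilon> * level u * barrier c \<beta> s"
          using ampR(1) BH.barrier_pos[of s] by (intro mult_right_mono) auto
        finally show "\<bar>amplitude u * X s \<omega>\<bar> \<le> \<epsilon> * level u * barrier c \<beta> s" .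
      qed
      show "\<forall>s\<in>D. \<bar>s - s0\<bar> < \<eta> \<longrightarrow> amplitude u * q \<le> amplitude u * (\<theta> * r s)"
      proof (intro ballI impI)
        fix s assume "s \<in> D" "\<bar>s - s0\<bar> < \<eta>"
        then have "\<theta> * (v / 2) \<le> \<theta> * r s" using \<eta>(2)[of s] \<theta> by (intro mult_left_mono) auto
        then have "q \<le> \<theta> * r s" using v by (simp add: \<theta>_def)
        then show "amplitude u * q \<le> amplitude u * (\<theta> * r s)" using amp0 by (rule mult_left_mono)
      qed
    qed
    then show ?thesis by (simp add: cross_def distrib_left)
  qed
  have pk: "max_df k u > 1/2"
  proof -
    have "(3/4 :: real) * (3/4) \<le> (\<integral>\<omega>. 3/4 * indicator (space M - excess R) \<omega> \<partial>M)"
      using BX.prob_compl[OF excess_events, of R] R by simp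
    also have "\<dots> \<le> (\<integral>\<omega>. (1 - cross u \<omega>) ^ k \<partial>M)"
    proof (rule integral_mono[OF _ integrable_cross])
      show "integrable M (\<lambda>\<omega>. 3/4 * indicator (space M - excess R) \<omega> :: real)"
        by (intro integrable_mult_right integrable_real_indicator) (auto simp: BX.emeasure_eq_measure)
      fix \<omega> assume \<omega>: "\<omega> \<in> space M"
      show "3/4 * indicator (space M - excess R) \<omega> \<le> (1 - cross u \<omega>) ^ k"
      proof (cases "\<omega> \<in> excess R")
        case False
        have "cross u \<omega> \<le> BH.hit_prob (level u - amplitude u * R) (\<lambda>_. 0)"
          unfolding cross_def using \<omega> False amp0 by (intro BH.hit_prob_bounds scaled_path_bound) auto
        also have "\<dots> \<le> BH.hit_prob (level u / 2) (\<lambda>_. 0)"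
          using ampR by (intro BH.hit_prob_antimono) simp
        also have "\<dots> \<le> 1 / (4 * real k)" by (rule small)
        finally have "cross u \<omega> \<le> 1 / (4 * real k)" .
        then have "real k * cross u \<omega> \<le> 1/4" using k by (simp add: field_simps)
        moreover have "1 + real k * (- cross u \<omega>) \<le> (1 + - cross u \<omega>) ^ k"
          using cross_01 by (intro Bernoulli_inequality) auto
        ultimately show ?thesis using False \<omega> by simp
      qed (use cross_01 in simp)
    qed
    finally show ?thesis using k u0 by (simp add: max_df_eq)
  qed
  \<comment> \<open>Stopping when the probability falls below \<open>1/2\<close> keeps it above \<open>1/4\<close>, by Jensen's inequality.\<close>
  define n where "n = (LEAST n. n \<ge> 1 \<and> max_df n u \<le> 1/2)"
  have "eventually (\<lambda>n. max_df n u < 1/2) sequentially"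
    using max_df_tendsto_0[OF u0] by (rule order_tendstoD) simp
  then obtain n' where "n' \<ge> 1" "max_df n' u < 1/2"
    using eventually_happens[OF eventually_conj[OF eventually_ge_at_top[of "1::nat"]]] by auto
  then have n: "n \<ge> 1" "max_df n u \<le> 1/2"
    using LeastI[of "\<lambda>n. n \<ge> 1 \<and> max_df n u \<le> 1/2" n'] unfolding n_def by auto
  have n_min: "max_df m u > 1/2" if "m \<ge> 1" "m < n" for m
    using not_less_Least[of m "\<lambda>n. n \<ge> 1 \<and> max_df n u \<le> 1/2"] that unfolding n_def by auto
  have dec: "max_df m u \<ge> max_df m' u" if "m \<le> m'" "m \<ge> 1" for m m'
    unfolding max_df_eq[OF that(2) u0] max_df_eq[OF order.trans[OF that(2,1)] u0]
    using that cross_01 by (intro integral_mono integrable_cross power_decreasing) auto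
  have kn: "k < n"
  proof (rule ccontr)
    assume "\<not> k < n"
    then have "max_df k u \<le> max_df n u" using n by (intro dec) auto
    then show False using n pk by simp
  qed
  define p where "p = max_df n u"
  have var: "BX.variance (\<lambda>\<omega>. (1 - cross u \<omega>) ^ m) = max_df (2 * m) u - (max_df m u)\<^sup>2" if "m \<ge> 1" for m
  proof -
    have sq: "((1 - cross u \<omega>) ^ m)\<^sup>2 = (1 - cross u \<omega>) ^ (2 * m)" for \<omega> by (simp add: power_mult power2_eq_square power_mult_distrib mult.commute)
    have "BX.variance (\<lambda>\<omega>. (1 - cross u \<omega>) ^ m) =
       BX.expectation (\<lambda>\<omega>. ((1 - cross u \<omega>) ^ m)\<^sup>2) - (BX.expectation (\<lambda>\<omega>. (1 - cross u \<omega>) ^ m))\<^sup>2"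
      by (intro BX.variance_eq integrable_cross) (simp only: sq integrable_cross)
    then show ?thesis using that u0 by (simp only: sq) (simp add: max_df_eq)
  qed
  have p: "1/4 < p" "p \<le> 1/2"
  proof -
    have n1: "n - 1 \<ge> 1" "n - 1 < n" using kn k by auto
    have "(1/2)\<^sup>2 < (max_df (n - 1) u)\<^sup>2" using n_min[OF n1] by (intro power_strict_mono) auto
    also have "\<dots> \<le> max_df (2 * (n - 1)) u"
      using var[OF n1(1)] BX.variance_positive[of "\<lambda>\<omega>. (1 - cross u \<omega>) ^ (n - 1)"] by linarith
    also have "\<dots> \<le> max_df n u" using n1 n by (intro dec) auto
    finally show "1/4 < p" by (simp add: p_def power2_eq_square)
    show "p \<le> 1/2" using n by (simp add: p_def)
  qed
  have small_var: "BX.variance (\<lambda>\<omega>. (1 - cross u \<omega>) ^ n) \<le> \<delta>"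
  proof -
    have 1: "\<bar>p - G u ^ n\<bar> < \<delta> / 3" unfolding p_def using kn k by (intro n0) auto
    have 2: "\<bar>max_df (2 * n) u - G u ^ (2 * n)\<bar> < \<delta> / 3" using kn k by (intro n0) auto
    have g: "0 \<le> G u ^ n" "G u ^ n \<le> 1" using G01 by (auto simp: power_le_one)
    have "G u ^ (2 * n) - p\<^sup>2 = (G u ^ n - p) * (G u ^ n + p)"
      by (simp add: power_mult power2_eq_square algebra_simps flip: power_mult_distrib)
    also have "\<dots> \<le> \<bar>G u ^ n - p\<bar> * 2"
    proof -
      have "(G u ^ n - p) * (G u ^ n + p) \<le> \<bar>G u ^ n - p\<bar> * (G u ^ n + p)"
        using g p by (intro mult_right_mono) auto
      also have "\<dots> \<le> \<bar>G u ^ n - p\<bar> * 2" using g p by (intro mult_left_mono) auto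
      finally show ?thesis .
    qed
    finally have "G u ^ (2 * n) - p\<^sup>2 \<le> 2 * (\<delta> / 3)" using 1 by (simp add: abs_minus_commute)
    then show ?thesis using 2 unfolding var[OF n(1)] p_def[symmetric] abs_diff_less_iff by linarith
  qed
  define A where "A = {y\<in>space path_space. 1/32 \<le> \<bar>(1 - BH.hit_prob (level u) (\<lambda>s. amplitude u * y s)) ^ n - p\<bar>}"
  have A: "A \<in> sets path_space"
  proof -
    have [measurable]: "(\<lambda>y. BH.hit_prob (level u) (\<lambda>s. amplitude u * y s)) \<in> borel_measurable path_space"
      by (rule BH.measurable_hit_prob)
    show ?thesis unfolding A_def by measurable
  qed
  have XA: "{\<omega>\<in>space M. (\<lambda>t\<in>{0..}. X t \<omega> + z t) \<in> A} =
      {\<omega>\<in>space M. 1/32 \<le> \<bar>(1 - BH.hit_prob (level u) (\<lambda>s. amplitude u * (X s \<omega> + z s))) ^ n - p\<bar>}" for z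
    unfolding A_def using hit_prob_sample_path[of "level u" "amplitude u" "\<lambda>s. X s _ + z s"] by (auto simp: space_PiM)
  have XA0: "{\<omega>\<in>space M. (\<lambda>t\<in>{0..}. X t \<omega>) \<in> A} = {\<omega>\<in>space M. 1/32 \<le> \<bar>(1 - cross u \<omega>) ^ n - p\<bar>}"
    using XA[of "\<lambda>_. 0"] by (simp add: cross_def)
  have cheb: "BX.prob {\<omega>\<in>space M. 1/32 \<le> \<bar>(1 - cross u \<omega>) ^ n - p\<bar>} \<le> min (1/8) d0"
  proof -
    have sq: "((1 - cross u \<omega>) ^ n)\<^sup>2 = (1 - cross u \<omega>) ^ (n * 2)" for \<omega> by (simp add: power_mult)
    have "BX.prob {\<omega>\<in>space M. 1/32 \<le> \<bar>(1 - cross u \<omega>) ^ n - BX.expectation (\<lambda>\<omega>. (1 - cross u \<omega>) ^ n)\<bar>}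
       \<le> BX.variance (\<lambda>\<omega>. (1 - cross u \<omega>) ^ n) / (1/32)\<^sup>2"
      by (rule BX.Chebyshev_inequality) (auto simp only: sq integrable_cross, auto)
    also have "\<dots> \<le> \<delta> / (1/32)\<^sup>2" using small_var by (intro divide_right_mono) auto
    also have "\<dots> = min (1/8) d0" by (simp add: \<delta>_def)
    finally show ?thesis using n u0 by (simp add: p_def max_df_eq)
  qed
  let ?B1 = "{\<omega>\<in>space M. (\<lambda>t\<in>{0..}. X t \<omega>) \<in> A}" and ?B2 = "{\<omega>\<in>space M. (\<lambda>t\<in>{0..}. X t \<omega> + \<theta> * r t) \<in> A}"
  have B: "?B1 \<in> BX.events" "?B2 \<in> BX.events"
    by (rule BX.path_events[OF A], rule BX.shifted_path_events[OF A])
  have "BX.prob ?B1 \<le> 1/8" "BX.prob ?B1 \<le> d0" using cheb unfolding XA0 by auto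
  moreover from this(2) have "BX.prob ?B2 \<le> 1/8" by (rule shift[OF A])
  moreover have "BX.prob (excess R \<union> (?B1 \<union> ?B2)) \<le> BX.prob (excess R) + (BX.prob ?B1 + BX.prob ?B2)"
    using B by (intro order.trans[OF measure_Un_le] add_left_mono measure_Un_le) auto
  ultimately have "BX.prob (excess R \<union> (?B1 \<union> ?B2)) < 1" using R by linarith
  then have "excess R \<union> (?B1 \<union> ?B2) \<noteq> space M" using BX.prob_space by force
  moreover have "excess R \<union> (?B1 \<union> ?B2) \<subseteq> space M" by (auto simp: excess_def)
  ultimately obtain \<omega> where \<omega>: "\<omega> \<in> space M" "\<omega> \<notin> excess R" "\<omega> \<notin> ?B1" "\<omega> \<notin> ?B2" by blast
  define a a' where "a = cross u \<omega>" and "a' = BH.hit_prob (level u) (\<lambda>s. amplitude u * (X s \<omega> + \<theta> * r s))"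
  have aa: "2 * a \<le> a'" "0 \<le> a" "a' \<le> 1"
    using shifted[of \<omega>] \<omega> cross_01 BH.hit_prob_le_1 by (auto simp: a_def a'_def)
  have 1: "\<bar>(1 - a) ^ n - p\<bar> < 1/32" using \<omega> unfolding XA0 by (auto simp: a_def)
  have 2: "\<bar>(1 - a') ^ n - p\<bar> < 1/32" using \<omega> unfolding XA[of "\<lambda>t. \<theta> * r t"] by (auto simp: a'_def)
  have "(1 - a)\<^sup>2 = 1 - 2 * a + a\<^sup>2" by (simp add: power2_diff)
  then have "1 - a' \<le> (1 - a)\<^sup>2" using aa zero_le_power2[of a] by linarith
  then have "(1 - a') ^ n \<le> ((1 - a)\<^sup>2) ^ n" using aa by (intro power_mono) auto
  also have "\<dots> = ((1 - a) ^ n)\<^sup>2" by (simp add: mult.commute flip: power_mult)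
  also have "\<dots> \<le> (p + 1/32)\<^sup>2" 
  proof (rule power_mono)
    show "(1 - a) ^ n \<le> p + 1/32" using 1 unfolding abs_diff_less_iff by linarith
    show "0 \<le> (1 - a) ^ n" using aa by simp
  qed
  finally have "p - 1/32 \<le> (p + 1/32)\<^sup>2" using 2 by linarith
  moreover have "(p + 1/32) * (p + 1/32) \<le> (1/2 + 1/32) * (p + 1/32)" using p by (intro mult_right_mono) auto
  ultimately have "p - 1/32 \<le> (1/2 + 1/32) * (p + 1/32)" unfolding power2_eq_square by linarith
  then show False using p by (simp add: algebra_simps)
qed

text \<open>
  For \<open>u > 0\<close> this is the distribution function of \<open>sup (XH t - c * t powr \<beta>)\<close>, by self-similarity;
  the value 0 elsewhere only ensures the limit at \<open>- \<infinity>\<close>.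
\<close>

definition base_df :: "real \<Rightarrow> real" where
  "base_df u = (if u \<le> 0 then 0 else 1 - BH.hit_prob (level u) (\<lambda>_. 0))"

lemma level_mono: "0 \<le> u \<Longrightarrow> u \<le> u' \<Longrightarrow> level u \<le> level u'"
  unfolding level_def using exponent_pos by (intro powr_mono2) auto

lemma base_df_mono: "u \<le> u' \<Longrightarrow> base_df u \<le> base_df u'"
  unfolding base_df_def using BH.hit_prob_le_1 level_mono[of u u'] by (auto intro!: BH.hit_prob_antimono)

lemma base_df_limits: "(base_df \<longlongrightarrow> 0) at_bot" "(base_df \<longlongrightarrow> 1) at_top"
proof -
  have "eventually (\<lambda>u. base_df u = 0) at_bot"
    using eventually_le_at_bot[of 0] by eventually_elim (simp add: base_df_def)
  then show "(base_df \<longlongrightarrow> 0) at_bot" by (rule tendsto_eventually)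
  show "(base_df \<longlongrightarrow> 1) at_top"
  proof (rule tendstoI)
    fix e :: real assume "e > 0"
    then have "eventually (\<lambda>x. BH.hit_prob x (\<lambda>_. 0) \<le> e / 2) at_top" by (intro BH.hit_prob_tendsto_0) simp
    from eventually_compose_filterlim[OF this level_at_top] eventually_gt_at_top[of 0]
    show "eventually (\<lambda>u. dist (base_df u) 1 < e) at_top"
      by eventually_elim (use \<open>e > 0\<close> BH.hit_prob_nonneg in \<open>auto simp: base_df_def dist_real_def\<close>)
  qed
qed

lemma level_increment: "u \<ge> 1 \<Longrightarrow> level u * (level (u + 1) - level u) \<le> u powr (1 - 2 * H / \<beta>)"
proof -
  assume u: "u \<ge> 1"
  define \<gamma> where "\<gamma> = 1 - H / \<beta>"
  have \<gamma>: "0 < \<gamma>" "\<gamma> \<le> 1" using exponent_pos H BH.\<beta>_pos by (auto simp: \<gamma>_def)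
  have "level (u + 1) = u powr \<gamma> * (1 + 1 / u) powr \<gamma>"
  proof -
    have "u + 1 = u * (1 + 1 / u)" using u by (simp add: field_simps)
    then show ?thesis using u by (simp add: level_def \<gamma>_def powr_mult)
  qed
  also have "(1 + 1 / u) powr \<gamma> \<le> (1 + 1 / u) powr 1" using u \<gamma> by (intro powr_mono) auto
  also have "u powr \<gamma> * (1 + 1 / u) powr 1 = level u + level u / u"
    using u by (simp add: level_def \<gamma>_def algebra_simps)
  finally have "level (u + 1) - level u \<le> level u / u" using u by (simp add: mult_left_mono)
  then have "level u * (level (u + 1) - level u) \<le> level u * (level u / u)"
    using level_nonneg by (intro mult_left_mono)
  also have "\<dots> = u powr \<gamma> * (u powr \<gamma> * u powr (- 1))"
    using u by (simp add: level_def \<gamma>_def powr_minus divide_inverse)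
  also have "\<dots> = u powr (1 - 2 * H / \<beta>)"
  proof -
    have "\<gamma> + (\<gamma> + - 1) = 1 - 2 * H / \<beta>" by (simp add: \<gamma>_def)
    then show ?thesis by (simp only: powr_add[symmetric])
  qed
  finally show ?thesis .
qed

text \<open>
  On the event that \<open>X\<close> is at most \<open>R\<close> times the barrier, the common input changes the level by
  at most \<open>amplitude u * R\<close>, which is too little to be felt by the tail.
\<close>

lemma cross_close:
  assumes small: "\<beta> < 2 * H - H0" and \<epsilon>: "\<epsilon> > 0" "\<epsilon> \<le> 1/2" and R: "R > 0"
    and G: "\<And>u. base_df u \<le> G u" "\<And>u. G u \<le> base_df (u + 1)"
  shows "eventually (\<lambda>u. \<forall>\<omega>\<in>space M - excess R. \<bar>cross u \<omega> - (1 - G u)\<bar> \<le> \<epsilon> * (1 - G u)) at_top"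
proof -
  define \<kappa> where "\<kappa> = \<epsilon> / 2"
  have \<kappa>: "\<kappa> > 0" "\<kappa> \<le> 1/2" using \<epsilon> by (auto simp: \<kappa>_def)
  let ?T = "\<lambda>x. BH.hit_prob x (\<lambda>_. 0)"
  obtain h where h: "h > 0" and "eventually (\<lambda>x. \<forall>d\<ge>0. x * d \<le> h \<longrightarrow> (1 - \<kappa>) * ?T x \<le> ?T (x + d)) at_top"
    using BH.hit_prob_long_tailed[OF \<kappa>(1)] by blast
  then obtain x1 where x1: "\<And>x d. x \<ge> x1 \<Longrightarrow> d \<ge> 0 \<Longrightarrow> x * d \<le> h \<Longrightarrow> (1 - \<kappa>) * ?T x \<le> ?T (x + d)"
    unfolding eventually_at_top_linorder by blast
  have "((\<lambda>u. \<sigma>0 * R * u powr (1 + (H0 - 2 * H) / \<beta>)) \<longlongrightarrow> 0) at_top"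
    using small BH.\<beta>_pos by (intro tendsto_mult_right_zero tendsto_neg_powr filterlim_ident) (simp add: field_simps)
  then have e1: "eventually (\<lambda>u. \<sigma>0 * R * u powr (1 + (H0 - 2 * H) / \<beta>) < h / 2) at_top"
    using h by (intro order_tendstoD) auto
  have "((\<lambda>u. u powr (1 - 2 * H / \<beta>)) \<longlongrightarrow> 0) at_top"
    using small BH.\<beta>_pos H0 by (intro tendsto_neg_powr filterlim_ident) (simp add: field_simps)
  then have e2: "eventually (\<lambda>u. u powr (1 - 2 * H / \<beta>) < h / 2) at_top"
    using h by (intro order_tendstoD) auto
  have e3: "eventually (\<lambda>u. level u \<ge> max (max 1 h) (2 * x1)) at_top"
    using level_at_top unfolding filterlim_at_top by blast
  from e1 e2 e3 eventually_ge_at_top[of "1::real"] show ?thesis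
  proof eventually_elim
    case (elim u)
    define x where "x = level u"
    define d where "d = max (amplitude u * R) (level (u + 1) - x)"
    have u: "u \<ge> 1" "u > 0" using elim by auto
    have x: "x \<ge> 1" "x \<ge> h" "x \<ge> 2 * x1" using elim by (auto simp: x_def)
    have d0: "d \<ge> 0" using amplitude_nonneg[of u] R by (simp add: d_def le_max_iff_disj)
    have "x * (amplitude u * R) \<le> h / 2"
      using level_times_amplitude[OF u(2)] elim(1) by (simp add: x_def mult_ac)
    moreover have "x * (level (u + 1) - x) \<le> h / 2"
      using level_increment[OF u(1)] elim(2) by (simp add: x_def)
    ultimately have xd: "x * d \<le> h / 2" by (simp add: d_def max_def)
    have dx: "d \<le> x / 2"
    proof -
      have "x * d \<le> x * (x / 2)"
      proof -
        have "h * 1 \<le> x * x" using x h by (intro mult_mono) auto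
        then show ?thesis using xd by simp
      qed
      then show ?thesis using x by simp
    qed
    have "(x - d) * (2 * d) \<le> x * (2 * d)" using d0 by (intro mult_right_mono) auto
    then have "(1 - \<kappa>) * ?T (x - d) \<le> ?T ((x - d) + 2 * d)"
      using xd dx x d0 by (intro x1) auto
    then have tail: "(1 - \<kappa>) * ?T (x - d) \<le> ?T (x + d)" by (simp add: algebra_simps)
    have "1 - G u \<le> ?T x" "?T (level (u + 1)) \<le> 1 - G u"
      using G[of u] u by (auto simp: base_df_def x_def)
    moreover have "?T x \<le> ?T (x - d)" "?T (x + d) \<le> ?T (level (u + 1))"
      using d0 by (auto intro!: BH.hit_prob_antimono simp: d_def)
    ultimately have g: "?T (x + d) \<le> 1 - G u" "1 - G u \<le> ?T (x - d)" by linarith+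
    have T0: "?T (x - d) \<ge> 0" by (rule BH.hit_prob_nonneg)
    have "\<kappa> * ?T (x - d) \<le> 1/2 * ?T (x - d)" using \<kappa> T0 by (intro mult_right_mono) auto
    then have "?T (x - d) \<le> 2 * (1 - G u)" using g(1) tail by (simp add: left_diff_distrib)
    then have "\<kappa> * ?T (x - d) \<le> \<kappa> * (2 * (1 - G u))" using \<kappa> by (intro mult_left_mono) auto
    also have "\<kappa> * (2 * (1 - G u)) = \<epsilon> * (1 - G u)" by (simp add: \<kappa>_def)
    finally have \<kappa>T: "\<kappa> * ?T (x - d) \<le> \<epsilon> * (1 - G u)" .
    show ?case
    proof
      fix \<omega> assume \<omega>: "\<omega> \<in> space M - excess R"
      have bd: "\<bar>amplitude u * X s \<omega>\<bar> \<le> amplitude u * R * barrier c \<beta> s" if "s \<in> D" for s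
        by (rule scaled_path_bound[OF \<omega> that amplitude_nonneg])
      have "?T (x + amplitude u * R) \<le> cross u \<omega>" "cross u \<omega> \<le> ?T (x - amplitude u * R)"
        unfolding cross_def x_def using bd by (intro BH.hit_prob_bounds; simp)+
      moreover have "?T (x + d) \<le> ?T (x + amplitude u * R)" "?T (x - amplitude u * R) \<le> ?T (x - d)"
        by (auto intro!: BH.hit_prob_antimono simp: d_def)
      ultimately have "?T (x + d) \<le> cross u \<omega>" "cross u \<omega> \<le> ?T (x - d)" by linarith+
      then have "\<bar>cross u \<omega> - (1 - G u)\<bar> \<le> ?T (x - d) - ?T (x + d)" using g by linarith
      also have "\<dots> \<le> \<kappa> * ?T (x - d)" using tail by (simp add: left_diff_distrib)
      also have "\<dots> \<le> \<epsilon> * (1 - G u)" by (rule \<kappa>T)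
      finally show "\<bar>cross u \<omega> - (1 - G u)\<bar> \<le> \<epsilon> * (1 - G u)" .
    qed
  qed
qed

theorem continuous_phantom_df:
  assumes small: "\<beta> < 2 * H - H0"
  shows "\<exists>G. phantom_df (completion M) (sup_with_drift Xs X \<sigma>0 c \<beta>) G \<and> continuous_on UNIV G"
proof -
  have base01: "0 \<le> base_df u" "base_df u \<le> 1" for u
    using BH.hit_prob_le_1 BH.hit_prob_nonneg by (auto simp: base_df_def)
  obtain G \<mu> where \<mu>: "real_distribution \<mu>" "G = cdf \<mu>" and cont: "continuous_on UNIV G"
    and G: "\<And>u. base_df u \<le> G u" "\<And>u. G u \<le> base_df (u + 1)"
    using continuous_df_between[of base_df, OF base_df_mono base01 base_df_limits] by metis
  interpret \<mu>: real_distribution \<mu> by fact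
  have G01: "0 \<le> G u" "G u \<le> 1" for u
    using \<mu>.cdf_nonneg \<mu>.cdf_bounded_prob by (auto simp: \<mu>)
  have Gmono: "G u \<le> G u'" if "u \<le> u'" for u u'
    using \<mu>.cdf_nondecreasing[OF that] by (simp add: \<mu>)
  have conv: "(\<lambda>n. max_df n (u n) - G (u n) ^ n) \<longlonglongrightarrow> 0" for u :: "nat \<Rightarrow> real"
  proof (rule LIMSEQ_I)
    fix e :: real assume e: "e > 0"
    define \<epsilon> where "\<epsilon> = min (1/2) (e / 4)"
    have \<epsilon>: "\<epsilon> > 0" "\<epsilon> \<le> 1/2" "4 * \<epsilon> \<le> e" using e by (auto simp: \<epsilon>_def)
    obtain R where R: "R > 0" "BX.prob (excess R) \<le> \<epsilon>" using excess_small[OF \<epsilon>(1)] by blast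
    obtain U0 where U0: "\<And>u \<omega>. u \<ge> U0 \<Longrightarrow> \<omega> \<in> space M - excess R \<Longrightarrow> \<bar>cross u \<omega> - (1 - G u)\<bar> \<le> \<epsilon> * (1 - G u)"
      using cross_close[OF small \<epsilon>(1,2) R(1) G] unfolding eventually_at_top_linorder by blast
    define U where "U = max 1 U0"
    have U: "U \<ge> U0" "U > 0" by (auto simp: U_def)
    have big: "\<bar>max_df n u - G u ^ n\<bar> \<le> 3 * \<epsilon>" if u: "u \<ge> U" and n: "n \<ge> 1" for u n
    proof -
      have u0: "u > 0" using u U by simp
      have eq: "max_df n u - G u ^ n = (\<integral>\<omega>. (1 - cross u \<omega>) ^ n - G u ^ n \<partial>M)"
        using integrable_cross n u0 by (simp add: max_df_eq BX.prob_space)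
      have "\<bar>max_df n u - G u ^ n\<bar> \<le> (\<integral>\<omega>. \<bar>(1 - cross u \<omega>) ^ n - G u ^ n\<bar> \<partial>M)"
        unfolding eq by (rule integral_abs_bound)
      also have "\<dots> \<le> (\<integral>\<omega>. 2 * \<epsilon> + indicator (excess R) \<omega> \<partial>M)"
      proof (rule integral_mono)
        show "integrable M (\<lambda>\<omega>. \<bar>(1 - cross u \<omega>) ^ n - G u ^ n\<bar>)" using integrable_cross by simp
        show "integrable M (\<lambda>\<omega>. 2 * \<epsilon> + indicator (excess R) \<omega> :: real)"
          by (intro Bochner_Integration.integrable_add integrable_real_indicator) (auto simp: BX.emeasure_eq_measure)
        fix \<omega> assume \<omega>: "\<omega> \<in> space M"
        show "\<bar>(1 - cross u \<omega>) ^ n - G u ^ n\<bar> \<le> 2 * \<epsilon> + indicator (excess R) \<omega>"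
        proof (cases "\<omega> \<in> excess R")
          case True
          have "0 \<le> (1 - cross u \<omega>) ^ n" "(1 - cross u \<omega>) ^ n \<le> 1" "0 \<le> G u ^ n" "G u ^ n \<le> 1"
            using cross_01 G01 by (auto simp: power_le_one)
          then show ?thesis using True \<epsilon> by (simp add: abs_le_iff)
        next
          case False
          then have "\<bar>(1 - cross u \<omega>) ^ n - (1 - (1 - G u)) ^ n\<bar> \<le> 2 * \<epsilon>"
            using U0[of u \<omega>] u U \<omega> cross_01 G01 \<epsilon> by (intro power_close) auto
          then show ?thesis using False by simp
        qed
      qed
      also have "\<dots> = 2 * \<epsilon> + BX.prob (excess R)"
        by (subst Bochner_Integration.integral_add) (auto simp: BX.emeasure_eq_measure BX.prob_space)
      finally show ?thesis using R by linarith
    qed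
    have "G U < 1"
    proof -
      have "BH.hit_prob (level (U + 1)) (\<lambda>_. 0) > 0"
        using s0_pos by (intro BH.hit_prob_pos[of s0]) (auto simp: time_grid_def)
      then show ?thesis using G(2)[of U] U by (auto simp: base_df_def)
    qed
    then have "(\<lambda>n. G U ^ n) \<longlonglongrightarrow> 0" using G01 by (intro LIMSEQ_realpow_zero) auto
    then have "eventually (\<lambda>n. G U ^ n < e) sequentially" using e by (rule order_tendstoD)
    moreover have "eventually (\<lambda>n. max_df n U < e) sequentially"
      using max_df_tendsto_0[OF U(2)] e by (rule order_tendstoD)
    ultimately have "eventually (\<lambda>n. norm (max_df n (u n) - G (u n) ^ n - 0) < e) sequentially"
      using eventually_ge_at_top[of "1::nat"]
    proof eventually_elim
      case (elim n)
      show ?case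
      proof (cases "u n \<ge> U")
        case True
        then show ?thesis using big[OF True elim(3)] \<epsilon> by simp
      next
        case False
        have "max_df n (u n) \<le> max_df n U" using False elim(3) by (intro max_df_mono) auto
        moreover have "G (u n) ^ n \<le> G U ^ n" using False G01 by (intro power_mono Gmono) auto
        moreover have "0 \<le> max_df n (u n)" "0 \<le> G (u n) ^ n" using max_df_nonneg G01 by auto
        ultimately show ?thesis using elim by (simp add: abs_less_iff)
      qed
    qed
    then show "\<exists>no. \<forall>n\<ge>no. norm (max_df n (u n) - G (u n) ^ n - 0) < e"
      by (simp add: eventually_sequentially)
  qed
  have "phantom_df (completion M) (sup_with_drift Xs X \<sigma>0 c \<beta>) G"
    unfolding phantom_df_def using \<mu> conv by (auto simp: max_df_def)
  then show ?thesis using cont by blast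
qed

end

theorem mainTheorem5:
  fixes M :: "'w measure" and N :: "'v measure"
    and Xs :: "nat \<Rightarrow> real \<Rightarrow> 'w \<Rightarrow> real" and X :: "real \<Rightarrow> 'w \<Rightarrow> real"
    and XH :: "real \<Rightarrow> 'v \<Rightarrow> real"
    and K :: "real \<Rightarrow> real"
    and H H0 \<sigma>0 c \<alpha> \<beta> :: real
  assumes "0 < H" "H < 1" "0 < H0" "H0 < 1" "\<sigma>0 > 0" "c > 0"
    and "self_similar_gaussian N H XH"
    and "independent_copies M Xs N XH"
    and "self_similar_gaussian M H0 X"
    and "independent_of_sequence M X Xs"
    and "0 < \<alpha> / 2" "\<alpha> / 2 < 1"
    and "regularly_varying_at_0 (\<alpha> / 2) K"
    and "locally_stationary_at N H XH K (t_zero H c \<beta>)"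
    and "\<beta> > max H H0"
  shows "(\<beta> \<ge> 2 * H - H0 \<longrightarrow>
            \<not> (\<exists>G. phantom_df (completion M) (sup_with_drift Xs X \<sigma>0 c \<beta>) G)) \<and>
         (\<beta> < 2 * H - H0 \<longrightarrow>
            (\<exists>G. phantom_df (completion M) (sup_with_drift Xs X \<sigma>0 c \<beta>) G \<and>
                 continuous_on UNIV G))"
proof -
  interpret shared_input_queues M N Xs X XH H H0 \<sigma>0 c \<beta>
    using assms by unfold_locales auto
  show ?thesis using no_phantom_df continuous_phantom_df by blast
qed

end
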